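(* Let $$V(q,t,\mathbf p,\mathbf p^\perp)=\exp\Big(\sum_{k\ge1}(q^{\frac k2}-q^{-\frac k2})\,p_k\frac{t^k}{k}\Big)\exp\Big(\sum_{k\ge1}(q^{\frac k2}-q^{-\frac k2})\,p_k^\perp\frac{t^{-k}}{k}\Big).$$ Then $$\mathcal U(x)=[t^1]\,\frac{1}{e^{\frac x2}-e^{-\frac x2}}V(e^x,t,\mathbf p,\mathbf p^\perp),\qquad \mathcal D(x)=[t^{-1}]\,\frac{1}{e^{\frac x2}-e^{-\frac x2}}V(e^x,t,\mathbf p,\mathbf p^\perp).$$
   Context: $\mathbf p=(p_1,p_2,\ldots)$ are the power sum symmetric functions (acting on symmetric functions by multiplication), $p_k^\perp=k\,\partial/\partial p_k$, $\mathbf p^\perp=(p_1^\perp,p_2^\perp,\ldots)$, and $s_\lambda$ are the Schur functions, over a field of characteristic $0$. $[t^j]$ denotes extraction of the coefficient of $t^j$. The content of a cell $\Box$ in row $i$, column $j$ of the diagram of a partition is $c(\Box)=j-i$, and $\mu=\lambda+\Box$ means that $\lambda,\mu$ are partitions and the diagram of $\mu$ is that of $\lambda$ with the single cell $\Box$ added. For $k\ge0$ the linear operators $\mathcal U_k,\mathcal D_k$ on symmetric functions are defined by $$\mathcal U_k\,s_\lambda=\sum_{\Box:\ \mu=\lambda+\Box}c(\Box)^ks_\mu,\qquad \mathcal D_k\,s_\lambda=\sum_{\Box:\ \lambda=\mu+\Box}c(\Box)^ks_\mu$$ for all partitions $\lambda$ (sums over all ways to add, respectively remove, a cell; $0^0=1$),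 and $\mathcal U(x)=\sum_{k\ge0}\mathcal U_k\frac{x^k}{k!}$, $\mathcal D(x)=\sum_{k\ge0}\mathcal D_k\frac{x^k}{k!}$. *)

theory Defs
  imports
    "HOL-Library.Poly_Mapping"
    "HOL-Computational_Algebra.Formal_Laurent_Series"
    "Jordan_Normal_Form.Determinant"
begin

section \<open>Symmetric functions\<close>

text \<open>
  Over a field \<open>K\<close> of characteristic 0 the ring of symmetric functions is the polynomial ring
  \<open>K[p_1, p_2, ...]\<close> in the power sums.  A polynomial is a finitely supported map from exponent
  vectors to coefficients.  The variables are indexed from 0: the \<open>i\<close>-th entry of an exponent
  vector is the exponent of \<open>p_(i+1)\<close>.
\<close>

type_synonym 'a symfun = "(nat \<Rightarrow>\<^sub>0 nat) \<Rightarrow>\<^sub>0 'a"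

definition scale :: "'a::field \<Rightarrow> 'a symfun \<Rightarrow> 'a symfun" where
  "scale c f = Poly_Mapping.single 0 c * f"

text \<open>Only meaningful for \<open>k \<ge> 1\<close>, as is \<open>p_perp\<close> below.\<close>

definition power_sum :: "nat \<Rightarrow> 'a::field symfun" where
  "power_sum k = Poly_Mapping.single (Poly_Mapping.single (k - 1) 1) 1"

definition partial_deriv :: "nat \<Rightarrow> 'a::field symfun \<Rightarrow> 'a symfun" where
  "partial_deriv i f =
     (\<Sum>\<alpha>\<in>Poly_Mapping.keys f.
        Poly_Mapping.single (\<alpha> - Poly_Mapping.single i 1)
          (of_nat (Poly_Mapping.lookup \<alpha> i) * Poly_Mapping.lookup f \<alpha>))"

definition p_perp :: "nat \<Rightarrow> 'a::field symfun \<Rightarrow> 'a symfun" where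
  "p_perp k f = scale (of_nat k) (partial_deriv (k - 1) f)"

text \<open>The value of a symmetric function in the \<open>n\<close> variables \<open>x 0, ..., x (n - 1)\<close>.\<close>

definition specialize :: "nat \<Rightarrow> (nat \<Rightarrow> 'a::field) \<Rightarrow> 'a symfun \<Rightarrow> 'a" where
  "specialize n x f =
     (\<Sum>\<alpha>\<in>Poly_Mapping.keys f.
        Poly_Mapping.lookup f \<alpha> *
        (\<Prod>i\<in>Poly_Mapping.keys \<alpha>. (\<Sum>j<n. x j ^ Suc i) ^ Poly_Mapping.lookup \<alpha> i))"


section \<open>Partitions and Schur functions\<close>

text \<open>Parts, rows and columns are indexed from 0.\<close>

definition is_partition :: "(nat \<Rightarrow> nat) \<Rightarrow> bool" where
  "is_partition \<nu> \<longleftrightarrow> antimono \<nu> \<and> finite {i. \<nu> i \<noteq> 0}"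

definition diagram :: "(nat \<Rightarrow> nat) \<Rightarrow> (nat \<times> nat) set" where
  "diagram \<nu> = {(i, j). j < \<nu> i}"

definition content :: "nat \<times> nat \<Rightarrow> int" where
  "content c = int (snd c) - int (fst c)"

definition add_cell :: "(nat \<Rightarrow> nat) \<Rightarrow> nat \<times> nat \<Rightarrow> (nat \<Rightarrow> nat) \<Rightarrow> bool" where
  "add_cell \<nu> c \<mu> \<longleftrightarrow>
     is_partition \<nu> \<and> is_partition \<mu> \<and> c \<notin> diagram \<nu> \<and> diagram \<mu> = insert c (diagram \<nu>)"

text \<open>
  The alternant \<open>a_(\<nu> + \<delta>)\<close> in \<open>n\<close> variables, where \<open>\<delta> = (n - 1, ..., 1, 0)\<close>.
\<close>

definition alternant :: "nat \<Rightarrow> (nat \<Rightarrow> 'a::field) \<Rightarrow> (nat \<Rightarrow> nat) \<Rightarrow> 'a" where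
  "alternant n x \<nu> = det (mat n n (\<lambda>(i, j). x i ^ (\<nu> j + (n - 1 - j))))"

text \<open>
  The Schur function is the unique symmetric function which in any number
  \<open>n \<ge> length \<nu>\<close> of variables is the quotient of alternants
  \<open>a_(\<nu> + \<delta>) / a_\<delta>\<close>.  As the field is infinite, this identity of polynomials may be
  tested on values.
\<close>

definition schur :: "(nat \<Rightarrow> nat) \<Rightarrow> 'a::field_char_0 symfun" where
  "schur \<nu> = (THE f. \<forall>n x. (\<forall>i\<ge>n. \<nu> i = 0) \<longrightarrow>
     specialize n x f * alternant n x (\<lambda>_. 0) = alternant n x \<nu>)"


section \<open>The operators \<open>U_k\<close> and \<open>D_k\<close>\<close>

text \<open>Well defined because the Schur functions form a basis.\<close>

definition U_op :: "nat \<Rightarrow> 'a::field_char_0 symfun \<Rightarrow> 'a symfun" where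
  "U_op k = (THE T. Vector_Spaces.linear scale scale T \<and>
     (\<forall>\<nu>. is_partition \<nu> \<longrightarrow>
        T (schur \<nu>) =
          (\<Sum>(c, \<mu>)\<in>{(c, \<mu>). add_cell \<nu> c \<mu>}. scale (of_int (content c) ^ k) (schur \<mu>))))"

definition D_op :: "nat \<Rightarrow> 'a::field_char_0 symfun \<Rightarrow> 'a symfun" where
  "D_op k = (THE T. Vector_Spaces.linear scale scale T \<and>
     (\<forall>\<nu>. is_partition \<nu> \<longrightarrow>
        T (schur \<nu>) =
          (\<Sum>(c, \<mu>)\<in>{(c, \<mu>). add_cell \<mu> c \<nu>}. scale (of_int (content c) ^ k) (schur \<mu>))))"

text \<open>
  \<open>U(x)\<close> and \<open>D(x)\<close>, applied to a symmetric function, are power series in \<open>x\<close> with symmetric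
  functions as coefficients.
\<close>

definition U_series :: "'a::field_char_0 symfun \<Rightarrow> 'a symfun fps" where
  "U_series f = Abs_fps (\<lambda>k. scale (1 / fact k) (U_op k f))"

definition D_series :: "'a::field_char_0 symfun \<Rightarrow> 'a symfun fps" where
  "D_series f = Abs_fps (\<lambda>k. scale (1 / fact k) (D_op k f))"


section \<open>The vertex operator\<close>

text \<open>
  A sequence \<open>A\<close> of operators stands for the series \<open>\<Sum>k. A k * z ^ k\<close>; \<open>op_power A n m\<close> is
  the coefficient of \<open>z ^ m\<close> in its \<open>n\<close>-th power.  If \<open>A 0 = 0\<close>, only the powers \<open>n \<le> m\<close>
  contribute to the coefficient of \<open>z ^ m\<close> in its exponential.
\<close>

primrec op_power ::
    "(nat \<Rightarrow> 'a::field symfun \<Rightarrow> 'a symfun) \<Rightarrow> nat \<Rightarrow> nat \<Rightarrow> 'a symfun \<Rightarrow> 'a symfun" where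
  "op_power A 0 m f = (if m = 0 then f else 0)"
| "op_power A (Suc n) m f = (\<Sum>i\<le>m. A i (op_power A n (m - i) f))"

definition op_exp ::
    "(nat \<Rightarrow> 'a::field_char_0 symfun \<Rightarrow> 'a symfun) \<Rightarrow> nat \<Rightarrow> 'a symfun \<Rightarrow> 'a symfun" where
  "op_exp A m f = (\<Sum>n\<le>m. scale (1 / fact n) (op_power A n m f))"

text \<open>
  The parameter \<open>r\<close> is the square root \<open>q ^ (1/2)\<close>.  The series \<open>V_plus\<close> is in \<open>t\<close>, the
  series \<open>V_minus\<close> in \<open>1 / t\<close>.
\<close>

definition V_plus :: "'a::field \<Rightarrow> nat \<Rightarrow> 'a symfun \<Rightarrow> 'a symfun" where
  "V_plus r k f =
     (if k = 0 then 0 else scale ((r ^ k - inverse r ^ k) / of_nat k) (power_sum k * f))"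

definition V_minus :: "'a::field \<Rightarrow> nat \<Rightarrow> 'a symfun \<Rightarrow> 'a symfun" where
  "V_minus r k f =
     (if k = 0 then 0 else scale ((r ^ k - inverse r ^ k) / of_nat k) (p_perp k f))"

text \<open>
  The coefficient of \<open>t ^ j\<close> in \<open>V\<close>.  The sum over \<open>n\<close> is finite, since \<open>op_exp (V_minus r) n\<close>
  lowers the degree by \<open>n\<close> (where \<open>p_k\<close> has degree \<open>k\<close>).
\<close>

definition V_coeff :: "'a::field_char_0 \<Rightarrow> int \<Rightarrow> 'a symfun \<Rightarrow> 'a symfun" where
  "V_coeff r j f =
     Sum_any (\<lambda>n. if j + int n \<ge> 0
                  then op_exp (V_plus r) (nat (j + int n)) (op_exp (V_minus r) n f)
                  else 0)"


section \<open>Extension of scalars to Laurent series in \<open>x\<close>\<close>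

definition extend_scalars :: "'a::field_char_0 symfun \<Rightarrow> 'a fls symfun" where
  "extend_scalars f = Poly_Mapping.map fls_const f"

text \<open>
  The inclusion of \<open>K((x))[p_1, p_2, ...]\<close> into \<open>K[p_1, p_2, ...]((x))\<close>: the coefficient of
  \<open>x ^ n\<close> is taken in each of the finitely many coefficients of the polynomial.
\<close>

definition laurent_expand :: "'a::field_char_0 fls symfun \<Rightarrow> 'a symfun fls" where
  "laurent_expand g = Abs_fls (\<lambda>n. Poly_Mapping.map (\<lambda>c. fls_nth c n) g)"

text \<open>The element \<open>exp (c * x)\<close> of \<open>K((x))\<close>.\<close>

definition exp_x :: "'a::field_char_0 \<Rightarrow> 'a fls" where
  "exp_x c = fps_to_fls (fps_exp c)"

end

theory Submission
  imports Defs
begin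

text \<open>
  Let \<open>r\<close> be a square root of \<open>q\<close>, and evaluate symmetric functions in \<open>N\<close> variables \<open>x_i\<close>. The
  right factor of \<open>V\<close> is the translation \<open>p_k \<mapsto> p_k + (r^k - r^-k) t^-k\<close>, so it turns \<open>f\<close> into a
  polynomial \<open>F\<close> in \<open>1/t\<close> (\<open>specialize_op_exp_V_minus\<close>). The left factor is multiplication by the
  rational function \<open>\<Prod>i. (1 - x_i t / r) / (1 - r x_i t)\<close> (\<open>specialize_op_exp_V_plus\<close>). Its poles
  are simple, and at the pole \<open>1/t = r x_i\<close> the translation replaces the variable \<open>x_i\<close> by
  \<open>q x_i\<close>. Extracting the coefficient of \<open>t\<close> by partial fractions therefore gives a \<open>q\<close>-difference
  operator, a weighted sum of the values of \<open>f\<close> at the points where one \<open>x_i\<close> is replaced by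
  \<open>q x_i\<close> (\<open>specialize_V_coeff_1\<close>). The weights are quotients of Vandermonde determinants: times
  \<open>a_\<delta>(x)\<close>, the weight at \<open>i\<close> is a constant times \<open>a_\<delta>\<close> at the shifted point
  (\<open>residue_weight_alternant\<close>).

  Let \<open>f = s_\<lambda>\<close> and multiply by \<open>a_\<delta>(x)\<close>. Up to a constant, only
  \<open>\<Sum>i. x_i a_(\<lambda>+\<delta>)(..., q x_i, ...)\<close> remains. An operator of this kind acts on a determinant
  exponent by exponent (\<open>alternant_operator\<close>), so the result is
  \<open>\<Sum>j. q^(\<lambda>_j + N - 1 - j) a_(\<lambda>+\<epsilon>_j+\<delta>)\<close>. Terms where no cell can be added to row \<open>j\<close> have two
  equal columns; in the others, the constant of the weights corrects the exponent of \<open>q\<close> to the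
  content \<open>\<lambda>_j - j\<close> of the new cell. With \<open>q = e^x\<close> this is \<open>U(x)\<close>. For the coefficient of \<open>1/t\<close>
  the same computation lowers exponents, and the constant of the partial fractions contributes a
  multiple of \<open>\<partial>f/\<partial>p_1\<close>, which cancels the terms with the exponent \<open>-1\<close>
  (\<open>specialize_V_coeff_minus_1_represents\<close>).

  The operators and the Schur functions are given by descriptions, so existence and uniqueness are
  part of the proof. Values determine a symmetric function (\<open>symfun_eqI\<close>). Schur functions exist
  because the formula above, for several values of \<open>q\<close>, isolates the Schur function of each
  partition with one more cell (\<open>represents_add_cell\<close>). They span because their span contains 1
  and is closed under multiplication by power sums, by the Murnaghan-Nakayama rule
  (\<open>schur_span_power_sum_mult_schur\<close>). Finally, the formula is applied over the field \<open>K((x))\<close> at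
  points with constant coordinates. It needs the values of \<open>s_\<lambda>\<close> at the shifted, nonconstant
  points, so the defining identity of \<open>s_\<lambda>\<close> is first extended from \<open>K\<close> to \<open>K((x))\<close>
  (\<open>represents_extend_scalars\<close>).
\<close>

section \<open>Evaluation of symmetric functions\<close>

definition monomial_value :: "(nat \<Rightarrow> 'b::comm_ring_1) \<Rightarrow> (nat \<Rightarrow>\<^sub>0 nat) \<Rightarrow> 'b" where
  "monomial_value \<phi> \<alpha> = (\<Prod>i\<in>Poly_Mapping.keys \<alpha>. \<phi> i ^ Poly_Mapping.lookup \<alpha> i)"

text \<open>
  The substitution \<open>p_(i+1) \<mapsto> \<phi> i\<close>. The coefficients go through \<open>h\<close> because values are taken in
  the field \<open>K\<close> and in \<open>K[z]\<close>.
\<close>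

definition evaluate ::
    "('a::field \<Rightarrow> 'b::comm_ring_1) \<Rightarrow> (nat \<Rightarrow> 'b) \<Rightarrow> 'a symfun \<Rightarrow> 'b" where
  "evaluate h \<phi> f =
     (\<Sum>\<alpha>\<in>Poly_Mapping.keys f. h (Poly_Mapping.lookup f \<alpha>) * monomial_value \<phi> \<alpha>)"

lemma specialize_eq_evaluate:
  "specialize n x f = evaluate (\<lambda>c. c) (\<lambda>i. \<Sum>j<n. x j ^ Suc i) f"
  by (simp add: specialize_def evaluate_def monomial_value_def)

lemma symfun_induct [case_names single add]:
  fixes f :: "'b \<Rightarrow>\<^sub>0 'c::comm_monoid_add"
  assumes single: "\<And>\<alpha> c. P (Poly_Mapping.single \<alpha> c)"
    and add: "\<And>f g. P f \<Longrightarrow> P g \<Longrightarrow> P (f + g)"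
  shows "P f"
proof (induction f rule: Poly_Mapping.update_induct)
  case const
  show ?case using single[of undefined 0] by simp
next
  case (update f a b)
  have "Poly_Mapping.update a b f = Poly_Mapping.single a b + f"
    by (rule poly_mapping_eqI)
       (use update(1) in \<open>auto simp: lookup_update lookup_add lookup_single when_def in_keys_iff\<close>)
  then show ?case using add[OF single update(3)] by simp
qed

lemma monomial_value_superset:
  assumes "finite S" "Poly_Mapping.keys \<alpha> \<subseteq> S"
  shows "monomial_value \<phi> \<alpha> = (\<Prod>i\<in>S. \<phi> i ^ Poly_Mapping.lookup \<alpha> i)"
  unfolding monomial_value_def
  by (rule prod.mono_neutral_left) (use assms in \<open>auto simp: in_keys_iff\<close>)

lemma monomial_value_add: "monomial_value \<phi> (\<alpha> + \<beta>) = monomial_value \<phi> \<alpha> * monomial_value \<phi> \<beta>"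
proof -
  let ?S = "Poly_Mapping.keys \<alpha> \<union> Poly_Mapping.keys \<beta>"
  have "Poly_Mapping.keys (\<alpha> + \<beta>) \<subseteq> ?S" by (rule Poly_Mapping.keys_add)
  then show ?thesis
    by (simp add: monomial_value_superset[of ?S] lookup_add power_add prod.distrib)
qed

lemma monomial_value_0 [simp]: "monomial_value \<phi> 0 = 1"
  by (simp add: monomial_value_def)

lemma monomial_value_single [simp]: "monomial_value \<phi> (Poly_Mapping.single i k) = \<phi> i ^ k"
  by (simp add: monomial_value_def)

context
  fixes hom :: "'a::field \<Rightarrow> 'b::comm_ring_1"
  assumes hom: "comm_ring_hom hom"
begin

interpretation comm_ring_hom hom by (rule hom)

lemma evaluate_superset:
  assumes "finite S" "Poly_Mapping.keys f \<subseteq> S"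
  shows "evaluate hom \<phi> f = (\<Sum>\<alpha>\<in>S. hom (Poly_Mapping.lookup f \<alpha>) * monomial_value \<phi> \<alpha>)"
  unfolding evaluate_def
  by (rule sum.mono_neutral_left) (use assms in \<open>auto simp: in_keys_iff\<close>)

lemma evaluate_add: "evaluate hom \<phi> (f + g) = evaluate hom \<phi> f + evaluate hom \<phi> g"
proof -
  let ?S = "Poly_Mapping.keys f \<union> Poly_Mapping.keys g"
  have "Poly_Mapping.keys (f + g) \<subseteq> ?S" by (rule Poly_Mapping.keys_add)
  then show ?thesis
    by (simp add: evaluate_superset[of ?S] lookup_add hom_add distrib_right sum.distrib)
qed

lemma evaluate_single:
  "evaluate hom \<phi> (Poly_Mapping.single \<alpha> c) = hom c * monomial_value \<phi> \<alpha>"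
  by (cases "c = 0") (simp_all add: evaluate_def)

lemma evaluate_0 [simp]: "evaluate hom \<phi> 0 = 0"
  by (simp add: evaluate_def)

lemma evaluate_sum: "evaluate hom \<phi> (sum F A) = (\<Sum>a\<in>A. evaluate hom \<phi> (F a))"
  by (induction A rule: infinite_finite_induct) (simp_all add: evaluate_add)

lemma evaluate_mult: "evaluate hom \<phi> (f * g) = evaluate hom \<phi> f * evaluate hom \<phi> g"
proof (induction f rule: symfun_induct)
  case (single \<alpha> c)
  show ?case
    by (induction g rule: symfun_induct)
       (simp_all add: evaluate_single evaluate_add mult_single monomial_value_add hom_mult
          distrib_left algebra_simps)
next
  case (add f1 f2)
  then show ?case by (simp add: distrib_right evaluate_add)
qed

lemma evaluate_scale: "evaluate hom \<phi> (scale c f) = hom c * evaluate hom \<phi> f"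
  by (simp add: scale_def evaluate_mult evaluate_single)

lemma evaluate_power_sum: "k \<ge> 1 \<Longrightarrow> evaluate hom \<phi> (power_sum k) = \<phi> (k - 1)"
  by (simp add: power_sum_def evaluate_single)

end

lemma comm_ring_hom_id: "comm_ring_hom (\<lambda>c::'a::comm_ring_1. c)"
  by unfold_locales auto

lemma comm_ring_hom_const_poly: "comm_ring_hom (\<lambda>c::'a::comm_ring_1. [:c:])"
  by unfold_locales auto

lemma comm_ring_hom_fls_const: "comm_ring_hom (fls_const :: 'a::comm_ring_1 \<Rightarrow> 'a fls)"
  by unfold_locales (auto simp: fls_plus_const)

lemma specialize_add: "specialize n x (f + g) = specialize n x f + specialize n x g"
  unfolding specialize_eq_evaluate by (rule evaluate_add[OF comm_ring_hom_id])

lemma specialize_0 [simp]: "specialize n x 0 = 0"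
  unfolding specialize_eq_evaluate by (rule evaluate_0[OF comm_ring_hom_id])

lemma specialize_sum: "specialize n x (sum F A) = (\<Sum>a\<in>A. specialize n x (F a))"
  unfolding specialize_eq_evaluate by (rule evaluate_sum[OF comm_ring_hom_id])

lemma specialize_mult: "specialize n x (f * g) = specialize n x f * specialize n x g"
  unfolding specialize_eq_evaluate by (rule evaluate_mult[OF comm_ring_hom_id])

lemma specialize_scale: "specialize n x (scale c f) = c * specialize n x f"
  unfolding specialize_eq_evaluate by (rule evaluate_scale[OF comm_ring_hom_id])

lemma specialize_power_sum:
  "k \<ge> 1 \<Longrightarrow> specialize n x (power_sum k) = (\<Sum>j<n. x j ^ k)"
  unfolding specialize_eq_evaluate
  by (subst evaluate_power_sum[OF comm_ring_hom_id]) auto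

lemma specialize_1 [simp]: "specialize n x 1 = 1"
  using evaluate_single[OF comm_ring_hom_id, of _ 0 1]
  by (simp add: specialize_eq_evaluate)

lemma specialize_uminus: "specialize n x (- f) = - specialize n x f"
  using specialize_add[where f=f and g="- f"] by (simp add: eq_neg_iff_add_eq_0 add.commute)

lemma specialize_diff: "specialize n x (f - g) = specialize n x f - specialize n x g"
  using specialize_add[where f=f and g="- g"] by (simp add: specialize_uminus)

lemma poly_evaluate:
  "poly (evaluate (\<lambda>c. [:c:]) \<Phi> f) y = evaluate (\<lambda>c. c) (\<lambda>i. poly (\<Phi> i) y) f"
  by (simp add: evaluate_def monomial_value_def poly_sum poly_prod poly_power)

lemma scale_0 [simp]: "scale c 0 = 0" by (simp add: scale_def)
lemma scale_0_left [simp]: "scale 0 f = 0" by (simp add: scale_def)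
lemma scale_1 [simp]: "scale 1 f = f" by (simp add: scale_def)
lemma scale_add: "scale c (f + g) = scale c f + scale c g" by (simp add: scale_def distrib_left)
lemma scale_add_left: "scale (c + d) f = scale c f + scale d f"
  by (simp add: scale_def single_add distrib_right)
lemma scale_scale: "scale c (scale d f) = scale (c * d) f"
  by (simp add: scale_def mult.assoc[symmetric] mult_single)
lemma scale_sum: "scale c (sum F A) = (\<Sum>a\<in>A. scale c (F a))"
  by (simp add: scale_def sum_distrib_left)
lemma lookup_scale: "Poly_Mapping.lookup (scale c f) \<alpha> = c * Poly_Mapping.lookup f \<alpha>"
proof (induction f rule: symfun_induct)
  case (single \<beta> d)
  show ?case by (simp add: scale_def mult_single lookup_single when_def)
next
  case (add f g)
  then show ?case by (simp add: scale_add lookup_add distrib_left)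
qed

lemma vector_space_scale: "vector_space (scale :: 'a::field \<Rightarrow> _)"
  by unfold_locales (simp_all add: scale_add scale_add_left scale_scale)

subsection \<open>Partial derivatives\<close>

lemma partial_deriv_superset:
  assumes "finite S" "Poly_Mapping.keys f \<subseteq> S"
  shows "partial_deriv i f =
     (\<Sum>\<alpha>\<in>S. Poly_Mapping.single (\<alpha> - Poly_Mapping.single i 1)
          (of_nat (Poly_Mapping.lookup \<alpha> i) * Poly_Mapping.lookup f \<alpha>))"
  unfolding partial_deriv_def
  by (rule sum.mono_neutral_left) (use assms in \<open>auto simp: in_keys_iff\<close>)

lemma partial_deriv_add: "partial_deriv i (f + g) = partial_deriv i f + partial_deriv i g"
proof -
  let ?S = "Poly_Mapping.keys f \<union> Poly_Mapping.keys g"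
  have "Poly_Mapping.keys (f + g) \<subseteq> ?S" by (rule Poly_Mapping.keys_add)
  then show ?thesis
    by (simp add: partial_deriv_superset[of ?S] lookup_add distrib_left sum.distrib single_add)
qed

lemma partial_deriv_single:
  "partial_deriv i (Poly_Mapping.single \<alpha> c) =
     Poly_Mapping.single (\<alpha> - Poly_Mapping.single i 1) (of_nat (Poly_Mapping.lookup \<alpha> i) * c)"
  by (cases "c = 0") (simp_all add: partial_deriv_def)

lemma partial_deriv_0 [simp]: "partial_deriv i 0 = 0"
  by (simp add: partial_deriv_def)

lemma partial_deriv_scale: "partial_deriv i (scale c f) = scale c (partial_deriv i f)"
proof (induction f rule: symfun_induct)
  case (single \<alpha> d)
  show ?case by (simp add: scale_def mult_single partial_deriv_single mult.left_commute)
next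
  case (add f g)
  then show ?case by (simp add: scale_add partial_deriv_add)
qed

lemma partial_deriv_commute:
  "partial_deriv i (partial_deriv j f) = partial_deriv j (partial_deriv i f)"
proof (induction f rule: symfun_induct)
  case (single \<alpha> c)
  have "\<alpha> - Poly_Mapping.single j 1 - Poly_Mapping.single i 1 =
        \<alpha> - Poly_Mapping.single i 1 - Poly_Mapping.single j (1::nat)"
    by (rule poly_mapping_eqI) (simp add: lookup_minus)
  moreover have "of_nat (Poly_Mapping.lookup (\<alpha> - Poly_Mapping.single j 1) i) * of_nat (Poly_Mapping.lookup \<alpha> j) =
     (of_nat (Poly_Mapping.lookup (\<alpha> - Poly_Mapping.single i 1) j) * of_nat (Poly_Mapping.lookup \<alpha> i) :: 'a)"
    by (cases "i = j") (auto simp: lookup_minus lookup_single when_def mult.commute)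
  ultimately show ?case by (simp add: partial_deriv_single mult.assoc[symmetric])
next
  case (add f g)
  then show ?case by (simp add: partial_deriv_add)
qed

lemma lookup_partial_deriv:
  "Poly_Mapping.lookup (partial_deriv i f) \<alpha> =
   of_nat (Suc (Poly_Mapping.lookup \<alpha> i)) * Poly_Mapping.lookup f (\<alpha> + Poly_Mapping.single i 1)"
proof (induction f rule: symfun_induct)
  case (single \<beta> c)
  have "\<beta> - Poly_Mapping.single i 1 = \<alpha> \<longleftrightarrow> \<beta> = \<alpha> + Poly_Mapping.single i 1"
    if "Poly_Mapping.lookup \<beta> i \<noteq> 0"
  proof -
    have "\<beta> = \<beta> - Poly_Mapping.single i 1 + Poly_Mapping.single i 1"
      by (rule poly_mapping_eqI)
         (use that in \<open>auto simp: lookup_add lookup_minus lookup_single when_def\<close>)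
    then show ?thesis by (metis add_diff_cancel_right')
  qed
  then show ?case
    by (cases "Poly_Mapping.lookup \<beta> i = 0")
       (auto simp: partial_deriv_single lookup_single when_def lookup_add)
next
  case (add f g)
  then show ?case by (simp add: partial_deriv_add lookup_add distrib_left)
qed

lemma pderiv_monomial_value:
  fixes \<Phi> :: "nat \<Rightarrow> 'a::field poly"
  assumes "finite S" "Poly_Mapping.keys \<alpha> \<subseteq> S"
  shows "pderiv (monomial_value \<Phi> \<alpha>) =
    (\<Sum>i\<in>S. of_nat (Poly_Mapping.lookup \<alpha> i) *
        (pderiv (\<Phi> i) * monomial_value \<Phi> (\<alpha> - Poly_Mapping.single i 1)))"
proof -
  have *: "monomial_value \<Phi> (\<alpha> - Poly_Mapping.single i 1) =
      \<Phi> i ^ (Poly_Mapping.lookup \<alpha> i - 1) * (\<Prod>k\<in>S - {i}. \<Phi> k ^ Poly_Mapping.lookup \<alpha> k)"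
    if "i \<in> S" for i
  proof -
    have "Poly_Mapping.keys (\<alpha> - Poly_Mapping.single i 1) \<subseteq> S"
      using assms(2) by (auto simp: in_keys_iff lookup_minus)
    then have "monomial_value \<Phi> (\<alpha> - Poly_Mapping.single i 1) =
       (\<Prod>k\<in>S. \<Phi> k ^ Poly_Mapping.lookup (\<alpha> - Poly_Mapping.single i 1) k)"
      by (rule monomial_value_superset[OF assms(1)])
    also have "\<dots> = \<Phi> i ^ (Poly_Mapping.lookup \<alpha> i - 1) *
        (\<Prod>k\<in>S - {i}. \<Phi> k ^ Poly_Mapping.lookup (\<alpha> - Poly_Mapping.single i 1) k)"
      by (subst prod.remove[OF assms(1) that]) (simp add: lookup_minus)
    also have "(\<Prod>k\<in>S - {i}. \<Phi> k ^ Poly_Mapping.lookup (\<alpha> - Poly_Mapping.single i 1) k) =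
       (\<Prod>k\<in>S - {i}. \<Phi> k ^ Poly_Mapping.lookup \<alpha> k)"
      by (rule prod.cong) (auto simp: lookup_minus lookup_single when_def)
    finally show ?thesis .
  qed
  show ?thesis
    unfolding monomial_value_superset[OF assms] pderiv_prod
    by (rule sum.cong) (simp_all add: * pderiv_power mult_ac of_nat_poly del: One_nat_def)
qed

text \<open>
  The chain rule, for power sums that depend polynomially on one parameter. Only the indices in
  \<open>S\<close> can contribute, since \<open>f\<close> does not involve the other variables.
\<close>

lemma pderiv_evaluate:
  fixes \<Phi> :: "nat \<Rightarrow> 'a::field poly"
  assumes "finite S" "\<And>\<alpha>. \<alpha> \<in> Poly_Mapping.keys f \<Longrightarrow> Poly_Mapping.keys \<alpha> \<subseteq> S"
  shows "pderiv (evaluate (\<lambda>c. [:c:]) \<Phi> f) =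
    (\<Sum>i\<in>S. pderiv (\<Phi> i) * evaluate (\<lambda>c. [:c:]) \<Phi> (partial_deriv i f))"
proof -
  have "evaluate (\<lambda>c. [:c:]) \<Phi> (partial_deriv i f) =
     (\<Sum>\<alpha>\<in>Poly_Mapping.keys f. [:Poly_Mapping.lookup f \<alpha>:] *
          (of_nat (Poly_Mapping.lookup \<alpha> i) * monomial_value \<Phi> (\<alpha> - Poly_Mapping.single i 1)))" for i
    unfolding partial_deriv_def
    by (simp add: evaluate_sum[OF comm_ring_hom_const_poly]
         evaluate_single[OF comm_ring_hom_const_poly] of_nat_poly mult.commute)
  moreover have "pderiv (evaluate (\<lambda>c. [:c:]) \<Phi> f) =
     (\<Sum>\<alpha>\<in>Poly_Mapping.keys f. [:Poly_Mapping.lookup f \<alpha>:] *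
        (\<Sum>i\<in>S. of_nat (Poly_Mapping.lookup \<alpha> i) *
        (pderiv (\<Phi> i) * monomial_value \<Phi> (\<alpha> - Poly_Mapping.single i 1))))"
    unfolding evaluate_def
    by (simp add: higher_pderiv_sum[of 1, simplified] pderiv_smult pderiv_monomial_value[OF assms(1,2)])
  ultimately show ?thesis
    by (simp only: sum_distrib_left sum.swap[of _ S] mult.assoc mult.left_commute)
qed

section \<open>Functions polynomial in each coordinate\<close>

text \<open>
  Formally weaker than being a polynomial in \<open>n\<close> variables, but enough for the identity theorem
  below, and immediate for every expression built from the coordinates.
\<close>

definition coordinatewise_poly :: "nat \<Rightarrow> ((nat \<Rightarrow> 'a::field) \<Rightarrow> 'a) \<Rightarrow> bool" where
  "coordinatewise_poly n g \<longleftrightarrow> (\<forall>x. \<forall>i<n. \<exists>P. \<forall>z. g (x(i := z)) = poly P z)"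

lemma coordinatewise_poly_const: "coordinatewise_poly n (\<lambda>_. c)"
  unfolding coordinatewise_poly_def by (auto intro!: exI[of _ "[:c:]"])

lemma coordinatewise_poly_coord: "coordinatewise_poly n (\<lambda>x. x j)"
  unfolding coordinatewise_poly_def
proof (intro allI impI)
  fix x :: "nat \<Rightarrow> 'a" and i
  show "\<exists>P. \<forall>z. (x(i := z)) j = poly P z"
    by (cases "i = j") (auto intro: exI[of _ "[:0, 1:]"] exI[of _ "[:x j:]"])
qed

lemma coordinatewise_poly_add:
  assumes "coordinatewise_poly n g" "coordinatewise_poly n h"
  shows "coordinatewise_poly n (\<lambda>x. g x + h x)"
  unfolding coordinatewise_poly_def
proof (intro allI impI)
  fix x :: "nat \<Rightarrow> 'a" and i
  assume "i < n"
  then obtain P Q where "\<forall>z. g (x(i := z)) = poly P z" "\<forall>z. h (x(i := z)) = poly Q z"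
    using assms unfolding coordinatewise_poly_def by metis
  then show "\<exists>P. \<forall>z. g (x(i := z)) + h (x(i := z)) = poly P z"
    by (intro exI[of _ "P + Q"]) simp
qed

lemma coordinatewise_poly_mult:
  assumes "coordinatewise_poly n g" "coordinatewise_poly n h"
  shows "coordinatewise_poly n (\<lambda>x. g x * h x)"
  unfolding coordinatewise_poly_def
proof (intro allI impI)
  fix x :: "nat \<Rightarrow> 'a" and i
  assume "i < n"
  then obtain P Q where "\<forall>z. g (x(i := z)) = poly P z" "\<forall>z. h (x(i := z)) = poly Q z"
    using assms unfolding coordinatewise_poly_def by metis
  then show "\<exists>P. \<forall>z. g (x(i := z)) * h (x(i := z)) = poly P z"
    by (intro exI[of _ "P * Q"]) simp
qed

lemma coordinatewise_poly_diff:
  assumes "coordinatewise_poly n g" "coordinatewise_poly n h"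
  shows "coordinatewise_poly n (\<lambda>x. g x - h x)"
  using coordinatewise_poly_add[OF assms(1)
      coordinatewise_poly_mult[OF coordinatewise_poly_const[of n "-1"] assms(2)]] by simp

lemma coordinatewise_poly_sum:
  "(\<And>a. a \<in> A \<Longrightarrow> coordinatewise_poly n (g a)) \<Longrightarrow> coordinatewise_poly n (\<lambda>x. \<Sum>a\<in>A. g a x)"
  by (induction A rule: infinite_finite_induct)
     (simp_all add: coordinatewise_poly_const coordinatewise_poly_add)

lemma coordinatewise_poly_prod:
  "(\<And>a. a \<in> A \<Longrightarrow> coordinatewise_poly n (g a)) \<Longrightarrow> coordinatewise_poly n (\<lambda>x. \<Prod>a\<in>A. g a x)"
  by (induction A rule: infinite_finite_induct)
     (simp_all add: coordinatewise_poly_const coordinatewise_poly_mult)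

lemma coordinatewise_poly_power:
  "coordinatewise_poly n g \<Longrightarrow> coordinatewise_poly n (\<lambda>x. g x ^ k)"
  by (induction k) (simp_all add: coordinatewise_poly_const coordinatewise_poly_mult)

lemmas coordinatewise_poly_intros =
  coordinatewise_poly_const coordinatewise_poly_coord coordinatewise_poly_add
  coordinatewise_poly_mult coordinatewise_poly_diff coordinatewise_poly_sum
  coordinatewise_poly_prod coordinatewise_poly_power

text \<open>
  The identity theorem. The coordinates of an arbitrary point are freed one after the other: if
  the coordinates from \<open>k\<close> on are distinct elements of \<open>S\<close>, then the polynomial in coordinate \<open>k\<close>
  vanishes on \<open>S\<close> minus finitely many elements. That only points with distinct coordinates have to
  be tested matters because there the Vandermonde alternant is not zero.
\<close>

lemma coordinatewise_poly_eq_0: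
  fixes g :: "(nat \<Rightarrow> 'a::field) \<Rightarrow> 'a"
  assumes g: "coordinatewise_poly n g" and S: "infinite S"
    and zero: "\<And>x. inj_on x {..<n} \<Longrightarrow> x ` {..<n} \<subseteq> S \<Longrightarrow> g x = 0"
  shows "g x = 0"
proof -
  have "\<forall>x. inj_on x {k..<n} \<and> x ` {k..<n} \<subseteq> S \<longrightarrow> g x = 0" if "k \<le> n" for k
    using that
  proof (induction k)
    case 0
    then show ?case using zero by (simp add: atLeast0LessThan)
  next
    case (Suc k)
    show ?case
    proof (intro allI impI)
      fix x assume x: "inj_on x {Suc k..<n} \<and> x ` {Suc k..<n} \<subseteq> S"
      have k: "k < n" using Suc.prems by simp
      then obtain P where P: "\<forall>z. g (x(k := z)) = poly P z"
        using g unfolding coordinatewise_poly_def by blast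
      have split: "{k..<n} = insert k {Suc k..<n}" using k by auto
      have "poly P z = 0" if z: "z \<in> S - x ` {Suc k..<n}" for z
      proof -
        have "inj_on (x(k := z)) {k..<n}"
          unfolding split using x z by (auto simp: inj_on_def)
        moreover have "(x(k := z)) ` {k..<n} \<subseteq> S"
          unfolding split using x z by auto
        ultimately have "g (x(k := z)) = 0" using Suc.IH k by simp
        then show ?thesis using P by simp
      qed
      then have sub: "S - x ` {Suc k..<n} \<subseteq> {z. poly P z = 0}" by blast
      moreover have "infinite (S - x ` {Suc k..<n})" using S by (simp add: Diff_infinite_finite)
      ultimately have "infinite {z. poly P z = 0}" using infinite_super by blast
      then have "P = 0" using poly_roots_finite by blast
      then have "g (x(k := x k)) = 0" using P by (metis poly_0)
      then show "g x = 0" by simp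
    qed
  qed
  from this[of n] show ?thesis by simp
qed

lemma coordinatewise_poly_specialize:
  "coordinatewise_poly n (\<lambda>x. specialize m x f)"
  unfolding specialize_def by (intro coordinatewise_poly_intros)

section \<open>Determinants\<close>

text \<open>
  In the Leibniz expansion both sides sum, over all permutations \<open>p\<close> and all positions \<open>(i, p i)\<close>,
  the product in which the factor at this one position is taken from \<open>M'\<close>. This turns operators
  that act on one variable (a row of an alternant) at a time into operators that act on one
  exponent (a column) at a time.
\<close>

lemma det_replace_rows_eq_replace_columns:
  fixes M M' :: "nat \<Rightarrow> nat \<Rightarrow> 'a::comm_ring_1"
  shows "(\<Sum>i<n. det (mat n n (\<lambda>(a, b). if a = i then M' a b else M a b))) =
         (\<Sum>j<n. det (mat n n (\<lambda>(a, b). if b = j then M' a b else M a b)))"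
proof -
  let ?P = "{p. p permutes {0..<n}}"
  have pl: "p a < n" if "p \<in> ?P" "a < n" for p a
    using that permutes_in_image[of p "{0..<n}" a] by auto
  have rows: "det (mat n n (\<lambda>(a, b). if a = i then M' a b else M a b)) =
      (\<Sum>p\<in>?P. signof p * (\<Prod>a = 0..<n. if a = i then M' a (p a) else M a (p a)))" for i
    by (subst det_def'[of _ n]) (auto intro!: sum.cong prod.cong simp: pl)
  have cols: "det (mat n n (\<lambda>(a, b). if b = j then M' a b else M a b)) =
      (\<Sum>p\<in>?P. signof p * (\<Prod>a = 0..<n. if p a = j then M' a (p a) else M a (p a)))" for j
    by (subst det_def'[of _ n]) (auto intro!: sum.cong prod.cong simp: pl)
  have "(\<Sum>j<n. \<Prod>a = 0..<n. if p a = j then M' a (p a) else M a (p a)) =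
        (\<Sum>i<n. \<Prod>a = 0..<n. if a = i then M' a (p a) else M a (p a))" if p: "p \<in> ?P" for p
  proof -
    have "bij_betw p {..<n} {..<n}"
      using p permutes_imp_bij[of p "{0..<n}"] by (simp add: atLeast0LessThan)
    then have "(\<Sum>j<n. \<Prod>a = 0..<n. if p a = j then M' a (p a) else M a (p a)) =
       (\<Sum>i<n. \<Prod>a = 0..<n. if p a = p i then M' a (p a) else M a (p a))"
      by (rule sum.reindex_bij_betw[symmetric])
    also have "\<dots> = (\<Sum>i<n. \<Prod>a = 0..<n. if a = i then M' a (p a) else M a (p a))"
      using p by (auto simp: inj_eq permutes_inj)
    finally show ?thesis .
  qed
  then have "(\<Sum>p\<in>?P. signof p * (\<Sum>i<n. \<Prod>a = 0..<n. if a = i then M' a (p a) else M a (p a))) =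
     (\<Sum>p\<in>?P. signof p * (\<Sum>j<n. \<Prod>a = 0..<n. if p a = j then M' a (p a) else M a (p a)))"
    by (intro sum.cong) auto
  then show ?thesis
    unfolding rows cols by (simp add: sum_distrib_left sum.swap[of _ ?P])
qed

lemma det_equal_columns:
  fixes M :: "nat \<Rightarrow> nat \<Rightarrow> 'a::comm_ring_1"
  assumes "j < n" "k < n" "j \<noteq> k" "\<And>i. i < n \<Longrightarrow> M i j = M i k"
  shows "det (mat n n (\<lambda>(a, b). M a b)) = 0"
  by (rule det_identical_columns[of _ n j k]) (use assms in \<open>auto intro!: eq_vecI\<close>)

lemma det_row_linear_cofactor:
  fixes M :: "nat \<Rightarrow> nat \<Rightarrow> 'a::comm_ring_1"
  assumes "i < n"
  shows "det (mat n n (\<lambda>(a, b). if a = i then w b else M a b)) =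
    (\<Sum>b<n. w b * cofactor (mat n n (\<lambda>(a, b). M a b)) i b)"
proof -
  let ?A = "mat n n (\<lambda>(a, b). if a = i then w b else M a b)"
  have "cofactor ?A i b = cofactor (mat n n (\<lambda>(a, b). M a b)) i b" for b
  proof -
    have "mat_delete ?A i b = mat_delete (mat n n (\<lambda>(a, b). M a b)) i b"
      by (rule eq_matI) (auto simp: mat_delete_def)
    then show ?thesis by (simp add: cofactor_def)
  qed
  then show ?thesis
    by (subst laplace_expansion_row[of _ n i]) (use assms in auto)
qed

lemma det_scale_rows:
  fixes M :: "nat \<Rightarrow> nat \<Rightarrow> 'a::comm_ring_1"
  shows "det (mat n n (\<lambda>(a, b). s a * M a b)) = (\<Prod>a<n. s a) * det (mat n n (\<lambda>(a, b). M a b))"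
proof -
  have "p a < n" if "p permutes {0..<n}" "a < n" for p a
    using that permutes_in_image[of p "{0..<n}" a] by auto
  then have eq: "det (mat n n (\<lambda>(a, b). K a b)) = (\<Sum>p | p permutes {0..<n}. signof p * (\<Prod>a<n. K a (p a)))"
    for K :: "nat \<Rightarrow> nat \<Rightarrow> 'a"
    by (subst det_def'[of _ n]) (auto simp: atLeast0LessThan intro!: sum.cong prod.cong)
  show ?thesis unfolding eq by (simp add: prod.distrib sum_distrib_left mult.left_commute)
qed

lemma det_scale_row:
  fixes M :: "nat \<Rightarrow> nat \<Rightarrow> 'a::comm_ring_1"
  assumes "i < n"
  shows "det (mat n n (\<lambda>(a, b). if a = i then c * w b else M a b)) =
     c * det (mat n n (\<lambda>(a, b). if a = i then w b else M a b))"
  by (simp add: det_row_linear_cofactor[OF assms] sum_distrib_left mult.assoc)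

lemma det_scale_column:
  fixes M :: "nat \<Rightarrow> nat \<Rightarrow> 'a::comm_ring_1"
  assumes "j < n"
  shows "det (mat n n (\<lambda>(a, b). if b = j then c * w a else M a b)) =
     c * det (mat n n (\<lambda>(a, b). if b = j then w a else M a b))"
proof -
  have transp: "det (mat n n (\<lambda>(a, b). K a b)) = det (mat n n (\<lambda>(a, b). K b a))"
    for K :: "nat \<Rightarrow> nat \<Rightarrow> 'a"
  proof -
    have "transpose_mat (mat n n (\<lambda>(a, b). K a b)) = mat n n (\<lambda>(a, b). K b a)"
      by (rule eq_matI) auto
    then show ?thesis using det_transpose[of "mat n n (\<lambda>(a, b). K a b)" n] by simp
  qed
  show ?thesis
    using det_scale_row[OF assms, of c w "\<lambda>a b. M b a"]
    by (simp add: transp[of "\<lambda>a b. if b = j then c * w a else M a b"]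
        transp[of "\<lambda>a b. if b = j then w a else M a b"])
qed

section \<open>Alternants\<close>

lemma coordinatewise_poly_alternant:
  "coordinatewise_poly n (\<lambda>x. alternant n x \<nu>)"
proof -
  have "p a < n" if "p permutes {0..<n}" "a < n" for p a
    using that permutes_in_image[of p "{0..<n}" a] by auto
  then have eq: "alternant n x \<nu> = (\<Sum>p | p permutes {0..<n}. signof p *
      (\<Prod>a = 0..<n. x a ^ (\<nu> (p a) + (n - 1 - p a))))" for x :: "nat \<Rightarrow> 'a"
    unfolding alternant_def by (subst det_def'[of _ n]) auto
  show ?thesis unfolding eq by (intro coordinatewise_poly_intros)
qed

lemma alternant_eq_0:
  assumes "\<not> inj_on x {..<n}"
  shows "alternant n x \<nu> = 0"
proof -
  obtain i j where ij: "i < n" "j < n" "i \<noteq> j" "x i = x j"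
    using assms by (auto simp: inj_on_def)
  show ?thesis unfolding alternant_def
    by (rule det_identical_rows[of _ n i j]) (use ij in \<open>auto intro!: eq_vecI\<close>)
qed

text \<open>
  A vector in the kernel would be the coefficient vector of a polynomial of degree less than \<open>n\<close>
  with \<open>n\<close> roots.
\<close>

lemma alternant_0_nonzero:
  fixes x :: "nat \<Rightarrow> 'a::field"
  assumes "inj_on x {..<n}"
  shows "alternant n x (\<lambda>_. 0) \<noteq> 0"
proof
  let ?A = "mat n n (\<lambda>(i, j). x i ^ (n - 1 - j))"
  assume "alternant n x (\<lambda>_. 0) = 0"
  then have "det ?A = 0" by (simp add: alternant_def)
  then obtain v where v: "v \<in> carrier_vec n" "v \<noteq> 0\<^sub>v n" "?A *\<^sub>v v = 0\<^sub>v n"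
    using det_0_iff_vec_prod_zero_field[of ?A n] by auto
  define P where "P = (\<Sum>j<n. Polynomial.monom (v $ j) (n - 1 - j))"
  have n: "n > 0" using v by (cases n) (auto intro!: eq_vecI)
  have coeff: "Polynomial.coeff P (n - 1 - j) = v $ j" if "j < n" for j
  proof -
    have "Polynomial.coeff P (n - 1 - j) = (\<Sum>k<n. if k = j then v $ j else 0)"
      unfolding P_def coeff_sum by (rule sum.cong) (use that in auto)
    then show ?thesis using that by simp
  qed
  have "poly P (x i) = 0" if "i < n" for i
  proof -
    have "(?A *\<^sub>v v) $ i = (0\<^sub>v n) $ i" using v(3) by simp
    then have "(\<Sum>j<n. x i ^ (n - 1 - j) * v $ j) = 0"
      using that v(1) by (simp add: scalar_prod_def atLeast0LessThan)
    then show ?thesis by (simp add: P_def poly_sum poly_monom mult.commute)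
  qed
  moreover have "degree P < n"
  proof -
    have "degree P \<le> n - 1" unfolding P_def
      by (rule degree_sum_le) (auto intro: order.trans[OF degree_monom_le])
    then show ?thesis using n by simp
  qed
  ultimately have "P = 0"
    using assms n by (intro poly_eqI_degree[of "x ` {..<n}"]) (auto simp: card_image)
  then have "v $ j = 0" if "j < n" for j using coeff[OF that] by simp
  then show False using v(1,2) by (auto intro!: eq_vecI)
qed

section \<open>Symmetric functions are determined by their values\<close>

text \<open>
  Adding \<open>m\<close> copies of one variable moves the power sums along a line, polynomially in \<open>m\<close>.
\<close>

lemma specialize_append_copies:
  "specialize (n + m) (\<lambda>j. if j < n then x j else y) f =
   evaluate (\<lambda>c. c) (\<lambda>k. (\<Sum>j<n. x j ^ Suc k) + of_nat m * y ^ Suc k) f"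
proof -
  have "(\<Sum>j<n+m. (if j < n then x j else y) ^ Suc k) = (\<Sum>j<n. x j ^ Suc k) + of_nat m * y ^ Suc k" for k
  proof -
    have "(\<Sum>j<n+m. (if j < n then x j else y) ^ Suc k) =
        (\<Sum>j<n. (if j < n then x j else y) ^ Suc k) + (\<Sum>j\<in>{n..<n+m}. (if j < n then x j else y) ^ Suc k)"
      by (subst sum.union_disjoint[symmetric]) (auto simp: ivl_disj_un)
    then show ?thesis by simp
  qed
  then show ?thesis unfolding specialize_eq_evaluate by simp
qed

text \<open>
  If \<open>m\<close> copies of a variable \<open>y\<close> are added, the value of \<open>f\<close> is a polynomial in \<open>m\<close> that vanishes
  for all natural \<open>m\<close>, so its derivative at 0 vanishes. By the chain rule this derivative is
  \<open>\<Sum>k. y^(k+1) \<partial>f/\<partial>p_(k+1)\<close>; it vanishes for all \<open>y\<close>, hence coefficient by coefficient.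
\<close>

lemma specialize_partial_deriv_eq_0:
  fixes f :: "'a::field_char_0 symfun"
  assumes zero: "\<And>n x. n \<ge> n0 \<Longrightarrow> specialize n x f = 0" and n: "n \<ge> n0"
  shows "specialize n x (partial_deriv i f) = 0"
proof -
  define S where "S = insert i (\<Union>\<alpha>\<in>Poly_Mapping.keys f. Poly_Mapping.keys \<alpha>)"
  have S: "finite S" "\<And>\<alpha>. \<alpha> \<in> Poly_Mapping.keys f \<Longrightarrow> Poly_Mapping.keys \<alpha> \<subseteq> S" "i \<in> S"
    by (auto simp: S_def)
  define Q where "Q = (\<Sum>k\<in>S. Polynomial.monom (specialize n x (partial_deriv k f)) (Suc k))"
  have "poly Q y = 0" for y
  proof -
    define \<Phi> where "\<Phi> = (\<lambda>k. [:\<Sum>j<n. x j ^ Suc k, y ^ Suc k:])"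
    define P where "P = evaluate (\<lambda>c. [:c:]) \<Phi> f"
    have "poly P (of_nat m) = 0" for m
    proof -
      have "poly P (of_nat m) = specialize (n + m) (\<lambda>j. if j < n then x j else y) f"
        by (simp add: P_def poly_evaluate \<Phi>_def specialize_append_copies)
      then show ?thesis using zero[of "n + m"] n by simp
    qed
    then have "range (of_nat :: nat \<Rightarrow> 'a) \<subseteq> {z. poly P z = 0}" by auto
    moreover have "infinite (range (of_nat :: nat \<Rightarrow> 'a))"
      by (rule range_inj_infinite) (simp add: inj_def)
    ultimately have "P = 0" using poly_roots_finite infinite_super by blast
    then have "poly (pderiv P) 0 = 0" by simp
    also have "poly (pderiv P) 0 = poly Q y"
    proof -
      have "pderiv P = (\<Sum>k\<in>S. pderiv (\<Phi> k) * evaluate (\<lambda>c. [:c:]) \<Phi> (partial_deriv k f))"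
        unfolding P_def by (rule pderiv_evaluate) (use S in auto)
      then show ?thesis
        by (simp add: Q_def poly_sum poly_evaluate \<Phi>_def pderiv_pCons poly_monom specialize_eq_evaluate mult.commute)
    qed
    finally show ?thesis .
  qed
  then have "Q = 0" by (simp add: poly_all_0_iff_0[symmetric])
  then have "0 = Polynomial.coeff Q (Suc i)" by simp
  also have "\<dots> = specialize n x (partial_deriv i f)"
    unfolding Q_def coeff_sum using S by (simp add: sum.delta' eq_commute)
  finally show ?thesis by simp
qed

lemma exponent_induct [case_names zero add]:
  fixes \<beta> :: "nat \<Rightarrow>\<^sub>0 nat"
  assumes zero: "P 0" and add: "\<And>\<alpha> i. P \<alpha> \<Longrightarrow> P (\<alpha> + Poly_Mapping.single i 1)"
  shows "P \<beta>"
proof (induction "\<Sum>i\<in>Poly_Mapping.keys \<beta>. Poly_Mapping.lookup \<beta> i" arbitrary: \<beta> rule: less_induct)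
  case less
  show ?case
  proof (cases "\<beta> = 0")
    case False
    then obtain i where i: "i \<in> Poly_Mapping.keys \<beta>" by fastforce
    let ?\<gamma> = "\<beta> - Poly_Mapping.single i 1"
    have "(\<Sum>k\<in>Poly_Mapping.keys ?\<gamma>. Poly_Mapping.lookup ?\<gamma> k) =
          (\<Sum>k\<in>Poly_Mapping.keys \<beta>. Poly_Mapping.lookup ?\<gamma> k)"
      by (rule sum.mono_neutral_left) (auto simp: in_keys_iff lookup_minus)
    also have "\<dots> < (\<Sum>k\<in>Poly_Mapping.keys \<beta>. Poly_Mapping.lookup \<beta> k)"
    proof (rule sum_strict_mono_ex1)
      show "\<exists>k\<in>Poly_Mapping.keys \<beta>. Poly_Mapping.lookup ?\<gamma> k < Poly_Mapping.lookup \<beta> k"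
        using i by (intro bexI[of _ i]) (auto simp: lookup_minus in_keys_iff)
    qed (auto simp: lookup_minus)
    finally have "P ?\<gamma>" by (rule less.hyps)
    then have "P (?\<gamma> + Poly_Mapping.single i 1)" by (rule add)
    also have "?\<gamma> + Poly_Mapping.single i 1 = \<beta>"
      by (rule poly_mapping_eqI)
         (use i in \<open>auto simp: lookup_add lookup_minus lookup_single when_def in_keys_iff\<close>)
    finally show ?thesis .
  qed (simp add: zero)
qed

lemma specialize_at_0: "specialize n (\<lambda>_. 0) f = Poly_Mapping.lookup f 0"
proof (induction f rule: symfun_induct)
  case (single \<alpha> c)
  have "monomial_value (\<lambda>i. 0 :: 'a) \<alpha> = (if \<alpha> = 0 then 1 else 0)"
  proof (cases "\<alpha> = 0")
    case False
    then obtain i where "i \<in> Poly_Mapping.keys \<alpha>" by fastforce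
    then show ?thesis using False
      by (auto simp: monomial_value_def in_keys_iff intro!: prod_zero)
  qed simp
  then show ?case
    by (simp add: specialize_eq_evaluate evaluate_single[OF comm_ring_hom_id] lookup_single when_def)
next
  case (add f g)
  then show ?case by (simp add: specialize_add lookup_add)
qed

text \<open>
  Algebraic independence of the power sums. Functions with zero values are closed under partial
  derivatives, so every coefficient can be differentiated down to the constant coefficient, which
  is the value at the origin.
\<close>

lemma specialize_eq_0_imp_lookup_eq_0:
  fixes f :: "'a::field_char_0 symfun"
  assumes "\<And>n x. n \<ge> n0 \<Longrightarrow> specialize n x f = 0"
  shows "Poly_Mapping.lookup f \<beta> = 0"
  using assms
proof (induction \<beta> arbitrary: f rule: exponent_induct)
  case zero
  then show ?case using specialize_at_0[of n0 f] by simp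
next
  case (add \<alpha> i)
  have "Poly_Mapping.lookup (partial_deriv i f) \<alpha> = 0"
    using specialize_partial_deriv_eq_0[OF add.prems] by (rule add.IH)
  then have "of_nat (Suc (Poly_Mapping.lookup \<alpha> i)) * Poly_Mapping.lookup f (\<alpha> + Poly_Mapping.single i 1) = 0"
    by (simp only: lookup_partial_deriv)
  then show ?case by (simp only: mult_eq_0_iff of_nat_eq_0_iff) simp
qed

lemma infinite_nonzero: "infinite (- {0 :: 'a::field_char_0})"
  unfolding Compl_eq_Diff_UNIV by (rule Diff_infinite_finite) (simp_all add: infinite_UNIV_char_0)

text \<open>
  Values with distinct nonzero variables suffice. There the Vandermonde alternant can be
  cancelled, and the poles of the vertex operator are simple and finite.
\<close>

lemma symfun_eqI:
  fixes f g :: "'a::field_char_0 symfun"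
  assumes "\<And>n x. n \<ge> n0 \<Longrightarrow> inj_on x {..<n} \<Longrightarrow> (\<And>i. i < n \<Longrightarrow> x i \<noteq> 0) \<Longrightarrow>
    specialize n x f = specialize n x g"
  shows "f = g"
proof -
  have "specialize n x (f - g) = 0" if "n \<ge> n0" for n x
  proof (rule coordinatewise_poly_eq_0[OF coordinatewise_poly_specialize[of n n]])
    show "infinite (- {0 :: 'a})" by (rule infinite_nonzero)
    fix x :: "nat \<Rightarrow> 'a" assume x: "inj_on x {..<n}" "x ` {..<n} \<subseteq> - {0}"
    then have "x i \<noteq> 0" if "i < n" for i using that by blast
    then show "specialize n x (f - g) = 0"
      using assms[OF \<open>n \<ge> n0\<close> x(1)] by (simp add: specialize_diff)
  qed
  then have "Poly_Mapping.lookup (f - g) \<beta> = 0" for \<beta>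
    by (rule specialize_eq_0_imp_lookup_eq_0)
  then show ?thesis by (intro poly_mapping_eqI) (simp add: lookup_minus)
qed

section \<open>Exponentials of commuting operators\<close>

text \<open>
  The exponential of a series of operators satisfies the expected differential equation as soon as
  the coefficients commute.
\<close>

locale commuting_operators =
  fixes A :: "nat \<Rightarrow> 'a::field_char_0 symfun \<Rightarrow> 'a symfun"
  assumes A_add: "A i (f + g) = A i f + A i g"
    and A_scale: "A i (scale c f) = scale c (A i f)"
    and A_commute: "A i (A j f) = A j (A i f)"
    and A_zero: "A 0 f = 0"
begin

lemma A_0: "A i 0 = 0"
  using A_add[of i 0 0] by simp

lemma A_sum: "A i (sum F S) = (\<Sum>s\<in>S. A i (F s))"
  by (induction S rule: infinite_finite_induct) (simp_all add: A_0 A_add)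

lemma op_power_add: "op_power A n m (f + g) = op_power A n m f + op_power A n m g"
  by (induction n arbitrary: m) (simp_all add: A_add sum.distrib)

lemma op_power_scale: "op_power A n m (scale c f) = scale c (op_power A n m f)"
  by (induction n arbitrary: m) (simp_all add: A_scale scale_sum)

lemma op_exp_add: "op_exp A m (f + g) = op_exp A m f + op_exp A m g"
  by (simp add: op_exp_def op_power_add scale_add sum.distrib)

lemma op_exp_scale: "op_exp A m (scale c f) = scale c (op_exp A m f)"
  by (simp add: op_exp_def op_power_scale scale_scale scale_sum mult.commute)

lemma op_exp_zero: "op_exp A m 0 = 0"
  using op_exp_add[of m 0 0] by simp

lemma op_power_commute: "op_power A n m (A i f) = A i (op_power A n m f)"
  by (induction n arbitrary: m) (simp_all add: A_0 A_sum A_commute[of i])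

lemma op_power_Suc_inner: "op_power A (Suc n) m f = (\<Sum>i\<le>m. op_power A n (m - i) (A i f))"
  by (simp add: op_power_commute)

lemma op_power_eq_0: "m < n \<Longrightarrow> op_power A n m f = 0"
proof (induction n arbitrary: m)
  case (Suc n)
  have "A i (op_power A n (m - i) f) = 0" if "i \<le> m" for i
  proof (cases "i = 0")
    case False
    then have "m - i < n" using Suc.prems that by simp
    then show ?thesis using Suc.IH by (simp add: A_0)
  qed (simp add: A_zero)
  then show ?case by simp
qed simp

text \<open>
  The coefficient form of \<open>z d/dz A^(n+1) = (n+1) (z A') A^n\<close>.
\<close>

lemma op_power_euler:
  "scale (of_nat m) (op_power A (Suc n) m f) =
     scale (of_nat (Suc n)) (\<Sum>i\<le>m. scale (of_nat i) (op_power A n (m - i) (A i f)))"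
proof (induction n arbitrary: m f)
  case 0
  show ?case
    by (simp add: op_power_Suc_inner scale_sum if_distrib[of "scale _"] sum.delta' cong: if_cong
          del: op_power.simps(2))
next
  case (Suc n)
  have "scale (of_nat m) (op_power A (Suc (Suc n)) m f) =
    (\<Sum>i\<le>m. scale (of_nat i) (op_power A (Suc n) (m - i) (A i f)) +
            scale (of_nat (m - i)) (op_power A (Suc n) (m - i) (A i f)))"
    unfolding op_power_Suc_inner[of "Suc n"] scale_sum
    by (rule sum.cong) (simp_all add: scale_add_left[symmetric] of_nat_add[symmetric] del: of_nat_add)
  also have "\<dots> = (\<Sum>i\<le>m. scale (of_nat i) (op_power A (Suc n) (m - i) (A i f))) +
     scale (of_nat (Suc n)) (\<Sum>i\<le>m. \<Sum>j\<le>m - i. scale (of_nat j) (op_power A n (m - i - j) (A j (A i f))))"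
    by (simp only: sum.distrib Suc.IH scale_sum)
  also have "(\<Sum>i\<le>m. \<Sum>j\<le>m - i. scale (of_nat j) (op_power A n (m - i - j) (A j (A i f)))) =
     (\<Sum>j\<le>m. \<Sum>i\<le>m - j. scale (of_nat j) (op_power A n (m - j - i) (A i (A j f))))"
  proof -
    have "(\<Sum>i\<le>m. \<Sum>j\<le>m - i. scale (of_nat j) (op_power A n (m - i - j) (A j (A i f)))) =
       (\<Sum>j\<le>m. \<Sum>i\<le>m - j. scale (of_nat j) (op_power A n (m - i - j) (A j (A i f))))"
      unfolding sum.Sigma[OF finite_atMost ballI[OF finite_atMost]]
      by (rule sum.reindex_bij_witness[of _ "\<lambda>(a, b). (b, a)" "\<lambda>(a, b). (b, a)"]) auto
    also have "\<dots> = (\<Sum>j\<le>m. \<Sum>i\<le>m - j. scale (of_nat j) (op_power A n (m - j - i) (A i (A j f))))"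
      by (intro sum.cong refl) (metis A_commute diff_commute)
    finally show ?thesis .
  qed
  also have "\<dots> = (\<Sum>j\<le>m. scale (of_nat j) (op_power A (Suc n) (m - j) (A j f)))"
    unfolding op_power_Suc_inner by (simp add: scale_sum)
  finally show ?case
    by (simp only: of_nat_Suc[of "Suc n"] scale_add_left scale_1)
qed

text \<open>
  The coefficient form of \<open>z d/dz exp A = (z A') exp A\<close>.
\<close>

lemma op_exp_euler:
  "scale (of_nat m) (op_exp A m f) = (\<Sum>i\<in>{1..m}. scale (of_nat i) (op_exp A (m - i) (A i f)))"
proof -
  have "scale (of_nat m) (op_exp A m f) =
     (\<Sum>n\<le>m. scale (1 / fact n) (scale (of_nat m) (op_power A n m f)))"
    by (simp add: op_exp_def scale_sum scale_scale mult.commute)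
  also have "\<dots> = (\<Sum>n<m. scale (1 / fact (Suc n)) (scale (of_nat m) (op_power A (Suc n) m f)))"
  proof (cases m)
    case (Suc k)
    then show ?thesis
      by (subst Suc, subst sum.atMost_Suc_shift) (simp add: lessThan_Suc_atMost del: op_power.simps(2))
  qed simp
  also have "\<dots> = (\<Sum>n<m. \<Sum>i\<le>m. scale (of_nat i / fact n) (op_power A n (m - i) (A i f)))"
    unfolding op_power_euler
    by (rule sum.cong) (simp_all add: scale_sum scale_scale field_simps del: of_nat_Suc)
  also have "\<dots> = (\<Sum>i\<le>m. \<Sum>n<m. scale (of_nat i / fact n) (op_power A n (m - i) (A i f)))"
    by (rule sum.swap)
  also have "\<dots> = (\<Sum>i\<in>{1..m}. \<Sum>n<m. scale (of_nat i / fact n) (op_power A n (m - i) (A i f)))"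
    by (rule sum.mono_neutral_right) (auto simp: not_less_eq_eq[symmetric])
  also have "\<dots> = (\<Sum>i\<in>{1..m}. \<Sum>n\<le>m - i. scale (of_nat i / fact n) (op_power A n (m - i) (A i f)))"
    by (intro sum.cong refl sum.mono_neutral_right) (auto simp: op_power_eq_0)
  also have "\<dots> = (\<Sum>i\<in>{1..m}. scale (of_nat i) (op_exp A (m - i) (A i f)))"
    by (simp add: op_exp_def scale_sum scale_scale)
  finally show ?thesis .
qed

text \<open>
  In characteristic 0 the Euler recursion determines the exponential, so its values may be
  computed by guessing a solution. The operators are applied first and the value is taken last, so
  \<open>X\<close> has to be guessed for all symmetric functions at once.
\<close>

lemma op_exp_unique:
  fixes n :: nat and x :: "nat \<Rightarrow> 'a" and X :: "nat \<Rightarrow> 'a symfun \<Rightarrow> 'a"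
  assumes X0: "\<And>f. X 0 f = specialize n x f"
    and X_euler: "\<And>m f. of_nat m * X m f = (\<Sum>i\<in>{1..m}. of_nat i * X (m - i) (A i f))"
  shows "specialize n x (op_exp A m f) = X m f"
proof (induction m arbitrary: f rule: less_induct)
  case (less m)
  show ?case
  proof (cases "m = 0")
    case True
    then show ?thesis by (simp add: X0 op_exp_def)
  next
    case False
    have "of_nat m * specialize n x (op_exp A m f) = specialize n x (scale (of_nat m) (op_exp A m f))"
      by (simp add: specialize_scale)
    also have "\<dots> = of_nat m * X m f"
      unfolding op_exp_euler X_euler using False
      by (auto simp: specialize_sum specialize_scale less.IH intro!: sum.cong)
    finally show ?thesis using False by simp
  qed
qed

end

section \<open>The two halves of the vertex operator\<close>

interpretation V_plus: commuting_operators "V_plus r" for r :: "'a::field_char_0"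
  by unfold_locales (simp_all add: V_plus_def scale_def algebra_simps)

interpretation V_minus: commuting_operators "V_minus r" for r :: "'a::field_char_0"
  by unfold_locales
    (simp_all add: V_minus_def p_perp_def partial_deriv_add partial_deriv_scale
      partial_deriv_commute scale_add scale_scale mult_ac)

definition geometric_fps :: "'a::field \<Rightarrow> 'a fps" where
  "geometric_fps d = Abs_fps (\<lambda>m. d ^ m)"

lemma geometric_fps_inverse: "(1 - fps_const d * fps_X) * geometric_fps d = 1"
proof (rule fps_ext)
  fix m
  show "fps_nth ((1 - fps_const d * fps_X) * geometric_fps d) m = fps_nth 1 m"
    by (cases m) (simp_all add: geometric_fps_def left_diff_distrib mult.assoc)
qed

text \<open>
  The expansion of \<open>\<Prod>j<N. (1 - b_j t) / (1 - d_j t)\<close>.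
\<close>

definition linear_fraction_product :: "nat \<Rightarrow> (nat \<Rightarrow> 'a::field) \<Rightarrow> (nat \<Rightarrow> 'a) \<Rightarrow> 'a fps" where
  "linear_fraction_product N b d = (\<Prod>j<N. (1 - fps_const (b j) * fps_X) * geometric_fps (d j))"

lemma linear_fraction_product_nth_0: "fps_nth (linear_fraction_product N b d) 0 = 1"
  by (induction N) (simp_all add: linear_fraction_product_def geometric_fps_def)

lemma linear_fraction_euler:
  fixes b d :: "'a::field"
  defines "t \<equiv> (1 - fps_const b * fps_X) * geometric_fps d"
  shows "fps_X * fps_deriv t = t * (geometric_fps d - geometric_fps b)"
proof -
  let ?B = "fps_const b * fps_X" and ?D = "fps_const d * fps_X"
  let ?G = "geometric_fps d" and ?G' = "geometric_fps b"
  have D: "(1 - ?D) * ?G = 1" and B: "(1 - ?B) * ?G' = 1" by (rule geometric_fps_inverse)+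
  have "fps_deriv ((1 - ?D) * ?G) = 0" by (simp add: D)
  then have *: "(1 - ?D) * fps_deriv ?G = fps_const d * ?G" by (simp add: algebra_simps)
  have "fps_deriv ?G = ((1 - ?D) * ?G) * fps_deriv ?G" by (simp add: D)
  also have "\<dots> = fps_const d * ?G * ?G" using * by (simp add: mult_ac)
  finally have G: "fps_deriv ?G = fps_const d * ?G * ?G" .
  have DG: "?D * ?G = ?G - 1" using D by (simp add: algebra_simps)
  have "fps_X * fps_deriv t = - (?B * ?G) + (1 - ?B) * (?D * ?G) * ?G"
    by (simp add: t_def G algebra_simps)
  also have "\<dots> = (1 - ?B) * ?G * ?G - ?G" unfolding DG by (simp add: algebra_simps)
  also have "\<dots> = (1 - ?B) * ?G * ?G - ((1 - ?B) * ?G') * ?G" unfolding B by simp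
  also have "\<dots> = t * (?G - ?G')" by (simp add: t_def algebra_simps)
  finally show ?thesis .
qed

lemma linear_fraction_product_euler:
  "fps_X * fps_deriv (linear_fraction_product N b d) =
     linear_fraction_product N b d * (\<Sum>j<N. geometric_fps (d j) - geometric_fps (b j))"
proof (induction N)
  case (Suc N)
  let ?t = "(1 - fps_const (b N) * fps_X) * geometric_fps (d N)"
  let ?H = "linear_fraction_product N b d"
  have "linear_fraction_product (Suc N) b d = ?H * ?t"
    by (simp add: linear_fraction_product_def)
  moreover have "fps_X * fps_deriv (?H * ?t) =
      (fps_X * fps_deriv ?H) * ?t + ?H * (fps_X * fps_deriv ?t)"
    by (simp only: fps_deriv_mult distrib_left mult_ac add_ac)
  ultimately show ?case
    by (simp only: Suc.IH linear_fraction_euler sum.lessThan_Suc) (simp only: distrib_left mult_ac)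
qed (simp add: linear_fraction_product_def)

lemma linear_fraction_product_nth_euler:
  fixes b d :: "nat \<Rightarrow> 'a::field_char_0"
  shows "of_nat m * fps_nth (linear_fraction_product N b d) m =
    (\<Sum>i\<in>{1..m}. (\<Sum>j<N. d j ^ i - b j ^ i) * fps_nth (linear_fraction_product N b d) (m - i))"
proof -
  let ?H = "linear_fraction_product N b d"
  let ?L = "\<Sum>j<N. geometric_fps (d j) - geometric_fps (b j)"
  have L: "fps_nth ?L i = (\<Sum>j<N. d j ^ i - b j ^ i)" for i
    by (simp add: fps_sum_nth geometric_fps_def)
  have "of_nat m * fps_nth ?H m = fps_nth (fps_X * fps_deriv ?H) m"
    by (cases m) simp_all
  also have "\<dots> = fps_nth (?L * ?H) m" by (simp only: linear_fraction_product_euler mult.commute)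
  also have "\<dots> = (\<Sum>i=0..m. (\<Sum>j<N. d j ^ i - b j ^ i) * fps_nth ?H (m - i))"
    by (simp add: fps_mult_nth L)
  also have "\<dots> = (\<Sum>i\<in>{1..m}. (\<Sum>j<N. d j ^ i - b j ^ i) * fps_nth ?H (m - i))"
    by (rule sum.mono_neutral_right) (auto simp: not_less_eq_eq[symmetric])
  finally show ?thesis .
qed

text \<open>
  Times \<open>\<Prod>j<N. 1 - d_j t\<close>, both sides are polynomials in \<open>t\<close> of degree at most \<open>N\<close>. They agree at
  the \<open>N\<close> poles \<open>1 / d_i\<close> by the choice of the residues, and at 0 by the choice of the constant.
\<close>

lemma linear_fraction_product_partial_fractions:
  fixes b d :: "nat \<Rightarrow> 'a::field"
  assumes inj: "inj_on d {..<N}" and nz: "\<And>i. i < N \<Longrightarrow> d i \<noteq> 0"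
  defines "A \<equiv> \<lambda>i. (\<Prod>j<N. 1 - b j / d i) / (\<Prod>j\<in>{..<N} - {i}. 1 - d j / d i)"
  shows "linear_fraction_product N b d = fps_const (1 - (\<Sum>i<N. A i)) + (\<Sum>i<N. fps_const (A i) * geometric_fps (d i))"
proof -
  define P where "P = (\<Prod>j<N. [:1, - b j:])"
  define Q where "Q = [:1 - (\<Sum>i<N. A i):] * (\<Prod>j<N. [:1, - d j:]) +
     (\<Sum>i<N. [:A i:] * (\<Prod>j\<in>{..<N} - {i}. [:1, - d j:]))"
  let ?S = "insert 0 ((\<lambda>i. 1 / d i) ` {..<N})"
  have "inj_on (\<lambda>i. 1 / d i) {..<N}" using inj by (auto simp: inj_on_def)
  moreover have "0 \<notin> (\<lambda>i. 1 / d i) ` {..<N}" using nz by auto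
  ultimately have card: "card ?S = Suc N" by (simp add: card_image)
  have deg: "degree (\<Prod>j\<in>I. [:1, c j:]) \<le> N" if "I \<subseteq> {..<N}" for I and c :: "nat \<Rightarrow> 'a"
  proof -
    have "degree (\<Prod>j\<in>I. [:1, c j:]) \<le> (\<Sum>j\<in>I. degree [:1, c j:])"
      using degree_prod_sum_le[OF finite_subset[OF that finite_lessThan], of "\<lambda>j. [:1, c j:]"]
      by (simp add: o_def)
    also have "\<dots> \<le> (\<Sum>j\<in>I. 1)" by (rule sum_mono) simp
    also have "\<dots> \<le> N" using card_mono[OF finite_lessThan that] by simp
    finally show ?thesis .
  qed
  have "P = Q"
  proof (rule poly_eqI_degree)
    show "card ?S > degree P" unfolding card P_def using deg[of "{..<N}"] by (simp add: less_Suc_eq_le)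
    show "card ?S > degree Q" unfolding card Q_def less_Suc_eq_le
    proof (intro degree_add_le degree_sum_le finite_lessThan)
      show "degree ([:1 - (\<Sum>i<N. A i):] * (\<Prod>j<N. [:1, - d j:])) \<le> N"
        using deg[of "{..<N}"] by (simp add: order.trans[OF degree_smult_le])
      show "degree ([:A i:] * (\<Prod>j\<in>{..<N} - {i}. [:1, - d j:])) \<le> N" for i
        using deg[of "{..<N} - {i}"] by (simp add: order.trans[OF degree_smult_le])
    qed
    fix z assume "z \<in> ?S"
    then consider "z = 0" | i where "i < N" "z = 1 / d i" by auto
    then show "poly P z = poly Q z"
    proof cases
      case 1
      then show ?thesis by (simp add: P_def Q_def poly_prod poly_sum)
    next
      case (2 i)
      have "1 - d j / d i \<noteq> 0" if "j \<in> {..<N} - {i}" for j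
      proof -
        have "d j \<noteq> d i" using that inj 2 by (auto dest: inj_onD)
        then show ?thesis using nz[OF 2(1)] by (simp add: field_simps)
      qed
      then have nz': "(\<Prod>j\<in>{..<N} - {i}. 1 - d j / d i) \<noteq> 0"
        by (subst prod_zero_iff) auto
      have zero: "(\<Prod>j\<in>I. 1 - d j / d i) = 0" if "i \<in> I" "finite I" for I
        using that nz 2 by (intro prod_zero) auto
      have "poly Q z = (\<Sum>k<N. A k * (\<Prod>j\<in>{..<N} - {k}. 1 - d j / d i))"
        using 2 zero[of "{..<N}"] by (simp add: Q_def poly_prod poly_sum)
      also have "\<dots> = (\<Sum>k<N. if k = i then A i * (\<Prod>j\<in>{..<N} - {i}. 1 - d j / d i) else 0)"
        using 2 zero by (intro sum.cong) auto
      also have "\<dots> = (\<Prod>j<N. 1 - b j / d i)" using 2 nz' by (simp add: A_def)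
      also have "\<dots> = poly P z" using 2 by (simp add: P_def poly_prod)
      finally show ?thesis by simp
    qed
  qed
  have lin: "fps_of_poly [:1, - c:] = 1 - fps_const c * fps_X" for c :: 'a
    by (simp add: fps_of_poly_pCons mult.commute)
  let ?G = "\<lambda>I. \<Prod>j\<in>I. geometric_fps (d j)" and ?D = "\<lambda>I. \<Prod>j\<in>I. 1 - fps_const (d j) * fps_X"
  have DG: "?D I * ?G I = 1" for I
    by (simp add: prod.distrib[symmetric] geometric_fps_inverse)
  have "linear_fraction_product N b d = fps_of_poly P * ?G {..<N}"
    by (simp add: linear_fraction_product_def prod.distrib P_def fps_of_poly_prod lin)
  also have "\<dots> = fps_of_poly Q * ?G {..<N}" by (simp add: \<open>P = Q\<close>)
  also have "fps_of_poly Q = fps_const (1 - (\<Sum>i<N. A i)) * ?D {..<N} + (\<Sum>i<N. fps_const (A i) * ?D ({..<N} - {i}))"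
    by (simp only: Q_def fps_of_poly_add fps_of_poly_mult fps_of_poly_prod lin fps_of_poly_sum fps_of_poly_const)
  also have "\<dots> * ?G {..<N} = fps_const (1 - (\<Sum>i<N. A i)) * (?D {..<N} * ?G {..<N}) +
      (\<Sum>i<N. fps_const (A i) * (?D ({..<N} - {i}) * ?G {..<N}))"
    by (simp add: distrib_right sum_distrib_right mult.assoc)
  also have "(\<Sum>i<N. fps_const (A i) * (?D ({..<N} - {i}) * ?G {..<N})) = (\<Sum>i<N. fps_const (A i) * geometric_fps (d i))"
  proof (rule sum.cong)
    fix i assume "i \<in> {..<N}"
    then have "?G {..<N} = geometric_fps (d i) * ?G ({..<N} - {i})"
      by (intro prod.remove) auto
    then show "fps_const (A i) * (?D ({..<N} - {i}) * ?G {..<N}) = fps_const (A i) * geometric_fps (d i)"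
      using DG[of "{..<N} - {i}"] by (simp add: mult.left_commute)
  qed simp
  finally show ?thesis by (simp add: DG)
qed

text \<open>
  With \<open>N\<close> variables the logarithm \<open>\<Sum>k\<ge>1. (r^k - r^-k) p_k t^k / k\<close> has derivative
  \<open>\<Sum>j \<Sum>k\<ge>1. ((r x_j)^k - (x_j / r)^k) t^(k-1)\<close>, the logarithmic derivative of
  \<open>\<Prod>j. (1 - x_j t / r) / (1 - r x_j t)\<close>.
\<close>

lemma specialize_op_exp_V_plus:
  fixes f :: "'a::field_char_0 symfun"
  shows "specialize N x (op_exp (V_plus r) m f) =
     fps_nth (linear_fraction_product N (\<lambda>j. inverse r * x j) (\<lambda>j. r * x j)) m * specialize N x f"
    (is "_ = fps_nth ?H m * _")
proof (rule V_plus.op_exp_unique)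
  show "fps_nth ?H 0 * specialize N x f = specialize N x f" for f
    by (simp add: linear_fraction_product_nth_0)
next
  fix m and f :: "'a symfun"
  have "of_nat i * (fps_nth ?H (m - i) * specialize N x (V_plus r i f)) =
     (\<Sum>j<N. (r * x j) ^ i - (inverse r * x j) ^ i) * fps_nth ?H (m - i) * specialize N x f"
    if "i \<in> {1..m}" for i
  proof -
    have "i \<noteq> 0" using that by simp
    then have "of_nat i * specialize N x (V_plus r i f) =
        (r ^ i - inverse r ^ i) * (\<Sum>j<N. x j ^ i) * specialize N x f"
      by (simp add: V_plus_def specialize_scale specialize_mult specialize_power_sum)
    also have "(r ^ i - inverse r ^ i) * (\<Sum>j<N. x j ^ i) = (\<Sum>j<N. (r * x j) ^ i - (inverse r * x j) ^ i)"
      by (simp add: sum_distrib_left power_mult_distrib left_diff_distrib)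
    finally show ?thesis by (simp add: mult_ac)
  qed
  then show "of_nat m * (fps_nth ?H m * specialize N x f) =
     (\<Sum>i\<in>{1..m}. of_nat i * (fps_nth ?H (m - i) * specialize N x (V_plus r i f)))"
    by (simp add: mult.assoc[symmetric] linear_fraction_product_nth_euler sum_distrib_right
        del: power_inverse)
qed

text \<open>
  The value of \<open>f\<close> after the translation \<open>p_k \<mapsto> p_k + (r^k - r^-k) z^k\<close>, as a polynomial in \<open>z\<close>.
\<close>

definition shift_poly :: "'a::field \<Rightarrow> nat \<Rightarrow> (nat \<Rightarrow> 'a) \<Rightarrow> 'a symfun \<Rightarrow> 'a poly" where
  "shift_poly r N x = evaluate (\<lambda>c. [:c:])
     (\<lambda>k. [:\<Sum>j<N. x j ^ Suc k:] + Polynomial.monom (r ^ Suc k - inverse r ^ Suc k) (Suc k))"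

text \<open>
  Taylor's formula: \<open>V_minus r k\<close> is \<open>(r^k - r^-k) \<partial>/\<partial>p_k\<close>, and the exponential of a vector field
  with constant coefficients is a translation. The chain rule gives the Euler recursion.
\<close>

lemma specialize_op_exp_V_minus:
  fixes f :: "'a::field_char_0 symfun"
  shows "specialize N x (op_exp (V_minus r) m f) = Polynomial.coeff (shift_poly r N x f) m"
proof (rule V_minus.op_exp_unique)
  show "Polynomial.coeff (shift_poly r N x f) 0 = specialize N x f" for f
    by (simp add: poly_0_coeff_0[symmetric] shift_poly_def poly_evaluate poly_monom specialize_eq_evaluate)
next
  fix m and f :: "'a symfun"
  let ?E = "shift_poly r N x"
  let ?a = "\<lambda>k. r ^ k - inverse r ^ k"
  define S where "S = {..<m} \<union> (\<Union>\<alpha>\<in>Poly_Mapping.keys f. Poly_Mapping.keys \<alpha>)"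
  have pd: "pderiv (?E f) = (\<Sum>k\<in>S. Polynomial.monom (of_nat (Suc k) * ?a (Suc k)) k * ?E (partial_deriv k f))"
    unfolding shift_poly_def
    by (subst pderiv_evaluate[of S])
       (auto simp: S_def pderiv_add pderiv_monom pderiv_pCons simp del: of_nat_Suc)
  have "of_nat m * Polynomial.coeff (?E f) m =
     (\<Sum>k<m. of_nat (Suc k) * ?a (Suc k) * Polynomial.coeff (?E (partial_deriv k f)) (m - Suc k))"
  proof (cases m)
    case (Suc l)
    have "of_nat m * Polynomial.coeff (?E f) m = Polynomial.coeff (pderiv (?E f)) l"
      by (simp add: Suc coeff_pderiv)
    also have "\<dots> = (\<Sum>k\<in>S. if k \<le> l then of_nat (Suc k) * ?a (Suc k) * Polynomial.coeff (?E (partial_deriv k f)) (l - k) else 0)"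
      unfolding pd coeff_sum coeff_monom_mult by (auto intro!: sum.cong)
    also have "\<dots> = (\<Sum>k<m. of_nat (Suc k) * ?a (Suc k) * Polynomial.coeff (?E (partial_deriv k f)) (l - k))"
      by (rule sum.mono_neutral_cong_right) (auto simp: S_def Suc less_Suc_eq_le)
    finally show ?thesis by (simp add: Suc)
  qed simp
  also have "\<dots> = (\<Sum>i\<in>{1..m}. of_nat i * ?a i * Polynomial.coeff (?E (partial_deriv (i - 1) f)) (m - i))"
    by (rule sum.reindex_bij_witness[of _ "\<lambda>i. i - 1" Suc]) auto
  also have "\<dots> = (\<Sum>i\<in>{1..m}. of_nat i * Polynomial.coeff (?E (V_minus r i f)) (m - i))"
    by (rule sum.cong)
       (auto simp: V_minus_def p_perp_def shift_poly_def evaluate_scale[OF comm_ring_hom_const_poly] field_simps)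
  finally show "of_nat m * Polynomial.coeff (?E f) m =
     (\<Sum>i\<in>{1..m}. of_nat i * Polynomial.coeff (?E (V_minus r i f)) (m - i))" .
qed

lemma degree_evaluate_bounded:
  fixes f :: "'a::field symfun"
  shows "\<exists>D. \<forall>\<Phi>. (\<forall>k. degree (\<Phi> k) \<le> Suc k) \<longrightarrow> degree (evaluate (\<lambda>c. [:c:]) \<Phi> f) \<le> D"
proof (induction f rule: symfun_induct)
  case (single \<alpha> c)
  let ?K = "Poly_Mapping.keys \<alpha>"
  show ?case
  proof (intro exI[of _ "\<Sum>i\<in>?K. Suc i * Poly_Mapping.lookup \<alpha> i"] allI impI)
    fix \<Phi> :: "nat \<Rightarrow> 'a poly" assume \<Phi>: "\<forall>k. degree (\<Phi> k) \<le> Suc k"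
    have "degree (evaluate (\<lambda>c. [:c:]) \<Phi> (Poly_Mapping.single \<alpha> c)) \<le> degree (monomial_value \<Phi> \<alpha>)"
      by (simp add: evaluate_single[OF comm_ring_hom_const_poly])
    also have "\<dots> \<le> (\<Sum>i\<in>?K. degree (\<Phi> i ^ Poly_Mapping.lookup \<alpha> i))"
      unfolding monomial_value_def
      using degree_prod_sum_le[OF finite_keys, of "\<lambda>i. \<Phi> i ^ Poly_Mapping.lookup \<alpha> i" \<alpha>] by (simp add: o_def)
    also have "\<dots> \<le> (\<Sum>i\<in>?K. Suc i * Poly_Mapping.lookup \<alpha> i)"
      using \<Phi> by (intro sum_mono order.trans[OF degree_power_le] mult_right_mono) auto
    finally show "degree (evaluate (\<lambda>c. [:c:]) \<Phi> (Poly_Mapping.single \<alpha> c)) \<le> \<dots>" .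
  qed
next
  case (add f g)
  then obtain D D' where
    "\<forall>\<Phi>. (\<forall>k. degree (\<Phi> k) \<le> Suc k) \<longrightarrow> degree (evaluate (\<lambda>c. [:c:]) \<Phi> f) \<le> D"
    "\<forall>\<Phi>. (\<forall>k. degree (\<Phi> k) \<le> Suc k) \<longrightarrow> degree (evaluate (\<lambda>c. [:c:]) \<Phi> g) \<le> D'"
    by blast
  then show ?case
    by (intro exI[of _ "max D D'"])
       (auto simp: evaluate_add[OF comm_ring_hom_const_poly]
         intro!: degree_add_le intro: order.trans[OF _ max.cobounded1] order.trans[OF _ max.cobounded2])
qed

lemma degree_shift_poly_bounded:
  fixes f :: "'a::field symfun"
  shows "\<exists>D. \<forall>N x. degree (shift_poly r N x f) \<le> D"
proof -
  obtain D where "\<forall>\<Phi>. (\<forall>k. degree (\<Phi> k) \<le> Suc k) \<longrightarrow> degree (evaluate (\<lambda>c. [:c:]) \<Phi> f) \<le> D"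
    using degree_evaluate_bounded by blast
  moreover have "degree ([:\<Sum>j<N. x j ^ Suc k:] + Polynomial.monom (r ^ Suc k - inverse r ^ Suc k) (Suc k)) \<le> Suc k"
    for N k and x :: "nat \<Rightarrow> 'a"
    by (intro degree_add_le degree_monom_le) simp
  ultimately show ?thesis unfolding shift_poly_def by (intro exI[of _ D]) simp
qed

text \<open>
  The degree of the translated polynomial in \<open>z\<close> is bounded by the weighted degree of \<open>f\<close>, in any
  number of variables. So the higher coefficients have only zero values.
\<close>

lemma op_exp_V_minus_eventually_0:
  fixes f :: "'a::field_char_0 symfun"
  shows "\<exists>D. (\<forall>N x. degree (shift_poly r N x f) \<le> D) \<and> (\<forall>m>D. op_exp (V_minus r) m f = 0)"
proof -
  obtain D where D: "\<forall>N x. degree (shift_poly r N x f) \<le> D" using degree_shift_poly_bounded by blast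
  have "op_exp (V_minus r) m f = 0" if "m > D" for m
  proof (rule symfun_eqI)
    fix N x
    have "degree (shift_poly r N x f) < m" using D that by (meson le_less_trans)
    then show "specialize N x (op_exp (V_minus r) m f) = specialize N x 0"
      by (simp add: specialize_op_exp_V_minus coeff_eq_0)
  qed
  then show ?thesis using D by blast
qed

lemma V_coeff_eq_sum:
  assumes "\<And>m. m > D \<Longrightarrow> op_exp (V_minus r) m f = 0"
  shows "V_coeff r j f =
    (\<Sum>n\<le>D. if j + int n \<ge> 0 then op_exp (V_plus r) (nat (j + int n)) (op_exp (V_minus r) n f) else 0)"
  unfolding V_coeff_def
proof (rule Sum_any.expand_superset)
  show "{n. (if j + int n \<ge> 0 then op_exp (V_plus r) (nat (j + int n)) (op_exp (V_minus r) n f) else 0) \<noteq> 0} \<subseteq> {..D}"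
    using assms by (auto simp: V_plus.op_exp_zero not_less[symmetric] split: if_splits)
qed simp

lemma V_coeff_add: "V_coeff r j (f + g) = V_coeff r j f + V_coeff r j g"
proof -
  obtain D D' where D: "\<And>m. m > D \<Longrightarrow> op_exp (V_minus r) m f = 0"
      and D': "\<And>m. m > D' \<Longrightarrow> op_exp (V_minus r) m g = 0"
    using op_exp_V_minus_eventually_0[of r f] op_exp_V_minus_eventually_0[of r g] by blast
  let ?M = "max D D'"
  have fg: "op_exp (V_minus r) m (f + g) = 0" if "m > ?M" for m
    using that by (simp add: V_minus.op_exp_add D D')
  show ?thesis
    using V_coeff_eq_sum[of ?M r f j] V_coeff_eq_sum[of ?M r g j] V_coeff_eq_sum[where D = ?M and r = r and f = "f + g" and j = j, OF fg] D D'
    by (auto simp: sum.distrib[symmetric] V_minus.op_exp_add V_plus.op_exp_add intro!: sum.cong)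
qed

lemma V_coeff_scale: "V_coeff r j (scale c f) = scale c (V_coeff r j f)"
proof -
  obtain D where D: "\<And>m. m > D \<Longrightarrow> op_exp (V_minus r) m f = 0"
    using op_exp_V_minus_eventually_0[of r f] by blast
  have "op_exp (V_minus r) m (scale c f) = 0" if "m > D" for m
    using that by (simp add: V_minus.op_exp_scale D)
  from V_coeff_eq_sum[where D = D and r = r and f = "scale c f" and j = j, OF this]
    V_coeff_eq_sum[where D = D and r = r and f = f and j = j, OF D] show ?thesis
    by (auto simp: scale_sum V_minus.op_exp_scale V_plus.op_exp_scale intro!: sum.cong)
qed

section \<open>Operators on alternants\<close>

text \<open>
  The operator that multiplies by \<open>s(x_i)\<close> and substitutes \<open>q x_i\<close> for \<open>x_i\<close>, summed over \<open>i\<close>: by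
  exchanging rows for columns it becomes a sum over the exponents, which are scaled by \<open>q\<close> to the
  exponent.
\<close>

lemma alternant_operator:
  fixes x :: "nat \<Rightarrow> 'a::field"
  shows "(\<Sum>i<N. s (x i) * alternant N (x(i := q * x i)) \<nu>) =
    (\<Sum>j<N. q ^ (\<nu> j + (N - 1 - j)) * det (mat N N (\<lambda>(a, b).
        if b = j then s (x a) * x a ^ (\<nu> b + (N - 1 - b)) else x a ^ (\<nu> b + (N - 1 - b)))))"
proof -
  let ?e = "\<lambda>b. \<nu> b + (N - 1 - b)"
  let ?M' = "\<lambda>a b. s (x a) * (q * x a) ^ ?e b"
  have row: "s (x i) * alternant N (x(i := q * x i)) \<nu> =
      det (mat N N (\<lambda>(a, b). if a = i then ?M' a b else x a ^ ?e b))" if "i < N" for i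
  proof -
    have "s (x i) * alternant N (x(i := q * x i)) \<nu> =
       s (x i) * det (mat N N (\<lambda>(a, b). if a = i then (q * x i) ^ ?e b else x a ^ ?e b))"
      unfolding alternant_def by (intro arg_cong2[where f = "(*)"] arg_cong[where f = det] refl eq_matI) auto
    also have "\<dots> = det (mat N N (\<lambda>(a, b). if a = i then s (x i) * (q * x i) ^ ?e b else x a ^ ?e b))"
      by (rule det_scale_row[OF that, symmetric])
    also have "\<dots> = det (mat N N (\<lambda>(a, b). if a = i then ?M' a b else x a ^ ?e b))"
      by (intro arg_cong[where f = det] eq_matI) auto
    finally show ?thesis .
  qed
  have col: "det (mat N N (\<lambda>(a, b). if b = j then ?M' a b else x a ^ ?e b)) =
      q ^ ?e j * det (mat N N (\<lambda>(a, b). if b = j then s (x a) * x a ^ ?e b else x a ^ ?e b))" if "j < N" for j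
  proof -
    have "det (mat N N (\<lambda>(a, b). if b = j then ?M' a b else x a ^ ?e b)) =
       det (mat N N (\<lambda>(a, b). if b = j then q ^ ?e j * (s (x a) * x a ^ ?e j) else x a ^ ?e b))"
      by (intro arg_cong[where f = det] eq_matI) (auto simp: power_mult_distrib)
    also have "\<dots> = q ^ ?e j * det (mat N N (\<lambda>(a, b). if b = j then s (x a) * x a ^ ?e j else x a ^ ?e b))"
      by (rule det_scale_column[OF that])
    also have "det (mat N N (\<lambda>(a, b). if b = j then s (x a) * x a ^ ?e j else x a ^ ?e b)) =
        det (mat N N (\<lambda>(a, b). if b = j then s (x a) * x a ^ ?e b else x a ^ ?e b))"
      by (intro arg_cong[where f = det] eq_matI) auto
    finally show ?thesis .
  qed
  show ?thesis
    using det_replace_rows_eq_replace_columns[of N ?M' "\<lambda>a b. x a ^ ?e b"]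
    by (simp add: row col del: fun_upd_apply)
qed

lemma alternant_operator_power:
  fixes x :: "nat \<Rightarrow> 'a::field"
  shows "(\<Sum>i<N. x i ^ k * alternant N (x(i := q * x i)) \<nu>) =
    (\<Sum>j<N. q ^ (\<nu> j + (N - 1 - j)) * alternant N x (\<nu>(j := \<nu> j + k)))"
  unfolding alternant_operator[of "\<lambda>z. z ^ k"]
  by (intro sum.cong refl arg_cong2[where f = "(*)"], unfold alternant_def,
      intro arg_cong[where f = det] eq_matI)
     (auto simp: power_add mult_ac simp del: Nat.add_diff_assoc Nat.add_diff_assoc2 diff_diff_left)

lemma alternant_repeated:
  assumes "j < N" "k < N" "j \<noteq> k" "\<nu> j + (N - 1 - j) = \<nu> k + (N - 1 - k)"
  shows "alternant N x \<nu> = 0"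
  unfolding alternant_def by (rule det_equal_columns[of j N k]) (use assms in auto)

text \<open>
  Both sides are polynomials in \<open>y\<close> of degree less than \<open>N\<close> that agree at \<open>x_0, ..., x_(N-1)\<close>.
  This is the part of the Vandermonde formula that is needed to move a single variable.
\<close>

lemma alternant_0_move:
  fixes x :: "nat \<Rightarrow> 'a::field"
  assumes inj: "inj_on x {..<N}" and i: "i < N"
  shows "alternant N (x(i := y)) (\<lambda>_. 0) * (\<Prod>j\<in>{..<N} - {i}. x i - x j) =
         alternant N x (\<lambda>_. 0) * (\<Prod>j\<in>{..<N} - {i}. y - x j)"
proof -
  define c where "c = (\<lambda>b. cofactor (mat N N (\<lambda>(a, b). x a ^ (N - 1 - b))) i b)"
  define P where "P = [:\<Prod>j\<in>{..<N} - {i}. x i - x j:] * (\<Sum>b<N. Polynomial.monom (c b) (N - 1 - b))"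
  define Q where "Q = [:alternant N x (\<lambda>_. 0):] * (\<Prod>j\<in>{..<N} - {i}. [:- x j, 1:])"
  have alt: "alternant N (x(i := z)) (\<lambda>_. 0) = poly (\<Sum>b<N. Polynomial.monom (c b) (N - 1 - b)) z" for z
  proof -
    have "alternant N (x(i := z)) (\<lambda>_. 0) =
       det (mat N N (\<lambda>(a, b). if a = i then z ^ (N - 1 - b) else x a ^ (N - 1 - b)))"
      unfolding alternant_def by (intro arg_cong[where f = det] eq_matI) auto
    then show ?thesis
      by (simp add: det_row_linear_cofactor[OF i] c_def poly_sum poly_monom mult.commute)
  qed
  have "P = Q"
  proof (rule poly_eqI_degree)
    have card: "card (x ` {..<N}) = N" using inj by (simp add: card_image)
    have "degree (\<Sum>b<N. Polynomial.monom (c b) (N - 1 - b)) \<le> N - 1"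
      by (intro degree_sum_le) (auto intro: order.trans[OF degree_monom_le])
    then have "degree P \<le> N - 1" unfolding P_def
      by (simp add: order.trans[OF degree_smult_le])
    then show "card (x ` {..<N}) > degree P" unfolding card using i by simp
    have "degree Q \<le> (\<Sum>j\<in>{..<N} - {i}. degree [:- x j, 1:])" unfolding Q_def
      using degree_prod_sum_le[of "{..<N} - {i}" "\<lambda>j. [:- x j, 1:]"]
      by (simp add: o_def order.trans[OF degree_smult_le])
    also have "\<dots> = N - 1" using i by simp
    finally show "card (x ` {..<N}) > degree Q" unfolding card using i by simp
    fix z assume "z \<in> x ` {..<N}"
    then obtain k where k: "k < N" "z = x k" by auto
    show "poly P z = poly Q z"
    proof (cases "k = i")
      case True
      then show ?thesis
        using k alt[of "x i"] by (simp add: P_def Q_def poly_prod)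
    next
      case False
      \<comment> \<open>At the remaining points two variables coincide on the left and a factor vanishes on the right.\<close>
      have "\<not> inj_on (x(i := z)) {..<N}"
        using k i False by (auto simp: inj_on_def)
      then have "alternant N (x(i := z)) (\<lambda>_. 0) = 0" by (rule alternant_eq_0)
      moreover have "poly (\<Prod>j\<in>{..<N} - {i}. [:- x j, 1:]) z = 0"
        using k False by (auto simp: poly_prod intro!: prod_zero bexI[of _ k])
      ultimately show ?thesis using alt[of z] by (simp add: P_def Q_def)
    qed
  qed
  then have "poly P y = poly Q y" by simp
  then show ?thesis using alt[of y] by (simp add: P_def Q_def poly_prod mult.commute)
qed

lemma poly_eq_sum_coeff:
  fixes p :: "'a::comm_ring_1 poly"
  assumes "degree p \<le> D"
  shows "poly p z = (\<Sum>n\<le>D. Polynomial.coeff p n * z ^ n)"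
  unfolding poly_altdef
  by (rule sum.mono_neutral_left) (use assms in \<open>auto simp: coeff_eq_0\<close>)

section \<open>The vertex operator as a difference operator\<close>

text \<open>
  The coefficient of \<open>1 / (1 - r x_i t)\<close> in the partial fraction decomposition of
  \<open>\<Prod>j. (1 - x_j t / r) / (1 - r x_j t)\<close>.
\<close>

definition residue_weight :: "'a::field \<Rightarrow> nat \<Rightarrow> (nat \<Rightarrow> 'a) \<Rightarrow> nat \<Rightarrow> 'a" where
  "residue_weight r N x i =
     (\<Prod>j<N. 1 - (inverse r * x j) / (r * x i)) / (\<Prod>j\<in>{..<N} - {i}. 1 - (r * x j) / (r * x i))"

context
  fixes r :: "'a::field_char_0" and N :: nat and x :: "nat \<Rightarrow> 'a"
  assumes r: "r \<noteq> 0" and inj: "inj_on x {..<N}" and nz: "\<And>i. i < N \<Longrightarrow> x i \<noteq> 0"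
begin

lemma linear_fraction_product_residues:
  "fps_nth (linear_fraction_product N (\<lambda>j. inverse r * x j) (\<lambda>j. r * x j)) m =
     (if m = 0 then 1 - (\<Sum>i<N. residue_weight r N x i) else 0) +
     (\<Sum>i<N. residue_weight r N x i * (r * x i) ^ m)"
proof -
  have "inj_on (\<lambda>j. r * x j) {..<N}" using inj r by (auto simp: inj_on_def)
  moreover have "r * x i \<noteq> 0" if "i < N" for i using nz[OF that] r by simp
  ultimately show ?thesis
    by (subst linear_fraction_product_partial_fractions)
       (auto simp: residue_weight_def fps_sum_nth geometric_fps_def)
qed

text \<open>
  Up to a factor that depends only on \<open>r\<close> and \<open>N\<close>, the weight is
  \<open>\<Prod>j\<noteq>i. (q x_i - x_j) / (x_i - x_j)\<close> with \<open>q = r^2\<close>, the quotient of the Vandermonde alternants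
  at the shifted and at the original point.
\<close>

lemma residue_weight_alternant:
  assumes i: "i < N"
  shows "residue_weight r N x i * alternant N x (\<lambda>_. 0) =
     (r - inverse r) * inverse r * inverse (r ^ 2) ^ (N - 1) * alternant N (x(i := r ^ 2 * x i)) (\<lambda>_. 0)"
proof -
  let ?J = "{..<N} - {i}"
  have xi: "x i \<noteq> 0" using nz i by simp
  have J: "card ?J = N - 1" using i by simp
  have ne: "x i - x j \<noteq> 0" if "j \<in> ?J" for j using that inj i by (auto simp: inj_on_def)
  have ne': "(\<Prod>j\<in>?J. x i - x j) \<noteq> 0" using ne by (subst prod_zero_iff) auto
  have "(\<Prod>j<N. 1 - (inverse r * x j) / (r * x i)) =
     (1 - (inverse r * x i) / (r * x i)) * (\<Prod>j\<in>?J. 1 - (inverse r * x j) / (r * x i))"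
    using i by (intro prod.remove) auto
  also have "1 - (inverse r * x i) / (r * x i) = (r - inverse r) * inverse r"
    using xi r by (simp add: field_simps)
  also have "(\<Prod>j\<in>?J. 1 - (inverse r * x j) / (r * x i)) =
      (\<Prod>j\<in>?J. inverse (r ^ 2) * inverse (x i) * (r ^ 2 * x i - x j))"
    using xi r by (intro prod.cong) (auto simp: field_simps power2_eq_square)
  also have "\<dots> = inverse (r ^ 2) ^ (N - 1) * inverse (x i) ^ (N - 1) * (\<Prod>j\<in>?J. r ^ 2 * x i - x j)"
    by (simp only: prod.distrib prod_constant J)
  finally have num: "(\<Prod>j<N. 1 - (inverse r * x j) / (r * x i)) = (r - inverse r) * inverse r *
     (inverse (r ^ 2) ^ (N - 1) * inverse (x i) ^ (N - 1) * (\<Prod>j\<in>?J. r ^ 2 * x i - x j))" .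
  have "(\<Prod>j\<in>?J. 1 - (r * x j) / (r * x i)) = (\<Prod>j\<in>?J. inverse (x i) * (x i - x j))"
    using xi r by (intro prod.cong) (auto simp: field_simps)
  also have "\<dots> = inverse (x i) ^ (N - 1) * (\<Prod>j\<in>?J. x i - x j)"
    by (simp only: prod.distrib prod_constant J)
  finally have "residue_weight r N x i = (r - inverse r) * inverse r * inverse (r ^ 2) ^ (N - 1) *
      (\<Prod>j\<in>?J. r ^ 2 * x i - x j) / (\<Prod>j\<in>?J. x i - x j)"
    unfolding residue_weight_def num using xi by simp
  moreover have "alternant N (x(i := r ^ 2 * x i)) (\<lambda>_. 0) =
      alternant N x (\<lambda>_. 0) * (\<Prod>j\<in>?J. r ^ 2 * x i - x j) / (\<Prod>j\<in>?J. x i - x j)"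
    using alternant_0_move[OF inj i, of "r ^ 2 * x i"] ne' by (simp add: field_simps)
  ultimately show ?thesis
    by (simp only: times_divide_eq_left times_divide_eq_right mult_ac)
qed

text \<open>
  At \<open>z = r x_i\<close> the translation adds \<open>(q x_i)^k - x_i^k\<close> to the \<open>k\<close>-th power sum: it replaces the
  variable \<open>x_i\<close> by \<open>q x_i\<close>.
\<close>

lemma poly_shift_poly_residue:
  assumes "i < N"
  shows "poly (shift_poly r N x f) (r * x i) = specialize N (x(i := r ^ 2 * x i)) f"
proof -
  have "(\<Sum>j<N. x j ^ Suc k) + (r ^ Suc k - inverse r ^ Suc k) * (r * x i) ^ Suc k =
     (\<Sum>j<N. (x(i := r ^ 2 * x i)) j ^ Suc k)" for k
  proof -
    have "(\<Sum>j<N. (x(i := r ^ 2 * x i)) j ^ Suc k) = (r ^ 2 * x i) ^ Suc k + (\<Sum>j\<in>{..<N} - {i}. x j ^ Suc k)"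
      using assms by (subst sum.remove[of _ i]) (auto intro!: sum.cong)
    moreover have "(\<Sum>j<N. x j ^ Suc k) = x i ^ Suc k + (\<Sum>j\<in>{..<N} - {i}. x j ^ Suc k)"
      using assms by (intro sum.remove) auto
    moreover have "(r ^ Suc k - inverse r ^ Suc k) * (r * x i) ^ Suc k = (r ^ 2 * x i) ^ Suc k - x i ^ Suc k"
    proof -
      have "(r ^ Suc k - inverse r ^ Suc k) * (r * x i) ^ Suc k =
         (r * (r * x i)) ^ Suc k - (inverse r * (r * x i)) ^ Suc k"
        by (simp only: left_diff_distrib power_mult_distrib)
      also have "r * (r * x i) = r ^ 2 * x i" by (simp add: power2_eq_square)
      also have "inverse r * (r * x i) = x i" using r by simp
      finally show ?thesis .
    qed
    ultimately show ?thesis by (simp del: power_Suc)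
  qed
  then show ?thesis
    unfolding shift_poly_def poly_evaluate specialize_eq_evaluate by (simp add: poly_monom)
qed

text \<open>
  The coefficient of \<open>t\<close> in the product of \<open>\<Sum>m. \<gamma>_m t^m\<close> and the polynomial \<open>\<Sum>n. c_n t^-n\<close> is
  \<open>\<Sum>n. \<gamma>_(n+1) c_n\<close>. The partial fractions make \<open>\<gamma>_m\<close> a combination of the powers \<open>(r x_i)^m\<close>, and
  the sum over \<open>n\<close> evaluates the polynomial at \<open>r x_i\<close>.
\<close>

lemma specialize_V_coeff_1:
  "specialize N x (V_coeff r 1 f) =
     (\<Sum>i<N. residue_weight r N x i * (r * x i) * specialize N (x(i := r ^ 2 * x i)) f)"
proof -
  let ?E = "shift_poly r N x f" and ?A = "residue_weight r N x"
  obtain D where D: "degree ?E \<le> D" and D0: "\<And>m. m > D \<Longrightarrow> op_exp (V_minus r) m f = 0"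
    using op_exp_V_minus_eventually_0[of r f] by blast
  have V: "V_coeff r (1) f = (\<Sum>n\<le>D. if 1 + int n \<ge> 0
      then op_exp (V_plus r) (nat (1 + int n)) (op_exp (V_minus r) n f) else 0)"
    by (rule V_coeff_eq_sum) (rule D0)
  have "specialize N x (V_coeff r 1 f) =
     (\<Sum>n\<le>D. (\<Sum>i<N. ?A i * (r * x i) ^ Suc n) * Polynomial.coeff ?E n)"
    unfolding V specialize_sum
    by (rule sum.cong) (simp_all add: specialize_op_exp_V_plus specialize_op_exp_V_minus
        linear_fraction_product_residues nat_add_distrib del: power_Suc)
  also have "\<dots> = (\<Sum>i<N. ?A i * (r * x i) * (\<Sum>n\<le>D. Polynomial.coeff ?E n * (r * x i) ^ n))"
    by (simp add: sum_distrib_left sum_distrib_right sum.swap[of _ "{..D}"] mult_ac)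
  also have "\<dots> = (\<Sum>i<N. ?A i * (r * x i) * poly ?E (r * x i))"
    by (simp add: poly_eq_sum_coeff[OF D])
  finally show ?thesis by (simp add: poly_shift_poly_residue)
qed

text \<open>
  Now the sum is \<open>\<Sum>n\<ge>1. \<gamma>_(n-1) c_n\<close>. It misses \<open>c_0\<close>, the value of \<open>f\<close>, and it involves \<open>\<gamma>_0\<close>,
  whose constant part multiplies \<open>c_1\<close>, a multiple of \<open>\<partial>f/\<partial>p_1\<close>.
\<close>

lemma specialize_V_coeff_minus_1:
  "specialize N x (V_coeff r (-1) f) =
     (1 - (\<Sum>i<N. residue_weight r N x i)) * (r - inverse r) * specialize N x (partial_deriv 0 f) +
     (\<Sum>i<N. residue_weight r N x i * inverse (r * x i) *
        (specialize N (x(i := r ^ 2 * x i)) f - specialize N x f))"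
proof -
  let ?E = "shift_poly r N x f" and ?A = "residue_weight r N x"
  obtain D0 where D0: "degree ?E \<le> D0" "\<And>m. m > D0 \<Longrightarrow> op_exp (V_minus r) m f = 0"
    using op_exp_V_minus_eventually_0[of r f] by blast
  \<comment> \<open>One more than needed for the degree, so that \<open>n = 1\<close> always belongs to the summation range.\<close>
  define D where "D = Suc D0"
  have D: "degree ?E \<le> D" and D': "\<And>m. m > D \<Longrightarrow> op_exp (V_minus r) m f = 0"
    using D0 by (auto simp: D_def)
  have tail: "(\<Sum>n\<in>{1..D}. Polynomial.coeff ?E n * z ^ n) = poly ?E z - Polynomial.coeff ?E 0" for z
    unfolding poly_eq_sum_coeff[OF D] by (simp add: atMost_atLeast0 sum.atLeast_Suc_atMost[of 0])
  have c0: "Polynomial.coeff ?E 0 = specialize N x f"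
    using specialize_op_exp_V_minus[of N x r 0 f] by (simp add: op_exp_def)
  have c1: "Polynomial.coeff ?E 1 = (r - inverse r) * specialize N x (partial_deriv 0 f)"
    using specialize_op_exp_V_minus[of N x r 1 f]
    by (simp add: op_exp_def V_minus.A_zero V_minus_def p_perp_def specialize_scale)
  let ?\<gamma> = "\<lambda>m. fps_nth (linear_fraction_product N (\<lambda>j. inverse r * x j) (\<lambda>j. r * x j)) m"
  have V: "V_coeff r (-1) f = (\<Sum>n\<le>D. if -1 + int n \<ge> 0
      then op_exp (V_plus r) (nat (-1 + int n)) (op_exp (V_minus r) n f) else 0)"
    by (rule V_coeff_eq_sum) (rule D')
  have "specialize N x (V_coeff r (-1) f) =
     (\<Sum>n\<le>D. if n = 0 then 0 else ?\<gamma> (n - 1) * Polynomial.coeff ?E n)"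
    unfolding V specialize_sum
    by (rule sum.cong) (auto simp: specialize_op_exp_V_plus specialize_op_exp_V_minus nat_diff_distrib)
  also have "\<dots> = (\<Sum>n\<in>{1..D}. ?\<gamma> (n - 1) * Polynomial.coeff ?E n)"
    by (rule sum.mono_neutral_cong_right) auto
  also have "\<dots> = (\<Sum>n\<in>{1..D}. (if n = 1 then (1 - (\<Sum>i<N. ?A i)) * Polynomial.coeff ?E 1 else 0) +
      (\<Sum>i<N. ?A i * inverse (r * x i) * (Polynomial.coeff ?E n * (r * x i) ^ n)))"
  proof (rule sum.cong)
    fix n assume n: "n \<in> {1..D}"
    have "(r * x i) ^ (n - 1) = inverse (r * x i) * (r * x i) ^ n" if "i < N" for i
      using n nz[OF that] r by (cases n) (auto simp: field_simps)
    then have "(\<Sum>i<N. ?A i * (r * x i) ^ (n - 1)) * Polynomial.coeff ?E n =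
      (\<Sum>i<N. ?A i * inverse (r * x i) * (Polynomial.coeff ?E n * (r * x i) ^ n))"
      by (simp add: sum_distrib_right sum_distrib_left mult_ac)
    then show "?\<gamma> (n - 1) * Polynomial.coeff ?E n =
       (if n = 1 then (1 - (\<Sum>i<N. ?A i)) * Polynomial.coeff ?E 1 else 0) +
      (\<Sum>i<N. ?A i * inverse (r * x i) * (Polynomial.coeff ?E n * (r * x i) ^ n))"
      using n unfolding linear_fraction_product_residues by (simp add: distrib_right)
  qed simp
  also have "\<dots> = (1 - (\<Sum>i<N. ?A i)) * Polynomial.coeff ?E 1 +
     (\<Sum>i<N. ?A i * inverse (r * x i) * (\<Sum>n\<in>{1..D}. Polynomial.coeff ?E n * (r * x i) ^ n))"
  proof -
    have "1 \<in> {1..D}" by (simp add: D_def)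
    then show ?thesis
      unfolding sum.distrib sum_distrib_left sum.swap[of _ "{1..D}"] by simp
  qed
  finally show ?thesis
    unfolding tail c0 c1 by (simp add: poly_shift_poly_residue mult.assoc)
qed

end

section \<open>The vertex operator on Schur functions\<close>

text \<open>
  The property by which Schur functions are defined.
\<close>

definition represents :: "'a::field symfun \<Rightarrow> (nat \<Rightarrow> nat) \<Rightarrow> bool" where
  "represents f \<nu> \<longleftrightarrow> (\<forall>n x. (\<forall>i\<ge>n. \<nu> i = 0) \<longrightarrow>
     specialize n x f * alternant n x (\<lambda>_. 0) = alternant n x \<nu>)"

lemma representsD:
  "represents f \<nu> \<Longrightarrow> (\<And>i. i \<ge> n \<Longrightarrow> \<nu> i = 0) \<Longrightarrow>
   specialize n x f * alternant n x (\<lambda>_. 0) = alternant n x \<nu>"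
  by (auto simp: represents_def)

text \<open>
  The alternant of \<open>\<nu> + \<delta>\<close> with 1 subtracted from its last exponent, when the last entry of \<open>\<nu>\<close> is
  0. The exponent \<open>-1\<close> is not of the form required by the function \<open>alternant\<close>.
\<close>

definition lowered_alternant :: "nat \<Rightarrow> (nat \<Rightarrow> 'a::field) \<Rightarrow> (nat \<Rightarrow> nat) \<Rightarrow> 'a" where
  "lowered_alternant N x \<nu> = det (mat N N (\<lambda>(a, b).
     if b = N - 1 then inverse (x a) else x a ^ (\<nu> b + (N - 1 - b))))"

text \<open>
  The alternant in \<open>N + 1\<close> variables as a polynomial in the last one, by expansion along the last
  row.
\<close>

definition alternant_poly :: "nat \<Rightarrow> (nat \<Rightarrow> 'a::field) \<Rightarrow> (nat \<Rightarrow> nat) \<Rightarrow> 'a poly" where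
  "alternant_poly N x \<nu> = (\<Sum>b<Suc N. Polynomial.monom
      (cofactor (mat (Suc N) (Suc N) (\<lambda>(a, b). x a ^ (\<nu> b + (N - b)))) N b) (\<nu> b + (N - b)))"

lemma poly_alternant_poly: "poly (alternant_poly N x \<nu>) y = alternant (Suc N) (x(N := y)) \<nu>"
proof -
  have "alternant (Suc N) (x(N := y)) \<nu> = det (mat (Suc N) (Suc N) (\<lambda>(a, b).
      if a = N then y ^ (\<nu> b + (N - b)) else x a ^ (\<nu> b + (N - b))))"
    unfolding alternant_def by (intro arg_cong[where f = det] eq_matI) auto
  then show ?thesis
    by (subst (asm) det_row_linear_cofactor)
       (simp_all add: alternant_poly_def poly_sum poly_monom mult.commute)
qed

text \<open>
  The exponents in the last row are distinct and end with 1 and 0, so each of the two coefficients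
  is a single minor. A factor \<open>x_a\<close> taken from each of its rows turns the minor into an alternant
  in \<open>N\<close> variables, lowered in the case of the coefficient of \<open>y\<close>.
\<close>

lemma coeff_alternant_poly:
  assumes N: "N \<ge> 1" and \<nu>: "\<And>i. i \<ge> N - 1 \<Longrightarrow> \<nu> i = 0" and nz: "\<And>i. i < N \<Longrightarrow> x i \<noteq> 0"
  shows "Polynomial.coeff (alternant_poly N x \<nu>) 0 = (\<Prod>a<N. x a) * alternant N x \<nu>"
    and "Polynomial.coeff (alternant_poly N x \<nu>) 1 = - (\<Prod>a<N. x a) * lowered_alternant N x \<nu>"
proof -
  let ?A = "mat (Suc N) (Suc N) (\<lambda>(a, b). x a ^ (\<nu> b + (N - b)))"
  have "Polynomial.coeff (alternant_poly N x \<nu>) 0 = (\<Sum>b<Suc N. if b = N then cofactor ?A N N else 0)"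
    unfolding alternant_poly_def coeff_sum using \<nu> by (intro sum.cong) auto
  also have "\<dots> = cofactor ?A N N" by simp
  also have "\<dots> = det (mat N N (\<lambda>(a, b). x a * x a ^ (\<nu> b + (N - 1 - b))))"
  proof -
    have "mat_delete ?A N N = mat N N (\<lambda>(a, b). x a * x a ^ (\<nu> b + (N - 1 - b)))"
      by (rule eq_matI) (auto simp: mat_delete_def Suc_diff_Suc simp flip: power_Suc)
    then show ?thesis by (simp add: cofactor_def)
  qed
  also have "\<dots> = (\<Prod>a<N. x a) * alternant N x \<nu>"
    by (simp only: det_scale_rows alternant_def)
  finally show "Polynomial.coeff (alternant_poly N x \<nu>) 0 = (\<Prod>a<N. x a) * alternant N x \<nu>" .
  have "Polynomial.coeff (alternant_poly N x \<nu>) 1 = (\<Sum>b<Suc N. if b = N - 1 then cofactor ?A N (N - 1) else 0)"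
    unfolding alternant_poly_def coeff_sum
  proof (intro sum.cong refl)
    fix b assume "b \<in> {..<Suc N}"
    then consider "b < N - 1" | "b = N - 1" | "b = N" using N by fastforce
    then show "Polynomial.coeff (Polynomial.monom (cofactor ?A N b) (\<nu> b + (N - b))) 1 =
        (if b = N - 1 then cofactor ?A N (N - 1) else 0)"
      by cases (use \<nu>[of b] N in auto)
  qed
  also have "\<dots> = cofactor ?A N (N - 1)" using N by simp
  also have "\<dots> = - det (mat N N (\<lambda>(a, b). x a * (if b = N - 1 then inverse (x a) else x a ^ (\<nu> b + (N - 1 - b)))))"
  proof -
    have "mat_delete ?A N (N - 1) = mat N N (\<lambda>(a, b). x a * (if b = N - 1 then inverse (x a) else x a ^ (\<nu> b + (N - 1 - b))))"
      using N \<nu>[of N] nz by (intro eq_matI) (auto simp: mat_delete_def Suc_diff_Suc simp flip: power_Suc)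
    moreover have "odd (N + (N - 1))" using N by (cases N) auto
    ultimately show ?thesis by (simp add: cofactor_def)
  qed
  also have "\<dots> = - (\<Prod>a<N. x a) * lowered_alternant N x \<nu>"
    by (simp only: det_scale_rows lowered_alternant_def mult_minus_left)
  finally show "Polynomial.coeff (alternant_poly N x \<nu>) 1 = - (\<Prod>a<N. x a) * lowered_alternant N x \<nu>" .
qed

text \<open>
  Adding a variable \<open>y\<close> changes the value of \<open>f\<close> by \<open>y \<partial>f/\<partial>p_1 + O(y^2)\<close>. The claim is the
  coefficient of \<open>y\<close> in the defining identity of Schur functions in \<open>N + 1\<close> variables.
\<close>

lemma specialize_partial_deriv_represents:
  fixes f :: "'a::field_char_0 symfun"
  assumes f: "represents f \<nu>" and N: "N \<ge> 1" and \<nu>: "\<And>i. i \<ge> N - 1 \<Longrightarrow> \<nu> i = 0"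
    and nz: "\<And>i. i < N \<Longrightarrow> x i \<noteq> 0"
  shows "specialize N x (partial_deriv 0 f) * alternant N x (\<lambda>_. 0) =
     specialize N x f * lowered_alternant N x (\<lambda>_. 0) - lowered_alternant N x \<nu>"
proof -
  define \<Phi> where "\<Phi> = (\<lambda>k. [:\<Sum>j<N. x j ^ Suc k:] + Polynomial.monom 1 (Suc k))"
  define Q where "Q = evaluate (\<lambda>c. [:c:]) \<Phi> f"
  let ?S = "insert 0 (\<Union>\<alpha>\<in>Poly_Mapping.keys f. Poly_Mapping.keys \<alpha>)"
  let ?\<Pi> = "\<Prod>a<N. x a"
  have "poly Q y = specialize (Suc N) (x(N := y)) f" for y
    by (simp add: Q_def \<Phi>_def poly_evaluate poly_monom specialize_eq_evaluate)
  then have "poly (Q * alternant_poly N x (\<lambda>_. 0)) y = poly (alternant_poly N x \<nu>) y" for y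
    using representsD[OF f, of "Suc N" "x(N := y)"] \<nu> by (simp add: poly_alternant_poly)
  then have eq: "Q * alternant_poly N x (\<lambda>_. 0) = alternant_poly N x \<nu>"
    by (simp add: poly_eq_poly_eq_iff[symmetric] fun_eq_iff)
  have Q0: "Polynomial.coeff Q 0 = specialize N x f"
    by (simp add: poly_0_coeff_0[symmetric] Q_def \<Phi>_def poly_evaluate poly_monom specialize_eq_evaluate)
  have "Polynomial.coeff Q 1 = poly (pderiv Q) 0"
    by (simp add: poly_0_coeff_0 coeff_pderiv)
  also have "pderiv Q = (\<Sum>k\<in>?S. pderiv (\<Phi> k) * evaluate (\<lambda>c. [:c:]) \<Phi> (partial_deriv k f))"
    unfolding Q_def by (rule pderiv_evaluate) auto
  also have "poly \<dots> 0 = (\<Sum>k\<in>?S. if k = 0 then specialize N x (partial_deriv 0 f) else 0)"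
    unfolding poly_sum
    by (intro sum.cong refl) (auto simp: \<Phi>_def pderiv_add pderiv_monom pderiv_pCons poly_monom
        poly_evaluate specialize_eq_evaluate power_0_left)
  also have "\<dots> = specialize N x (partial_deriv 0 f)"
    by (subst sum.delta) auto
  finally have Q1: "Polynomial.coeff Q 1 = specialize N x (partial_deriv 0 f)" .
  have "Polynomial.coeff (Q * alternant_poly N x (\<lambda>_. 0)) 1 =
     Polynomial.coeff Q 0 * Polynomial.coeff (alternant_poly N x (\<lambda>_. 0)) 1 +
     Polynomial.coeff Q 1 * Polynomial.coeff (alternant_poly N x (\<lambda>_. 0)) 0"
    by (simp add: coeff_mult)
  then have "?\<Pi> * (specialize N x (partial_deriv 0 f) * alternant N x (\<lambda>_. 0)) =
     ?\<Pi> * (specialize N x f * lowered_alternant N x (\<lambda>_. 0) - lowered_alternant N x \<nu>)"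
    using coeff_alternant_poly[of N "\<lambda>_. 0" x, OF N _ nz] coeff_alternant_poly[of N \<nu> x, OF N \<nu> nz]
    unfolding eq Q0 Q1 by (simp add: algebra_simps)
  moreover have "?\<Pi> \<noteq> 0" using nz by simp
  ultimately show ?thesis by simp
qed

text \<open>
  Times the Vandermonde alternant, the difference operator becomes
  \<open>\<Sum>i. x_i a_(\<nu>+\<delta>)(..., q x_i, ...)\<close>, which raises one exponent at a time. The exponent
  \<open>\<nu>_j + N - 1 - j\<close> of \<open>q\<close> is corrected by the factor \<open>q^(1-N)\<close> of the residues, which leaves the
  content \<open>\<nu>_j - j\<close>.
\<close>

lemma specialize_V_coeff_1_represents:
  fixes f :: "'a::field_char_0 symfun"
  assumes f: "represents f \<nu>" and \<nu>: "\<And>i. i \<ge> N \<Longrightarrow> \<nu> i = 0"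
    and r: "r \<noteq> 0" and inj: "inj_on x {..<N}" and nz: "\<And>i. i < N \<Longrightarrow> x i \<noteq> 0"
  shows "specialize N x (V_coeff r 1 f) * alternant N x (\<lambda>_. 0) =
    (r - inverse r) * (\<Sum>j<N. (r ^ 2) ^ \<nu> j * inverse (r ^ 2) ^ j * alternant N x (\<nu>(j := Suc (\<nu> j))))"
proof -
  let ?q = "r ^ 2"
  let ?T = "\<lambda>i. x(i := ?q * x i)"
  let ?c = "(r - inverse r) * inverse ?q ^ (N - 1)"
  have "specialize N x (V_coeff r 1 f) * alternant N x (\<lambda>_. 0) =
     (\<Sum>i<N. (residue_weight r N x i * alternant N x (\<lambda>_. 0)) * (r * x i) * specialize N (?T i) f)"
    unfolding specialize_V_coeff_1[OF r inj nz, simplified] sum_distrib_right by (simp add: mult_ac)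
  also have "\<dots> = (\<Sum>i<N. ?c * (x i * (specialize N (?T i) f * alternant N (?T i) (\<lambda>_. 0))))"
  proof (rule sum.cong)
    fix i assume "i \<in> {..<N}"
    then have "(residue_weight r N x i * alternant N x (\<lambda>_. 0)) * (r * x i) =
        (r - inverse r) * inverse r * inverse ?q ^ (N - 1) * alternant N (?T i) (\<lambda>_. 0) * (r * x i)"
      using residue_weight_alternant[OF r inj nz] by simp
    also have "\<dots> = ?c * (x i * alternant N (?T i) (\<lambda>_. 0))" using r by simp
    finally have *: "(residue_weight r N x i * alternant N x (\<lambda>_. 0)) * (r * x i) = \<dots>" .
    show "(residue_weight r N x i * alternant N x (\<lambda>_. 0)) * (r * x i) * specialize N (?T i) f =
        ?c * (x i * (specialize N (?T i) f * alternant N (?T i) (\<lambda>_. 0)))"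
      unfolding * by (simp only: mult_ac)
  qed simp
  also have "\<dots> = ?c * (\<Sum>i<N. x i ^ 1 * alternant N (?T i) \<nu>)"
  proof -
    have "specialize N (?T i) f * alternant N (?T i) (\<lambda>_. 0) = alternant N (?T i) \<nu>" for i
      by (rule representsD[OF f \<nu>])
    then show ?thesis by (simp add: sum_distrib_left)
  qed
  also have "\<dots> = (r - inverse r) * (\<Sum>j<N. inverse ?q ^ (N - 1) * ?q ^ (\<nu> j + (N - 1 - j)) *
      alternant N x (\<nu>(j := Suc (\<nu> j))))"
    unfolding alternant_operator_power by (simp add: sum_distrib_left mult_ac)
  also have "(\<Sum>j<N. inverse ?q ^ (N - 1) * ?q ^ (\<nu> j + (N - 1 - j)) * alternant N x (\<nu>(j := Suc (\<nu> j)))) =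
     (\<Sum>j<N. ?q ^ \<nu> j * inverse ?q ^ j * alternant N x (\<nu>(j := Suc (\<nu> j))))"
  proof (rule sum.cong)
    fix j assume "j \<in> {..<N}"
    then have "inverse ?q ^ (N - 1) = inverse ?q ^ j * inverse ?q ^ (N - 1 - j)"
      by (simp flip: power_add)
    then show "inverse ?q ^ (N - 1) * ?q ^ (\<nu> j + (N - 1 - j)) * alternant N x (\<nu>(j := Suc (\<nu> j))) =
       ?q ^ \<nu> j * inverse ?q ^ j * alternant N x (\<nu>(j := Suc (\<nu> j)))"
      using r by (simp only: power_add) (simp add: field_simps)
  qed simp
  finally show ?thesis .
qed

text \<open>
  The difference operator now lowers one exponent at a time. Lowering the last exponent, which is
  0, produces \<open>lowered_alternant\<close>, and the term with \<open>\<partial>f/\<partial>p_1\<close> cancels exactly this contribution.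
\<close>

lemma specialize_V_coeff_minus_1_represents:
  fixes f :: "'a::field_char_0 symfun"
  assumes f: "represents f \<nu>" and anti: "antimono \<nu>" and N: "N \<ge> 1" and \<nu>: "\<And>i. i \<ge> N - 1 \<Longrightarrow> \<nu> i = 0"
    and r: "r \<noteq> 0" and inj: "inj_on x {..<N}" and nz: "\<And>i. i < N \<Longrightarrow> x i \<noteq> 0"
  shows "specialize N x (V_coeff r (-1) f) * alternant N x (\<lambda>_. 0) =
    (r - inverse r) * (\<Sum>j<N. if \<nu> (Suc j) < \<nu> j
        then (r ^ 2) ^ \<nu> j * inverse (r ^ 2) ^ Suc j * alternant N x (\<nu>(j := \<nu> j - 1)) else 0)"
proof -
  let ?q = "r ^ 2"
  let ?T = "\<lambda>i. x(i := ?q * x i)"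
  let ?s = "\<lambda>f. specialize N x f"
  let ?a0 = "alternant N x (\<lambda>_. 0)"
  let ?c = "(r - inverse r) * inverse ?q ^ N"
  let ?W = "\<lambda>i. residue_weight r N x i"
  let ?removed = "\<lambda>j. alternant N x (\<nu>(j := \<nu> j - 1))"
  have W: "?W i * ?a0 = (1 - inverse ?q) * inverse ?q ^ (N - 1) * alternant N (?T i) (\<lambda>_. 0)" if "i < N" for i
    using residue_weight_alternant[OF r inj nz that] r by (simp add: field_simps power2_eq_square)
  \<comment> \<open>The constant of the partial fractions is \<open>q^-N\<close>: the residues sum to a geometric series.\<close>
  have W1: "(1 - (\<Sum>i<N. ?W i)) * ?a0 = inverse ?q ^ N * ?a0"
  proof -
    have "(\<Sum>i<N. ?W i) * ?a0 = (\<Sum>i<N. (1 - inverse ?q) * inverse ?q ^ (N - 1) * alternant N (?T i) (\<lambda>_. 0))"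
      unfolding sum_distrib_right by (rule sum.cong) (simp_all add: W)
    also have "\<dots> = (1 - inverse ?q) * inverse ?q ^ (N - 1) * (\<Sum>i<N. x i ^ 0 * alternant N (?T i) (\<lambda>_. 0))"
      by (simp add: sum_distrib_left)
    also have "(\<Sum>i<N. x i ^ 0 * alternant N (?T i) (\<lambda>_. 0)) = (\<Sum>j<N. ?q ^ (N - Suc j)) * ?a0"
    proof -
      have "(\<lambda>_. 0 :: nat)(j := 0) = (\<lambda>_. 0)" for j :: nat by auto
      then show ?thesis unfolding alternant_operator_power by (simp add: sum_distrib_right)
    qed
    also have "(\<Sum>j<N. ?q ^ (N - Suc j)) = (\<Sum>j<N. ?q ^ j)" by (rule sum.nat_diff_reindex)
    also have "(1 - inverse ?q) * inverse ?q ^ (N - 1) * ((\<Sum>j<N. ?q ^ j) * ?a0) =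
        inverse ?q ^ N * ((?q - 1) * (\<Sum>j<N. ?q ^ j)) * ?a0"
      using r N by (cases N) (simp_all add: field_simps)
    also have "(?q - 1) * (\<Sum>j<N. ?q ^ j) = ?q ^ N - 1" by (rule power_diff_1_eq[symmetric])
    finally show ?thesis using r by (simp add: field_simps)
  qed
  have W2: "?W i * inverse (r * x i) * ?a0 = ?c * (inverse (x i) * alternant N (?T i) (\<lambda>_. 0))" if "i < N" for i
  proof -
    have "?W i * inverse (r * x i) * ?a0 = (?W i * ?a0) * inverse (r * x i)" by (simp add: mult_ac)
    also have "\<dots> = ?c * (inverse (x i) * alternant N (?T i) (\<lambda>_. 0))"
      unfolding W[OF that] using r nz[OF that] N by (cases N) (simp_all add: field_simps power2_eq_square)
    finally show ?thesis .
  qed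
  have lower: "(\<Sum>i<N. inverse (x i) * alternant N (?T i) \<mu>) =
     (\<Sum>j<N. if \<mu> (Suc j) < \<mu> j then ?q ^ (\<mu> j + (N - 1 - j)) * alternant N x (\<mu>(j := \<mu> j - 1)) else 0)
       + lowered_alternant N x \<mu>"
    if anti: "antimono \<mu>" and \<mu>: "\<And>i. i \<ge> N - 1 \<Longrightarrow> \<mu> i = 0" for \<mu>
  proof -
    let ?e = "\<lambda>b. \<mu> b + (N - 1 - b)"
    let ?D = "\<lambda>j. det (mat N N (\<lambda>(a, b). if b = j then inverse (x a) * x a ^ ?e b else x a ^ ?e b))"
    have "?q ^ ?e j * ?D j = (if \<mu> (Suc j) < \<mu> j then ?q ^ ?e j * alternant N x (\<mu>(j := \<mu> j - 1)) else 0) +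
       (if j = N - 1 then lowered_alternant N x \<mu> else 0)" if j: "j < N" for j
    proof -
      consider "j = N - 1" | "j < N - 1" "\<mu> (Suc j) < \<mu> j" | "j < N - 1" "\<mu> (Suc j) = \<mu> j"
        using j antimonoD[OF anti, of j "Suc j"] by fastforce
      then show ?thesis
      proof cases
        case 1
        have "?D j = lowered_alternant N x \<mu>"
          unfolding lowered_alternant_def using \<mu>[of j] 1 by (intro arg_cong[where f = det] eq_matI) auto
        then show ?thesis using 1 \<mu>[of j] \<mu>[of "Suc j"] by simp
      next
        case 2
        have "?D j = alternant N x (\<mu>(j := \<mu> j - 1))"
          unfolding alternant_def
        proof (intro arg_cong[where f = det] eq_matI)
          fix a b assume ab: "a < dim_row (mat N N (\<lambda>(i, k). x i ^ ((\<mu>(j := \<mu> j - 1)) k + (N - 1 - k))))"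
            "b < dim_col (mat N N (\<lambda>(i, k). x i ^ ((\<mu>(j := \<mu> j - 1)) k + (N - 1 - k))))"
          have "inverse (x a) * x a ^ (\<mu> j + m) = x a ^ (\<mu> j - 1 + m)" for m
            using 2 nz[of a] ab by (cases "\<mu> j") auto
          then show "mat N N (\<lambda>(a, b). if b = j then inverse (x a) * x a ^ ?e b else x a ^ ?e b) $$ (a, b) =
             mat N N (\<lambda>(i, k). x i ^ ((\<mu>(j := \<mu> j - 1)) k + (N - 1 - k))) $$ (a, b)"
            using ab by (simp del: Nat.add_diff_assoc Nat.add_diff_assoc2 diff_diff_left)
        qed auto
        then show ?thesis using 2 by simp
      next
        case 3
        \<comment> \<open>No cell can be removed from row \<open>j\<close>, and the lowered column equals the next one.\<close>
        have "inverse (x a) * x a ^ ?e j = x a ^ ?e (Suc j)" if "a < N" for a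
        proof -
          have e: "?e j = Suc (?e (Suc j))" using 3 by simp
          show ?thesis unfolding e power_Suc mult.assoc[symmetric] using nz[OF that] by simp
        qed
        then have "?D j = 0"
          using 3 by (intro det_equal_columns[of j N "Suc j"]) auto
        then show ?thesis using 3 by simp
      qed
    qed
    then show ?thesis
      unfolding alternant_operator using N by (simp add: sum.distrib)
  qed
  have "?s (V_coeff r (-1) f) * ?a0 =
     (r - inverse r) * ?s (partial_deriv 0 f) * ((1 - (\<Sum>i<N. ?W i)) * ?a0) +
     (\<Sum>i<N. (?W i * inverse (r * x i) * ?a0) * (specialize N (?T i) f - ?s f))"
    unfolding specialize_V_coeff_minus_1[OF r inj nz, simplified] distrib_right sum_distrib_right
    by (simp add: mult_ac)
  also have "\<dots> = ?c * (?s (partial_deriv 0 f) * ?a0) +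
     (\<Sum>i<N. ?c * (inverse (x i) * (specialize N (?T i) f * alternant N (?T i) (\<lambda>_. 0)) -
                   ?s f * (inverse (x i) * alternant N (?T i) (\<lambda>_. 0))))"
    unfolding W1
  proof (intro arg_cong2[where f = "(+)"] sum.cong refl)
    fix i assume "i \<in> {..<N}"
    then have i: "i < N" by simp
    show "(?W i * inverse (r * x i) * ?a0) * (specialize N (?T i) f - ?s f) =
       ?c * (inverse (x i) * (specialize N (?T i) f * alternant N (?T i) (\<lambda>_. 0)) -
                   ?s f * (inverse (x i) * alternant N (?T i) (\<lambda>_. 0)))"
      unfolding W2[OF i] by (simp only: right_diff_distrib mult_ac)
  qed (simp only: mult_ac)
  also have "\<dots> = ?c * (?s (partial_deriv 0 f) * ?a0 + (\<Sum>i<N. inverse (x i) * alternant N (?T i) \<nu>) -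
       ?s f * (\<Sum>i<N. inverse (x i) * alternant N (?T i) (\<lambda>_. 0)))"
  proof -
    have "specialize N (?T i) f * alternant N (?T i) (\<lambda>_. 0) = alternant N (?T i) \<nu>" for i
      by (rule representsD[OF f]) (use \<nu> in auto)
    then show ?thesis
      by (simp add: sum_distrib_left sum_subtractf distrib_left right_diff_distrib)
  qed
  also have "\<dots> = ?c * (\<Sum>j<N. if \<nu> (Suc j) < \<nu> j then ?q ^ (\<nu> j + (N - 1 - j)) * ?removed j else 0)"
  proof -
    have "?s (partial_deriv 0 f) * ?a0 = ?s f * lowered_alternant N x (\<lambda>_. 0) - lowered_alternant N x \<nu>"
      by (rule specialize_partial_deriv_represents[OF f N \<nu> nz])
    moreover have "(\<Sum>i<N. inverse (x i) * alternant N (?T i) (\<lambda>_. 0)) = lowered_alternant N x (\<lambda>_. 0)"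
      by (subst lower) (auto simp: monotone_def)
    ultimately show ?thesis using lower[OF anti \<nu>] by simp
  qed
  also have "\<dots> = (r - inverse r) * (\<Sum>j<N. if \<nu> (Suc j) < \<nu> j
        then ?q ^ \<nu> j * inverse ?q ^ Suc j * ?removed j else 0)"
    unfolding mult.assoc sum_distrib_left[of "inverse ?q ^ N"]
  proof (intro arg_cong2[where f = "(*)"] sum.cong refl)
    fix j assume "j \<in> {..<N}"
    then have "inverse ?q ^ N = inverse ?q ^ Suc j * inverse ?q ^ (N - 1 - j)"
      by (subst power_add[symmetric]) simp
    then show "inverse ?q ^ N * (if \<nu> (Suc j) < \<nu> j then ?q ^ (\<nu> j + (N - 1 - j)) * ?removed j else 0) =
       (if \<nu> (Suc j) < \<nu> j then ?q ^ \<nu> j * (inverse ?q ^ Suc j * ?removed j) else 0)"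
      using r by (simp only: power_add) (simp add: field_simps)
  qed
  finally show ?thesis .
qed

section \<open>Schur functions exist\<close>

lemma is_partition_bounded:
  assumes "is_partition \<nu>"
  obtains M where "\<And>i. i \<ge> M \<Longrightarrow> \<nu> i = 0"
proof -
  obtain M where "\<forall>i\<in>{i. \<nu> i \<noteq> 0}. i < M"
    using assms finite_nat_set_iff_bounded unfolding is_partition_def by blast
  then show ?thesis using that[of M] by (meson mem_Collect_eq not_le)
qed

lemma is_partition_add_iff:
  assumes "is_partition \<nu>"
  shows "is_partition (\<nu>(j := Suc (\<nu> j))) \<longleftrightarrow> j = 0 \<or> \<nu> j < \<nu> (j - 1)"
proof -
  have "finite {i. (\<nu>(j := Suc (\<nu> j))) i \<noteq> 0}"
    by (rule finite_subset[of _ "insert j {i. \<nu> i \<noteq> 0}"]) (use assms in \<open>auto simp: is_partition_def\<close>)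
  moreover have "antimono (\<nu>(j := Suc (\<nu> j))) \<longleftrightarrow> j = 0 \<or> \<nu> j < \<nu> (j - 1)"
  proof
    assume anti: "antimono (\<nu>(j := Suc (\<nu> j)))"
    show "j = 0 \<or> \<nu> j < \<nu> (j - 1)"
      using antimonoD[OF anti, of "j - 1" j] by (cases j) auto
  next
    assume j: "j = 0 \<or> \<nu> j < \<nu> (j - 1)"
    have anti: "antimono \<nu>" using assms by (simp add: is_partition_def)
    show "antimono (\<nu>(j := Suc (\<nu> j)))"
    proof (rule antimonoI)
      fix a b :: nat assume ab: "a \<le> b"
      have "\<nu> (j - 1) \<le> \<nu> a" if "a < j" using that by (intro antimonoD[OF anti]) auto
      then show "(\<nu>(j := Suc (\<nu> j))) b \<le> (\<nu>(j := Suc (\<nu> j))) a"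
        using j ab antimonoD[OF anti ab] by (cases "a = j"; cases "b = j") auto
    qed
  qed
  ultimately show ?thesis by (simp add: is_partition_def)
qed

lemma is_partition_remove_iff:
  assumes "is_partition \<nu>" "\<nu> j > 0"
  shows "is_partition (\<nu>(j := \<nu> j - 1)) \<longleftrightarrow> \<nu> (Suc j) < \<nu> j"
proof -
  have "finite {i. (\<nu>(j := \<nu> j - 1)) i \<noteq> 0}"
    by (rule finite_subset[of _ "insert j {i. \<nu> i \<noteq> 0}"]) (use assms in \<open>auto simp: is_partition_def\<close>)
  moreover have "antimono (\<nu>(j := \<nu> j - 1)) \<longleftrightarrow> \<nu> (Suc j) < \<nu> j"
  proof
    assume anti: "antimono (\<nu>(j := \<nu> j - 1))"
    show "\<nu> (Suc j) < \<nu> j"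
      using antimonoD[OF anti, of j "Suc j"] assms(2) by auto
  next
    assume j: "\<nu> (Suc j) < \<nu> j"
    have anti: "antimono \<nu>" using assms by (simp add: is_partition_def)
    show "antimono (\<nu>(j := \<nu> j - 1))"
    proof (rule antimonoI)
      fix a b :: nat assume "a \<le> b"
      then show "(\<nu>(j := \<nu> j - 1)) b \<le> (\<nu>(j := \<nu> j - 1)) a"
        using j antimonoD[OF anti, of a b] antimonoD[OF anti, of "Suc j" b] by (cases "a = b") auto
    qed
  qed
  ultimately show ?thesis by (simp add: is_partition_def)
qed

text \<open>
  The defining identity is polynomial in each variable, so it may be tested on distinct elements
  of an infinite set, for instance on nonzero elements or on constants.
\<close>

lemma representsI:
  fixes f :: "'a::field symfun"
  assumes S: "infinite S"
    and eq: "\<And>n x. (\<And>i. i \<ge> n \<Longrightarrow> \<nu> i = 0) \<Longrightarrow> inj_on x {..<n} \<Longrightarrow> x ` {..<n} \<subseteq> S \<Longrightarrow>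
      specialize n x f * alternant n x (\<lambda>_. 0) = alternant n x \<nu>"
  shows "represents f \<nu>"
  unfolding represents_def
proof (intro allI impI)
  fix n and x :: "nat \<Rightarrow> 'a" assume \<nu>: "\<forall>i\<ge>n. \<nu> i = 0"
  have "specialize n x f * alternant n x (\<lambda>_. 0) - alternant n x \<nu> = 0"
  proof (rule coordinatewise_poly_eq_0[where x = x and n = n, OF _ S])
    show "coordinatewise_poly n (\<lambda>x. specialize n x f * alternant n x (\<lambda>_. 0) - alternant n x \<nu>)"
      by (intro coordinatewise_poly_intros coordinatewise_poly_specialize coordinatewise_poly_alternant)
  qed (use eq \<nu> in auto)
  then show "specialize n x f * alternant n x (\<lambda>_. 0) = alternant n x \<nu>" by simp
qed

lemma represents_unique:
  fixes f g :: "'a::field_char_0 symfun"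
  assumes "is_partition \<nu>" "represents f \<nu>" "represents g \<nu>"
  shows "f = g"
proof -
  obtain M where M: "\<And>i. i \<ge> M \<Longrightarrow> \<nu> i = 0" using is_partition_bounded[OF assms(1)] by blast
  show ?thesis
  proof (rule symfun_eqI)
    fix n and x :: "nat \<Rightarrow> 'a" assume n: "n \<ge> M" and inj: "inj_on x {..<n}"
    have \<nu>: "\<nu> i = 0" if "i \<ge> n" for i using M that n by simp
    have "specialize n x f * alternant n x (\<lambda>_. 0) = specialize n x g * alternant n x (\<lambda>_. 0)"
      using representsD[OF assms(2), of n x] representsD[OF assms(3), of n x] \<nu> by simp
    then show "specialize n x f = specialize n x g" using alternant_0_nonzero[OF inj] by simp
  qed
qed

lemma alternant_not_addable:
  assumes "is_partition \<nu>" "\<not> is_partition (\<nu>(j := Suc (\<nu> j)))" "j < N"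
  shows "alternant N x (\<nu>(j := Suc (\<nu> j))) = 0"
proof -
  have j: "j \<noteq> 0" "\<not> \<nu> j < \<nu> (j - 1)" using assms is_partition_add_iff by auto
  moreover have "\<nu> j \<le> \<nu> (j - 1)"
    using assms(1) by (auto simp: is_partition_def monotone_def)
  ultimately have "\<nu> (j - 1) = \<nu> j" by simp
  then show ?thesis using j assms(3) by (intro alternant_repeated[of j N "j - 1"]) auto
qed

lemma specialize_V_coeff_1_addable:
  fixes f :: "'a::field_char_0 symfun"
  assumes p: "is_partition \<nu>" and f: "represents f \<nu>" and \<nu>: "\<And>i. i \<ge> N \<Longrightarrow> \<nu> i = 0"
    and r: "r \<noteq> 0" and inj: "inj_on x {..<N}" and nz: "\<And>i. i < N \<Longrightarrow> x i \<noteq> 0"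
  shows "specialize N x (V_coeff r 1 f) * alternant N x (\<lambda>_. 0) =
    (r - inverse r) * (\<Sum>j | j < N \<and> is_partition (\<nu>(j := Suc (\<nu> j))).
        (r ^ 2) ^ \<nu> j * inverse (r ^ 2) ^ j * alternant N x (\<nu>(j := Suc (\<nu> j))))"
proof -
  have "(\<Sum>j<N. (r ^ 2) ^ \<nu> j * inverse (r ^ 2) ^ j * alternant N x (\<nu>(j := Suc (\<nu> j)))) =
    (\<Sum>j | j < N \<and> is_partition (\<nu>(j := Suc (\<nu> j))).
        (r ^ 2) ^ \<nu> j * inverse (r ^ 2) ^ j * alternant N x (\<nu>(j := Suc (\<nu> j))))"
    by (rule sum.mono_neutral_right) (auto simp: alternant_not_addable[OF p])
  then show ?thesis using specialize_V_coeff_1_represents[OF f \<nu> r inj nz] by simp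
qed

lemma represents_0: "represents 1 (\<lambda>_. 0)"
  by (simp add: represents_def)

text \<open>
  The coefficient of \<open>t\<close> in the vertex operator at \<open>r = 2^i\<close> sends the Schur function of \<open>\<nu>\<close> to
  \<open>\<Sum>j. b_j^i s_(\<nu>+\<epsilon>_j)\<close>, up to a factor, where \<open>b_j = 4^(\<nu>_j - j)\<close>. The contents of the addable
  cells are distinct, so Lagrange interpolation in \<open>b_j\<close> isolates a single term.
\<close>

lemma represents_add_cell:
  fixes f :: "'a::field_char_0 symfun"
  assumes p: "is_partition \<nu>" and f: "represents f \<nu>" and k: "is_partition (\<nu>(k := Suc (\<nu> k)))"
  shows "\<exists>g :: 'a symfun. represents g (\<nu>(k := Suc (\<nu> k)))"
proof -
  let ?\<mu> = "\<lambda>j. \<nu>(j := Suc (\<nu> j))"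
  obtain M where M: "\<And>i. i \<ge> M \<Longrightarrow> \<nu> i = 0" using is_partition_bounded[OF p] by blast
  define b :: "nat \<Rightarrow> 'a" where "b = (\<lambda>j. 4 ^ \<nu> j * inverse 4 ^ j)"
  have b_less: "b j \<noteq> b j'" if "j < j'" for j j'
  proof
    assume "b j = b j'"
    then have "(4 :: 'a) ^ (\<nu> j + j') = 4 ^ (\<nu> j' + j)" by (simp add: b_def field_simps power_add)
    then have "of_nat (4 ^ (\<nu> j + j')) = (of_nat (4 ^ (\<nu> j' + j)) :: 'a)" by simp
    then have "(4 :: nat) ^ (\<nu> j + j') = 4 ^ (\<nu> j' + j)" by (simp only: of_nat_eq_iff)
    then have "\<nu> j + j' = \<nu> j' + j" by simp
    moreover have "\<nu> j' \<le> \<nu> j" using p that by (auto simp: is_partition_def monotone_def)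
    ultimately show False using that by simp
  qed
  have b_inj: "b j \<noteq> b j'" if "j \<noteq> j'" for j j'
    using b_less[of j j'] b_less[of j' j] that by (metis linorder_neqE_nat)
  \<comment> \<open>The factor \<open>X\<close> avoids the exponent \<open>i = 0\<close>, for which \<open>r = 1\<close> and the vertex operator vanishes.\<close>
  define L where "L = [:0, 1:] * (\<Prod>j\<in>{..M} - {k}. [:- b j, 1:])"
  have L0: "Polynomial.coeff L 0 = 0" by (simp add: L_def)
  have Lj: "poly L (b j) = 0" if "j \<le> M" "j \<noteq> k" for j
    using that by (auto simp: L_def poly_prod intro!: prod_zero bexI[of _ j])
  have "b k \<noteq> 0" by (simp add: b_def)
  moreover have "(\<Prod>j\<in>{..M} - {k}. b k - b j) \<noteq> 0"
    using b_inj by (subst prod_zero_iff) auto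
  ultimately have Lk: "poly L (b k) \<noteq> 0" by (simp add: L_def poly_prod)
  have two: "(2 :: 'a) ^ i - inverse (2 ^ i) \<noteq> 0" if "i \<ge> 1" for i
  proof
    assume "(2 :: 'a) ^ i - inverse (2 ^ i) = 0"
    then have "(2 :: 'a) ^ (i + i) = 1" by (simp add: field_simps power_add)
    then have "of_nat (2 ^ (i + i)) = (of_nat 1 :: 'a)" by simp
    then have "(2 :: nat) ^ (i + i) = 1" by (simp only: of_nat_eq_iff)
    then show False using that by simp
  qed
  define g where "g = scale (inverse (poly L (b k))) (\<Sum>i\<in>{1..degree L}.
     scale (Polynomial.coeff L i / (2 ^ i - inverse (2 ^ i))) (V_coeff (2 ^ i) 1 f))"
  have "represents g (?\<mu> k)"
  proof (rule representsI[OF infinite_nonzero])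
    fix n and x :: "nat \<Rightarrow> 'a"
    assume \<mu>: "\<And>i. i \<ge> n \<Longrightarrow> ?\<mu> k i = 0" and inj: "inj_on x {..<n}" and x: "x ` {..<n} \<subseteq> - {0}"
    have k_less: "k < n" using \<mu>[of k] by (metis fun_upd_same not_less nat.distinct(1))
    have \<nu>: "\<nu> i = 0" if "i \<ge> n" for i using \<mu>[OF that] k_less that by simp
    have nz: "x i \<noteq> 0" if "i < n" for i using x that by blast
    let ?a0 = "alternant n x (\<lambda>_. 0)"
    let ?J = "{j. j < n \<and> is_partition (?\<mu> j)}"
    have V: "specialize n x (V_coeff (2 ^ i) 1 f) * ?a0 =
      (2 ^ i - inverse (2 ^ i)) * (\<Sum>j\<in>?J. b j ^ i * alternant n x (?\<mu> j))" for i
    proof -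
      have "((2 :: 'a) ^ i) ^ 2 = (2 ^ 2) ^ i" by (simp only: power_mult[symmetric] mult.commute)
      then have four: "((2 :: 'a) ^ i) ^ 2 = 4 ^ i" by simp
      have b: "((4 :: 'a) ^ i) ^ \<nu> j * inverse (4 ^ i) ^ j = b j ^ i" for j
        by (simp only: b_def power_mult_distrib power_inverse power_mult[symmetric] mult.commute)
      have "specialize n x (V_coeff (2 ^ i) 1 f) * ?a0 = (2 ^ i - inverse (2 ^ i)) *
         (\<Sum>j\<in>?J. ((2 ^ i) ^ 2) ^ \<nu> j * inverse ((2 ^ i) ^ 2) ^ j * alternant n x (?\<mu> j))"
        by (rule specialize_V_coeff_1_addable[OF p f \<nu> _ inj nz]) (simp_all add: power_not_zero)
      then show ?thesis unfolding four b .
    qed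
    have "specialize n x g * ?a0 = inverse (poly L (b k)) * (\<Sum>i\<in>{1..degree L}.
       Polynomial.coeff L i / (2 ^ i - inverse (2 ^ i)) * (specialize n x (V_coeff (2 ^ i) 1 f) * ?a0))"
      by (simp add: g_def specialize_scale specialize_sum sum_distrib_right mult.assoc)
    also have "\<dots> = inverse (poly L (b k)) * (\<Sum>i\<in>{1..degree L}. \<Sum>j\<in>?J. Polynomial.coeff L i * b j ^ i * alternant n x (?\<mu> j))"
      unfolding V using two by (intro arg_cong2[where f = "(*)"] sum.cong) (auto simp: sum_distrib_left mult.assoc)
    also have "(\<Sum>i\<in>{1..degree L}. \<Sum>j\<in>?J. Polynomial.coeff L i * b j ^ i * alternant n x (?\<mu> j)) =
       (\<Sum>j\<in>?J. poly L (b j) * alternant n x (?\<mu> j))"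
    proof -
      have "poly L z = (\<Sum>i\<in>{1..degree L}. Polynomial.coeff L i * z ^ i)" for z
        unfolding poly_altdef by (rule sum.mono_neutral_right) (auto simp: L0 not_less_eq_eq[symmetric])
      then show ?thesis by (simp add: sum_distrib_right sum.swap[of _ ?J])
    qed
    also have "\<dots> = (\<Sum>j\<in>?J. if j = k then poly L (b k) * alternant n x (?\<mu> k) else 0)"
    proof (intro sum.cong refl)
      fix j assume "j \<in> ?J"
      then have "j = 0 \<or> \<nu> j < \<nu> (j - 1)" using is_partition_add_iff[OF p] by blast
      moreover have "\<nu> (j - 1) = 0" if "\<not> j \<le> M" using that by (intro M) simp
      ultimately have "j \<le> M" by (cases "j \<le> M") auto
      then show "poly L (b j) * alternant n x (?\<mu> j) = (if j = k then poly L (b k) * alternant n x (?\<mu> k) else 0)"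
        using Lj[of j] by auto
    qed
    also have "\<dots> = poly L (b k) * alternant n x (?\<mu> k)" using k k_less by simp
    finally show "specialize n x g * ?a0 = alternant n x (?\<mu> k)" using Lk by simp
  qed
  then show ?thesis by blast
qed

text \<open>
  Induction on the size, removing the last cell of the last row.
\<close>

lemma represents_exists:
  assumes "is_partition \<nu>"
  shows "\<exists>f :: 'a::field_char_0 symfun. represents f \<nu>"
  using assms
proof (induction "\<Sum>i | \<nu> i \<noteq> 0. \<nu> i" arbitrary: \<nu> rule: less_induct)
  case less
  have fin: "finite {i. \<nu> i \<noteq> 0}" using less.prems by (simp add: is_partition_def)
  show ?case
  proof (cases "{i. \<nu> i \<noteq> 0} = {}")
    case True
    then have "\<nu> = (\<lambda>_. 0)" by auto
    then show ?thesis using represents_0 by blast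
  next
    case False
    define k where "k = Max {i. \<nu> i \<noteq> 0}"
    have k: "\<nu> k \<noteq> 0" using Max_in[OF fin False] by (simp add: k_def)
    have k1: "\<nu> (Suc k) = 0"
    proof (rule ccontr)
      assume "\<nu> (Suc k) \<noteq> 0"
      then have "Suc k \<le> k" unfolding k_def using fin by (intro Max_ge) auto
      then show False by simp
    qed
    define \<mu> where "\<mu> = \<nu>(k := \<nu> k - 1)"
    have \<mu>: "is_partition \<mu>" unfolding \<mu>_def using is_partition_remove_iff[OF less.prems, of k] k k1 by simp
    have \<nu>: "\<nu> = \<mu>(k := Suc (\<mu> k))" using k by (auto simp: \<mu>_def)
    have "(\<Sum>i | \<mu> i \<noteq> 0. \<mu> i) = (\<Sum>i | \<nu> i \<noteq> 0. \<mu> i)"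
      by (rule sum.mono_neutral_left) (use fin k in \<open>auto simp: \<mu>_def\<close>)
    also have "\<dots> < (\<Sum>i | \<nu> i \<noteq> 0. \<nu> i)"
      by (rule sum_strict_mono_ex1) (use fin k in \<open>auto simp: \<mu>_def\<close>)
    finally obtain f :: "'a symfun" where f: "represents f \<mu>" using less.hyps \<mu> by blast
    have "is_partition (\<mu>(k := Suc (\<mu> k)))" by (subst \<nu>[symmetric]) (rule less.prems)
    from represents_add_cell[OF \<mu> f this] show ?thesis by (subst \<nu>)
  qed
qed

lemma represents_schur:
  assumes "is_partition \<nu>"
  shows "represents (schur \<nu> :: 'a::field_char_0 symfun) \<nu>"
proof -
  have eq: "schur \<nu> = (THE f :: 'a symfun. represents f \<nu>)"
    by (simp add: schur_def represents_def)
  obtain f :: "'a symfun" where "represents f \<nu>" using represents_exists[OF assms] by blast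
  then show ?thesis unfolding eq
    by (rule theI) (rule represents_unique[OF assms _ \<open>represents f \<nu>\<close>])
qed

section \<open>Schur functions span\<close>

inductive schur_span :: "'a::field_char_0 symfun \<Rightarrow> bool" where
  schur: "is_partition \<nu> \<Longrightarrow> schur_span (schur \<nu>)"
| zero: "schur_span 0"
| add: "schur_span f \<Longrightarrow> schur_span g \<Longrightarrow> schur_span (f + g)"
| scale: "schur_span f \<Longrightarrow> schur_span (scale c f)"

lemma schur_span_sum: "(\<And>a. a \<in> A \<Longrightarrow> schur_span (F a)) \<Longrightarrow> schur_span (sum F A)"
  by (induction A rule: infinite_finite_induct) (auto intro: schur_span.intros)

text \<open>
  Two adjacent columns are exchanged; since their positions contribute 1 to the difference of the
  exponents, the entry that moves up loses 1 and the entry that moves down gains 1.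
\<close>

lemma alternant_swap:
  assumes "Suc m < n" "\<nu> m < \<nu> (Suc m)"
  shows "alternant n x (\<nu>(m := \<nu> (Suc m) - 1, Suc m := Suc (\<nu> m))) = - alternant n x \<nu>"
proof -
  let ?A = "mat n n (\<lambda>(i, j). x i ^ (\<nu> j + (n - 1 - j)))"
  have "alternant n x (\<nu>(m := \<nu> (Suc m) - 1, Suc m := Suc (\<nu> m))) = det (swapcols m (Suc m) ?A)"
  proof -
    let ?\<tau> = "\<lambda>j. if j = m then Suc m else if j = Suc m then m else j"
    have exponent: "(\<nu>(m := \<nu> (Suc m) - 1, Suc m := Suc (\<nu> m))) j + (n - 1 - j) =
       \<nu> (?\<tau> j) + (n - 1 - ?\<tau> j)" for j
      using assms by auto
    show ?thesis unfolding alternant_def exponent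
      by (intro arg_cong[where f = det] eq_matI) (use assms in auto)
  qed
  also have "\<dots> = - det ?A" by (rule det_swapcols) (use assms in auto)
  finally show ?thesis by (simp add: alternant_def)
qed

text \<open>
  If the exponents of an alternant decrease strictly, it already belongs to a partition.
\<close>

lemma represent_decreasing_alternant:
  assumes \<gamma>: "\<And>i. i \<ge> n0 \<Longrightarrow> \<gamma> i = 0" and dec: "\<And>i k. i < k \<Longrightarrow> \<gamma> k + i < \<gamma> i + k"
  shows "\<exists>f :: 'a::field_char_0 symfun. schur_span f \<and>
    (\<forall>n\<ge>n0. \<forall>x. specialize n x f * alternant n x (\<lambda>_. 0) = alternant n x \<gamma>)"
proof -
  have "\<gamma> (Suc i) \<le> \<gamma> i" for i using dec[of i "Suc i"] by simp
  then have "antimono \<gamma>" by (simp add: antimono_iff_le_Suc)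
  moreover have "finite {i. \<gamma> i \<noteq> 0}"
    by (rule finite_subset[of _ "{..<n0}"]) (metis (mono_tags) \<gamma> finite_lessThan lessThan_iff mem_Collect_eq not_le subsetI)+
  ultimately have p: "is_partition \<gamma>" by (simp add: is_partition_def)
  have "specialize n x (schur \<gamma>) * alternant n x (\<lambda>_. 0) = alternant n x \<gamma>"
    if "n \<ge> n0" for n and x :: "nat \<Rightarrow> 'a"
    by (rule representsD[OF represents_schur[OF p]]) (use \<gamma> that in auto)
  then show ?thesis using schur_span.schur[OF p] by blast
qed

text \<open>
  Exponents that decrease except for one entry that may be too large are sorted by moving this
  entry up, past one neighbour at a time, until it meets an equal exponent or finds its place. The
  same steps work in any number of variables, so one symmetric function serves for all \<open>n\<close>.
\<close>

lemma straighten_alternant: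
  assumes "\<And>i. i \<ge> n0 \<Longrightarrow> \<gamma> i = 0" and "j < n0"
    and "\<And>i k. i < k \<Longrightarrow> i \<noteq> j \<Longrightarrow> k \<noteq> j \<Longrightarrow> \<gamma> k + i < \<gamma> i + k"
    and "\<And>k. j < k \<Longrightarrow> \<gamma> k + j < \<gamma> j + k"
  shows "\<exists>f :: 'a::field_char_0 symfun. schur_span f \<and>
    (\<forall>n\<ge>n0. \<forall>x. specialize n x f * alternant n x (\<lambda>_. 0) = alternant n x \<gamma>)"
  using assms
proof (induction j arbitrary: \<gamma>)
  case 0
  show ?case
  proof (rule represent_decreasing_alternant)
    show "\<gamma> k + i < \<gamma> i + k" if "i < k" for i k
      using "0.prems"(3)[of i k] "0.prems"(4)[of k] that by (cases "i = 0") auto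
  qed (rule "0.prems"(1))
next
  case (Suc m)
  consider "\<gamma> (Suc m) = Suc (\<gamma> m)" | "\<gamma> (Suc m) \<le> \<gamma> m" | "\<gamma> (Suc m) > Suc (\<gamma> m)" by linarith
  then show ?case
  proof cases
    case 1
    have "alternant n x \<gamma> = 0" if "n \<ge> n0" for n and x :: "nat \<Rightarrow> 'a"
      by (rule alternant_repeated[of m n "Suc m"]) (use 1 Suc.prems(2) that in auto)
    then show ?thesis by (intro exI[of _ 0]) (auto intro: schur_span.zero)
  next
    case 2
    note le = this
    show ?thesis
    proof (rule represent_decreasing_alternant)
      show "\<gamma> k + i < \<gamma> i + k" if less: "i < k" for i k
      proof -
        consider (other) "i \<noteq> Suc m" "k \<noteq> Suc m" | (first) "i = Suc m"
          | (adjacent) "k = Suc m" "i = m" | (second) "k = Suc m" "i < m"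
          using less by (metis less_Suc_eq)
        then show ?thesis
        proof cases
          case other
          then show ?thesis using Suc.prems(3) less by simp
        next
          case first
          then show ?thesis using Suc.prems(4) less by simp
        next
          case adjacent
          then show ?thesis using le by simp
        next
          case second
          then have "\<gamma> m + i < \<gamma> i + m" by (intro Suc.prems(3)) auto
          then show ?thesis using le second by simp
        qed
      qed
    qed (rule Suc.prems(1))
  next
    case 3
    let ?\<gamma> = "\<gamma>(m := \<gamma> (Suc m) - 1, Suc m := Suc (\<gamma> m))"
    have "\<exists>f :: 'a symfun. schur_span f \<and>
      (\<forall>n\<ge>n0. \<forall>x. specialize n x f * alternant n x (\<lambda>_. 0) = alternant n x ?\<gamma>)"
    proof (rule Suc.IH)
      show "?\<gamma> i = 0" if "i \<ge> n0" for i using Suc.prems(1)[OF that] Suc.prems(2) that by auto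
      show "m < n0" using Suc.prems(2) by simp
      show "?\<gamma> k + i < ?\<gamma> i + k" if less: "i < k" and ne: "i \<noteq> m" "k \<noteq> m" for i k
      proof -
        consider (first) "i = Suc m" | (second) "k = Suc m" "i < m" | (other) "i \<noteq> Suc m" "k \<noteq> Suc m"
          using less ne by (metis less_Suc_eq)
        then show ?thesis
        proof cases
          case first
          then have "\<gamma> k + m < \<gamma> m + k" using less by (intro Suc.prems(3)) auto
          then show ?thesis using first less by simp
        next
          case second
          then have "\<gamma> m + i < \<gamma> i + m" by (intro Suc.prems(3)) auto
          then show ?thesis using second by simp
        next
          case other
          then have "\<gamma> k + i < \<gamma> i + k" using less by (intro Suc.prems(3)) auto
          then show ?thesis using other ne by simp
        qed
      qed
      show "?\<gamma> k + m < ?\<gamma> m + k" if "m < k" for k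
      proof (cases "k = Suc m")
        case True
        then show ?thesis using 3 by simp
      next
        case False
        then have "\<gamma> k + Suc m < \<gamma> (Suc m) + k" using that by (intro Suc.prems(4)) auto
        then show ?thesis using False that by simp
      qed
    qed
    then obtain f :: "'a symfun" where f: "schur_span f"
      "\<forall>n\<ge>n0. \<forall>x. specialize n x f * alternant n x (\<lambda>_. 0) = alternant n x ?\<gamma>" by blast
    have "specialize n x (scale (- 1) f) * alternant n x (\<lambda>_. 0) = alternant n x \<gamma>" if "n \<ge> n0" for n x
      using f(2) that alternant_swap[of m n \<gamma> x] 3 Suc.prems(2) by (simp add: specialize_scale)
    then show ?thesis using f(1) by (intro exI[of _ "scale (- 1) f"]) (auto intro: schur_span.scale)
  qed
qed

text \<open>
  The Murnaghan-Nakayama rule: \<open>p_k a_(\<nu>+\<delta>)\<close> is the sum of the alternants with \<open>k\<close> added to one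
  exponent. Beyond row \<open>n0\<close> the raised exponent is already present \<open>k\<close> columns before.
\<close>

lemma schur_span_power_sum_mult_schur:
  assumes p: "is_partition \<nu>" and k: "k \<ge> 1"
  shows "schur_span (power_sum k * schur \<nu> :: 'a::field_char_0 symfun)"
proof -
  obtain M where M: "\<And>i. i \<ge> M \<Longrightarrow> \<nu> i = 0" using is_partition_bounded[OF p] by blast
  have anti: "antimono \<nu>" using p by (simp add: is_partition_def)
  define n0 where "n0 = M + k"
  have "\<forall>j\<in>{..<n0}. \<exists>f :: 'a symfun. schur_span f \<and>
    (\<forall>n\<ge>n0. \<forall>x. specialize n x f * alternant n x (\<lambda>_. 0) = alternant n x (\<nu>(j := \<nu> j + k)))"
  proof
    fix j assume j: "j \<in> {..<n0}"
    show "\<exists>f :: 'a symfun. schur_span f \<and>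
      (\<forall>n\<ge>n0. \<forall>x. specialize n x f * alternant n x (\<lambda>_. 0) = alternant n x (\<nu>(j := \<nu> j + k)))"
    proof (rule straighten_alternant[of n0 _ j])
      show "(\<nu>(j := \<nu> j + k)) i = 0" if "i \<ge> n0" for i using M that j by (auto simp: n0_def)
      show "j < n0" using j by simp
      show "(\<nu>(j := \<nu> j + k)) l + i < (\<nu>(j := \<nu> j + k)) i + l" if "i < l" "i \<noteq> j" "l \<noteq> j" for i l
        using that antimonoD[OF anti, of i l] by auto
      show "(\<nu>(j := \<nu> j + k)) l + j < (\<nu>(j := \<nu> j + k)) j + l" if "j < l" for l
        using that antimonoD[OF anti, of j l] by auto
    qed
  qed
  from bchoice[OF this] obtain F :: "nat \<Rightarrow> 'a symfun" where F: "\<And>j. j < n0 \<Longrightarrow> schur_span (F j)"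
    "\<And>j n x. j < n0 \<Longrightarrow> n \<ge> n0 \<Longrightarrow>
       specialize n x (F j) * alternant n x (\<lambda>_. 0) = alternant n x (\<nu>(j := \<nu> j + k))"
    by (metis lessThan_iff)
  have "power_sum k * schur \<nu> = (\<Sum>j<n0. F j)"
  proof (rule symfun_eqI)
    fix n and x :: "nat \<Rightarrow> 'a" assume n: "n \<ge> n0" and inj: "inj_on x {..<n}"
    let ?a0 = "alternant n x (\<lambda>_. 0)"
    have "specialize n x (power_sum k * schur \<nu>) * ?a0 = (\<Sum>i<n. x i ^ k) * alternant n x \<nu>"
      using representsD[OF represents_schur[OF p], of n x] M n k
      by (simp add: specialize_mult specialize_power_sum n0_def mult.assoc)
    also have "\<dots> = (\<Sum>i<n. x i ^ k * alternant n (x(i := 1 * x i)) \<nu>)"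
      by (simp add: sum_distrib_right)
    also have "\<dots> = (\<Sum>j<n. alternant n x (\<nu>(j := \<nu> j + k)))"
      unfolding alternant_operator_power by simp
    also have "\<dots> = (\<Sum>j<n0. alternant n x (\<nu>(j := \<nu> j + k)))"
    proof (rule sum.mono_neutral_right)
      show "\<forall>j\<in>{..<n} - {..<n0}. alternant n x (\<nu>(j := \<nu> j + k)) = 0"
      proof
        fix j assume j: "j \<in> {..<n} - {..<n0}"
        then have "\<nu> j = 0" "\<nu> (j - k) = 0" using M by (auto simp: n0_def)
        then show "alternant n x (\<nu>(j := \<nu> j + k)) = 0"
          using j k by (intro alternant_repeated[of j n "j - k"]) (auto simp: n0_def)
      qed
    qed (use n in auto)
    also have "\<dots> = specialize n x (\<Sum>j<n0. F j) * ?a0"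
      using F(2) n by (simp add: specialize_sum sum_distrib_right)
    finally show "specialize n x (power_sum k * schur \<nu>) = specialize n x (\<Sum>j<n0. F j)"
      using alternant_0_nonzero[OF inj] by simp
  qed
  then show ?thesis using F(1) by (auto intro!: schur_span_sum)
qed

lemma schur_span_power_sum_mult:
  assumes "schur_span f" "k \<ge> 1"
  shows "schur_span (power_sum k * f)"
  using assms(1)
proof induction
  case (schur \<nu>)
  then show ?case using assms(2) by (rule schur_span_power_sum_mult_schur)
next
  case (scale f c)
  then show ?case using schur_span.scale[of "power_sum k * f" c] by (simp add: scale_def mult.left_commute)
qed (simp_all add: schur_span.zero schur_span.add distrib_left)

lemma schur_span_all: "schur_span f"
proof (induction f rule: symfun_induct)
  case (single \<alpha> c)
  have "schur_span (Poly_Mapping.single \<alpha> (1 :: 'a))"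
  proof (induction \<alpha> rule: exponent_induct)
    case zero
    have p: "is_partition (\<lambda>_. 0)" by (simp add: is_partition_def monotone_def)
    have "schur (\<lambda>_. 0) = (1 :: 'a symfun)"
      using represents_unique[OF p represents_schur[OF p] represents_0] .
    then show ?case using schur_span.schur[OF p] by (metis single_one)
  next
    case (add \<alpha> i)
    have "Poly_Mapping.single (\<alpha> + Poly_Mapping.single i 1) (1 :: 'a) =
       power_sum (Suc i) * Poly_Mapping.single \<alpha> 1"
      by (simp add: power_sum_def mult_single add.commute)
    then show ?case using schur_span_power_sum_mult[OF add, of "Suc i"] by simp
  qed
  then have "schur_span (scale c (Poly_Mapping.single \<alpha> 1))" by (rule schur_span.scale)
  then show ?case by (simp add: scale_def mult_single)
next
  case (add f g)
  then show ?case by (rule schur_span.add)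
qed

section \<open>Adding and removing cells\<close>

text \<open>
  A diagram has no gaps in its rows, so the new cell stands at the end of its row.
\<close>

lemma diagram_insert_iff:
  "c \<notin> diagram \<nu> \<and> diagram \<mu> = insert c (diagram \<nu>) \<longleftrightarrow>
     snd c = \<nu> (fst c) \<and> \<mu> = \<nu>(fst c := Suc (\<nu> (fst c)))"
proof (cases c)
  case (Pair j b)
  show ?thesis
  proof
    assume "c \<notin> diagram \<nu> \<and> diagram \<mu> = insert c (diagram \<nu>)"
    then have nb: "\<not> b < \<nu> j" and mem: "b' < \<mu> i \<longleftrightarrow> (i = j \<and> b' = b) \<or> b' < \<nu> i" for i b'
      using Pair by (auto simp: diagram_def set_eq_iff)
    have "b < \<mu> j" using mem[of b j] by simp
    have b: "b = \<nu> j"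
    proof (rule ccontr)
      assume "b \<noteq> \<nu> j"
      then have "\<nu> j < b" using nb by simp
      then show False using mem[of "\<nu> j" j] \<open>b < \<mu> j\<close> by simp
    qed
    have "\<mu> i = (\<nu>(j := Suc (\<nu> j))) i" for i
    proof (cases "i = j")
      case True
      have "b' < \<mu> j \<longleftrightarrow> b' < Suc (\<nu> j)" for b' using mem[of b' j] b by auto
      then show ?thesis using True by (metis fun_upd_same linorder_neqE_nat less_irrefl)
    next
      case False
      have "b' < \<mu> i \<longleftrightarrow> b' < \<nu> i" for b' using mem[of b' i] False by auto
      then show ?thesis using False by (metis fun_upd_other linorder_neqE_nat less_irrefl)
    qed
    then show "snd c = \<nu> (fst c) \<and> \<mu> = \<nu>(fst c := Suc (\<nu> (fst c)))"
      using b Pair by auto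
  qed (use Pair in \<open>auto simp: diagram_def split: if_splits\<close>)
qed

lemma add_cell_iff:
  assumes "is_partition \<nu>"
  shows "add_cell \<nu> c \<mu> \<longleftrightarrow>
    (\<exists>j. is_partition (\<nu>(j := Suc (\<nu> j))) \<and> c = (j, \<nu> j) \<and> \<mu> = \<nu>(j := Suc (\<nu> j)))"
  unfolding add_cell_def diagram_insert_iff using assms by (cases c) auto

lemma remove_cell_iff:
  assumes "is_partition \<nu>"
  shows "add_cell \<mu> c \<nu> \<longleftrightarrow> (\<exists>j. \<nu> (Suc j) < \<nu> j \<and> c = (j, \<nu> j - 1) \<and> \<mu> = \<nu>(j := \<nu> j - 1))"
proof
  assume "add_cell \<mu> c \<nu>"
  then have *: "is_partition \<mu>" "snd c = \<mu> (fst c)" "\<nu> = \<mu>(fst c := Suc (\<mu> (fst c)))"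
    unfolding add_cell_def diagram_insert_iff by auto
  let ?j = "fst c"
  have "\<nu> ?j - 1 = \<mu> ?j" using *(3) by (metis diff_Suc_1 fun_upd_same)
  moreover from this have \<mu>: "\<mu> = \<nu>(?j := \<nu> ?j - 1)" using *(3) by auto
  moreover have "\<nu> ?j > 0" using *(3) by (metis fun_upd_same zero_less_Suc)
  ultimately show "\<exists>j. \<nu> (Suc j) < \<nu> j \<and> c = (j, \<nu> j - 1) \<and> \<mu> = \<nu>(j := \<nu> j - 1)"
    using is_partition_remove_iff[OF assms, of ?j] *(1,2) by (metis prod.collapse)
next
  assume "\<exists>j. \<nu> (Suc j) < \<nu> j \<and> c = (j, \<nu> j - 1) \<and> \<mu> = \<nu>(j := \<nu> j - 1)"
  then obtain j where j: "\<nu> (Suc j) < \<nu> j" "c = (j, \<nu> j - 1)" "\<mu> = \<nu>(j := \<nu> j - 1)" by blast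
  then have "is_partition \<mu>" using is_partition_remove_iff[OF assms, of j] by simp
  then show "add_cell \<mu> c \<nu>"
    unfolding add_cell_def diagram_insert_iff using assms j by auto
qed

section \<open>Extension of scalars\<close>

lemma lookup_extend_scalars:
  "Poly_Mapping.lookup (extend_scalars f) \<alpha> = fls_const (Poly_Mapping.lookup f \<alpha>)"
  by (simp add: extend_scalars_def Poly_Mapping.map.rep_eq when_def)

lemma extend_scalars_add: "extend_scalars (f + g) = extend_scalars f + extend_scalars g"
  by (rule poly_mapping_eqI) (simp add: lookup_extend_scalars lookup_add fls_plus_const)

lemma extend_scalars_scale: "extend_scalars (scale c f) = scale (fls_const c) (extend_scalars f)"
  by (rule poly_mapping_eqI) (simp add: lookup_extend_scalars lookup_scale)

lemma extend_scalars_single: "extend_scalars (Poly_Mapping.single \<alpha> c) = Poly_Mapping.single \<alpha> (fls_const c)"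
  by (rule poly_mapping_eqI) (simp add: lookup_extend_scalars lookup_single when_def)

lemma lookup_laurent_expand:
  "Poly_Mapping.lookup (fls_nth (laurent_expand g) k) \<alpha> = fls_nth (Poly_Mapping.lookup g \<alpha>) k"
proof -
  have lookup: "Poly_Mapping.lookup (Poly_Mapping.map (\<lambda>c. fls_nth c m) g) \<beta> = fls_nth (Poly_Mapping.lookup g \<beta>) m"
    for m \<beta> by (simp add: Poly_Mapping.map.rep_eq when_def)
  obtain N where N: "\<forall>\<beta>\<in>Poly_Mapping.keys g. N \<le> fls_subdegree (Poly_Mapping.lookup g \<beta>)"
  proof
    show "\<forall>\<beta>\<in>Poly_Mapping.keys g. Min ((\<lambda>\<beta>. fls_subdegree (Poly_Mapping.lookup g \<beta>)) ` Poly_Mapping.keys g)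
        \<le> fls_subdegree (Poly_Mapping.lookup g \<beta>)"
      by (intro ballI Min_le) auto
  qed
  have "fls_nth (laurent_expand g) k = Poly_Mapping.map (\<lambda>c. fls_nth c k) g"
    unfolding laurent_expand_def
  proof (rule nth_Abs_fls_lower_bound[of N], intro allI impI)
    fix m assume "m < N"
    then show "Poly_Mapping.map (\<lambda>c. fls_nth c m) g = 0"
      using N by (auto simp: map_eq_zero_iff)
  qed
  then show ?thesis by (simp add: lookup)
qed

lemma laurent_expand_add:
  "fls_nth (laurent_expand (g + h)) k = fls_nth (laurent_expand g) k + fls_nth (laurent_expand h) k"
  by (rule poly_mapping_eqI) (simp add: lookup_laurent_expand lookup_add)

lemma laurent_expand_scale_const:
  "fls_nth (laurent_expand (scale (fls_const c) g)) k = scale c (fls_nth (laurent_expand g) k)"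
  by (rule poly_mapping_eqI) (simp add: lookup_laurent_expand lookup_scale)

lemma laurent_expand_single:
  "fls_nth (laurent_expand (Poly_Mapping.single \<alpha> c)) k = Poly_Mapping.single \<alpha> (fls_nth c k)"
  by (rule poly_mapping_eqI) (simp add: lookup_laurent_expand lookup_single when_def)

lemma (in comm_ring_hom) hom_monomial_value:
  "monomial_value (\<lambda>i. hom (\<phi> i)) \<alpha> = hom (monomial_value \<phi> \<alpha>)"
  by (simp add: monomial_value_def hom_prod hom_power)

lemma fls_const_power_sums:
  fixes x :: "nat \<Rightarrow> 'a::comm_ring_1"
  shows "(\<Sum>j<n. fls_const (x j) ^ k) = fls_const (\<Sum>j<n. x j ^ k)"
proof -
  interpret comm_ring_hom "fls_const :: 'a \<Rightarrow> 'a fls" by (rule comm_ring_hom_fls_const)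
  show ?thesis by (simp add: hom_sum hom_power)
qed

lemma specialize_laurent_expand:
  "specialize n x (fls_nth (laurent_expand g) k) = fls_nth (specialize n (\<lambda>i. fls_const (x i)) g) k"
proof (induction g rule: symfun_induct)
  case (single \<alpha> c)
  show ?case
    by (simp add: laurent_expand_single specialize_eq_evaluate evaluate_single[OF comm_ring_hom_id]
        fls_const_power_sums comm_ring_hom.hom_monomial_value[OF comm_ring_hom_fls_const] del: power_Suc)
next
  case (add g h)
  then show ?case by (simp add: laurent_expand_add specialize_add)
qed

lemma specialize_extend_scalars:
  "specialize n (\<lambda>i. fls_const (x i)) (extend_scalars f) = fls_const (specialize n x f)"
proof (induction f rule: symfun_induct)
  case (single \<alpha> c)
  show ?case
    by (simp add: extend_scalars_single specialize_eq_evaluate evaluate_single[OF comm_ring_hom_id]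
        fls_const_power_sums comm_ring_hom.hom_monomial_value[OF comm_ring_hom_fls_const] del: power_Suc)
next
  case (add g h)
  then show ?case by (simp add: extend_scalars_add specialize_add fls_plus_const)
qed

lemma alternant_fls_const: "alternant n (\<lambda>i. fls_const (x i)) \<nu> = fls_const (alternant n x \<nu>)"
proof -
  interpret comm_ring_hom "fls_const :: 'a \<Rightarrow> 'a fls" by (rule comm_ring_hom_fls_const)
  have "mat n n (\<lambda>(i, j). fls_const (x i) ^ (\<nu> j + (n - 1 - j))) =
      map_mat fls_const (mat n n (\<lambda>(i, j). x i ^ (\<nu> j + (n - 1 - j))))"
    by (rule eq_matI) (auto simp: hom_power)
  then show ?thesis by (simp add: alternant_def hom_det)
qed

lemma fls_const_inject: "fls_const a = fls_const b \<longleftrightarrow> a = b"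
proof
  assume "fls_const a = fls_const b"
  then have "fls_nth (fls_const a) 0 = fls_nth (fls_const b) 0" by simp
  then show "a = b" by simp
qed simp

text \<open>
  A polynomial identity over \<open>K\<close>, being valid at all constant points, is valid at all points of
  \<open>K((x))\<close>. This is needed because the vertex operator replaces a constant variable by its
  multiple by \<open>e^x\<close>.
\<close>

lemma represents_extend_scalars:
  fixes f :: "'a::field_char_0 symfun"
  assumes "represents f \<nu>"
  shows "represents (extend_scalars f) \<nu>"
proof (rule representsI)
  show "infinite (range (fls_const :: 'a \<Rightarrow> 'a fls))"
  proof (rule infinite_super)
    show "range (of_nat :: nat \<Rightarrow> 'a fls) \<subseteq> range fls_const" by (auto simp: fls_of_nat)
    show "infinite (range (of_nat :: nat \<Rightarrow> 'a fls))" by (rule range_inj_infinite) (simp add: inj_def)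
  qed
  fix n and y :: "nat \<Rightarrow> 'a fls"
  assume \<nu>: "\<And>i. i \<ge> n \<Longrightarrow> \<nu> i = 0" and y: "y ` {..<n} \<subseteq> range fls_const"
  define x where "x = (\<lambda>i. fls_nth (y i) 0)"
  have y: "y i = fls_const (x i)" if "i < n" for i
  proof -
    have "y i \<in> range fls_const" using y that by blast
    then show ?thesis by (auto simp: x_def)
  qed
  have "specialize n y g = specialize n (\<lambda>i. fls_const (x i)) g" for g
    unfolding specialize_eq_evaluate by (simp add: y)
  moreover have "alternant n y \<mu> = alternant n (\<lambda>i. fls_const (x i)) \<mu>" for \<mu>
    unfolding alternant_def by (intro arg_cong[where f = det] eq_matI) (auto simp: y)
  ultimately show "specialize n y (extend_scalars f) * alternant n y (\<lambda>_. 0) = alternant n y \<nu>"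
    using representsD[OF assms, of n x] \<nu>
    by (simp add: specialize_extend_scalars alternant_fls_const)
qed

lemma exp_x_add: "exp_x (a + b) = exp_x a * exp_x b"
  by (simp add: exp_x_def fps_exp_add_mult fls_times_fps_to_fls)

lemma exp_x_0: "exp_x 0 = 1"
  by (simp add: exp_x_def)

lemma exp_x_nonzero: "exp_x c \<noteq> 0"
  using exp_x_add[of c "- c"] by (auto simp: exp_x_0)

lemma exp_x_minus: "exp_x (- c) = inverse (exp_x c)"
  using exp_x_add[of c "- c"] by (intro inverse_unique[symmetric]) (simp add: exp_x_0)

lemma exp_x_power: "exp_x c ^ n = exp_x (of_nat n * c)"
  by (induction n) (simp_all add: exp_x_0 exp_x_add distrib_right)

lemma fls_nth_exp_x: "fls_nth (exp_x c) k = (if k < 0 then 0 else c ^ nat k / fact (nat k))"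
  by (simp add: exp_x_def)

lemma exp_x_half_power:
  "(exp_x (1 / 2) ^ 2) ^ a * inverse (exp_x (1 / 2) ^ 2) ^ b = exp_x (of_int (int a - int b) :: 'a::field_char_0)"
proof -
  have "exp_x (1 / 2 :: 'a) ^ 2 = exp_x 1" by (simp add: exp_x_power)
  then show ?thesis
    by (simp add: exp_x_minus[symmetric] exp_x_power exp_x_add[symmetric])
qed

lemma exp_x_half_diff_nonzero: "exp_x (1 / 2) - exp_x (- 1 / 2 :: 'a::field_char_0) \<noteq> 0"
proof
  assume "exp_x (1 / 2) - exp_x (- 1 / 2 :: 'a) = 0"
  then have "fls_nth (exp_x (1 / 2) - exp_x (- 1 / 2 :: 'a)) 1 = 0" by simp
  then show False by (simp add: fls_nth_exp_x)
qed

section \<open>The operators U and D\<close>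

text \<open>
  The coefficient of \<open>x^k\<close> in \<open>[t^s] V(e^x, t) / (e^(x/2) - e^(-x/2))\<close>.
\<close>

definition vertex_coeff :: "int \<Rightarrow> int \<Rightarrow> 'a::field_char_0 symfun \<Rightarrow> 'a symfun" where
  "vertex_coeff s k f = fls_nth (laurent_expand (scale (1 / (exp_x (1/2) - exp_x (-1/2)))
     (V_coeff (exp_x (1/2)) s (extend_scalars f)))) k"

lemma vertex_coeff_add: "vertex_coeff s k (f + g) = vertex_coeff s k f + vertex_coeff s k g"
  by (simp add: vertex_coeff_def extend_scalars_add V_coeff_add scale_add laurent_expand_add)

lemma vertex_coeff_scale: "vertex_coeff s k (scale c f) = scale c (vertex_coeff s k f)"
proof -
  have "scale a (scale (fls_const c) g) = scale (fls_const c) (scale a g)" for a and g :: "'a fls symfun"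
    by (simp add: scale_scale mult.commute)
  then show ?thesis
    by (simp add: vertex_coeff_def extend_scalars_scale V_coeff_scale laurent_expand_scale_const)
qed

lemma vertex_coeff_0: "vertex_coeff s k 0 = 0"
  using vertex_coeff_add[of s k 0 0] by simp

text \<open>
  Values at constant points commute with taking the coefficient of \<open>x^k\<close>, so an identity over
  \<open>K((x))\<close> between values yields an identity between symmetric functions over \<open>K\<close>.
\<close>

lemma vertex_coeff_eqI:
  fixes f :: "'a::field_char_0 symfun" and C :: "nat \<Rightarrow> int"
  assumes J: "finite J"
    and eq: "\<And>n x. n \<ge> n0 \<Longrightarrow> inj_on x {..<n} \<Longrightarrow> (\<And>i. i < n \<Longrightarrow> x i \<noteq> 0) \<Longrightarrow>
      specialize n x (V_coeff (exp_x (1/2)) s (extend_scalars f)) * alternant n x (\<lambda>_. 0) =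
      (exp_x (1/2) - inverse (exp_x (1/2))) * (\<Sum>j\<in>J. exp_x (of_int (C j)) * alternant n x (\<mu> j))"
    and \<mu>: "\<And>j. j \<in> J \<Longrightarrow> is_partition (\<mu> j)"
    and len: "\<And>j i. j \<in> J \<Longrightarrow> i \<ge> n0 \<Longrightarrow> \<mu> j i = 0"
  shows "vertex_coeff s k f = (\<Sum>j\<in>J. scale (fls_nth (exp_x (of_int (C j))) k) (schur (\<mu> j)))"
proof (rule symfun_eqI)
  fix n and x :: "nat \<Rightarrow> 'a"
  assume n: "n \<ge> n0" and inj: "inj_on x {..<n}" and nz: "\<And>i. i < n \<Longrightarrow> x i \<noteq> 0"
  let ?x = "\<lambda>i. fls_const (x i)" and ?E = "exp_x (1/2) - exp_x (-1/2) :: 'a fls"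
  let ?a0 = "alternant n x (\<lambda>_. 0)"
  have inv: "inverse (exp_x (1/2)) = exp_x (-1/2 :: 'a)" using exp_x_minus[of "1/2 :: 'a"] by simp
  have inj': "inj_on ?x {..<n}"
    using inj by (auto simp: inj_on_def fls_const_inject)
  have times_const: "fls_nth (g * fls_const c) k = fls_nth g k * c" for g and c :: 'a
    by simp
  have "specialize n x (vertex_coeff s k f) * ?a0 =
      fls_nth (1 / ?E * (specialize n ?x (V_coeff (exp_x (1/2)) s (extend_scalars f)) * alternant n ?x (\<lambda>_. 0))) k"
    unfolding vertex_coeff_def specialize_laurent_expand alternant_fls_const specialize_scale times_const[symmetric]
    by (simp only: mult.assoc)
  also have "specialize n ?x (V_coeff (exp_x (1/2)) s (extend_scalars f)) * alternant n ?x (\<lambda>_. 0) =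
     ?E * (\<Sum>j\<in>J. exp_x (of_int (C j)) * alternant n ?x (\<mu> j))"
    by (rule eq[OF n inj', unfolded inv]) (simp add: nz)
  also have "1 / ?E * (?E * (\<Sum>j\<in>J. exp_x (of_int (C j)) * alternant n ?x (\<mu> j))) =
     (\<Sum>j\<in>J. exp_x (of_int (C j)) * fls_const (alternant n x (\<mu> j)))"
    using exp_x_half_diff_nonzero[where 'a = 'a] by (simp add: alternant_fls_const)
  also have "fls_nth \<dots> k = (\<Sum>j\<in>J. fls_nth (exp_x (of_int (C j))) k * alternant n x (\<mu> j))"
    by (simp add: fls_nth_sum)
  also have "\<dots> = specialize n x (\<Sum>j\<in>J. scale (fls_nth (exp_x (of_int (C j))) k) (schur (\<mu> j))) * ?a0"
  proof -
    have "specialize n x (schur (\<mu> j)) * ?a0 = alternant n x (\<mu> j)" if "j \<in> J" for j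
      by (rule representsD[OF represents_schur[OF \<mu>[OF that]]]) (use len[OF that] n in auto)
    then show ?thesis
      by (simp add: specialize_sum specialize_scale sum_distrib_right mult.assoc)
  qed
  finally show "specialize n x (vertex_coeff s k f) =
      specialize n x (\<Sum>j\<in>J. scale (fls_nth (exp_x (of_int (C j))) k) (schur (\<mu> j)))"
    using alternant_0_nonzero[OF inj] by simp
qed

lemma vertex_coeff_1_schur:
  assumes p: "is_partition \<nu>"
  shows "vertex_coeff 1 k (schur \<nu> :: 'a::field_char_0 symfun) =
    (\<Sum>(c, \<mu>)\<in>{(c, \<mu>). add_cell \<nu> c \<mu>}. scale (fls_nth (exp_x (of_int (content c))) k) (schur \<mu>))"
proof -
  obtain M where M: "\<And>i. i \<ge> M \<Longrightarrow> \<nu> i = 0" using is_partition_bounded[OF p] by blast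
  let ?J = "{j. is_partition (\<nu>(j := Suc (\<nu> j)))}"
  have J: "j \<le> M" if "j \<in> ?J" for j
  proof (rule ccontr)
    assume j: "\<not> j \<le> M"
    then have "\<nu> (j - 1) = 0" by (intro M) simp
    then show False using j that is_partition_add_iff[OF p, of j] by auto
  qed
  have "vertex_coeff 1 k (schur \<nu> :: 'a symfun) =
     (\<Sum>j\<in>?J. scale (fls_nth (exp_x (of_int (int (\<nu> j) - int j))) k) (schur (\<nu>(j := Suc (\<nu> j)))))"
  proof (rule vertex_coeff_eqI[where ?n0.0 = "Suc M"])
    show "finite ?J" using J by (intro finite_subset[of ?J "{..M}"]) auto
    show "(\<nu>(j := Suc (\<nu> j))) i = 0" if "j \<in> ?J" "i \<ge> Suc M" for i j
      using J[OF that(1)] that M by auto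
    fix n and x :: "nat \<Rightarrow> 'a fls"
    assume n: "n \<ge> Suc M" and x: "inj_on x {..<n}" "\<And>i. i < n \<Longrightarrow> x i \<noteq> 0"
    have \<nu>: "\<nu> i = 0" if "i \<ge> n" for i using M n that by simp
    have "{j. j < n \<and> is_partition (\<nu>(j := Suc (\<nu> j)))} = ?J" using J n by fastforce
    then show "specialize n x (V_coeff (exp_x (1/2)) 1 (extend_scalars (schur \<nu> :: 'a symfun))) * alternant n x (\<lambda>_. 0) =
      (exp_x (1/2) - inverse (exp_x (1/2))) *
        (\<Sum>j\<in>?J. exp_x (of_int (int (\<nu> j) - int j)) * alternant n x (\<nu>(j := Suc (\<nu> j))))"
      using specialize_V_coeff_1_addable[OF p represents_extend_scalars[OF represents_schur[OF p]] \<nu> exp_x_nonzero x]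
      by (simp only: exp_x_half_power)
  qed auto
  also have "\<dots> = (\<Sum>(c, \<mu>)\<in>{(c, \<mu>). add_cell \<nu> c \<mu>}. scale (fls_nth (exp_x (of_int (content c))) k) (schur \<mu>))"
    by (rule sum.reindex_bij_witness[of _ "\<lambda>(c, \<mu>). fst c" "\<lambda>j. ((j, \<nu> j), \<nu>(j := Suc (\<nu> j)))"])
       (auto simp: add_cell_iff[OF p] content_def)
  finally show ?thesis .
qed

lemma vertex_coeff_minus_1_schur:
  assumes p: "is_partition \<nu>"
  shows "vertex_coeff (-1) k (schur \<nu> :: 'a::field_char_0 symfun) =
    (\<Sum>(c, \<mu>)\<in>{(c, \<mu>). add_cell \<mu> c \<nu>}. scale (fls_nth (exp_x (of_int (content c))) k) (schur \<mu>))"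
proof -
  obtain M where M: "\<And>i. i \<ge> M \<Longrightarrow> \<nu> i = 0" using is_partition_bounded[OF p] by blast
  have anti: "antimono \<nu>" using p by (simp add: is_partition_def)
  let ?J = "{j. \<nu> (Suc j) < \<nu> j}"
  have J: "j < M" if "j \<in> ?J" for j using M[of j] that by (cases "j < M") auto
  have "vertex_coeff (-1) k (schur \<nu> :: 'a symfun) =
     (\<Sum>j\<in>?J. scale (fls_nth (exp_x (of_int (int (\<nu> j) - int (Suc j)))) k) (schur (\<nu>(j := \<nu> j - 1))))"
  proof (rule vertex_coeff_eqI[where ?n0.0 = "Suc M"])
    show "finite ?J" using J by (intro finite_subset[of ?J "{..<M}"]) auto
    show "(\<nu>(j := \<nu> j - 1)) i = 0" if "j \<in> ?J" "i \<ge> Suc M" for i j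
      using J[OF that(1)] that M by auto
    show "is_partition (\<nu>(j := \<nu> j - 1))" if "j \<in> ?J" for j
      using that is_partition_remove_iff[OF p, of j] by simp
    fix n and x :: "nat \<Rightarrow> 'a fls"
    assume n: "n \<ge> Suc M" and x: "inj_on x {..<n}" "\<And>i. i < n \<Longrightarrow> x i \<noteq> 0"
    have \<nu>: "\<nu> i = 0" if "i \<ge> n - 1" for i using M n that by simp
    have n1: "n \<ge> 1" using n by simp
    let ?F = "\<lambda>j. exp_x (of_int (int (\<nu> j) - int (Suc j))) * alternant n x (\<nu>(j := \<nu> j - 1))"
    have "(\<Sum>j<n. if \<nu> (Suc j) < \<nu> j then ?F j else 0) = (\<Sum>j\<in>?J. ?F j)"
      by (rule sum.mono_neutral_cong_right) (use J n in fastforce)+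
    then show "specialize n x (V_coeff (exp_x (1/2)) (-1) (extend_scalars (schur \<nu> :: 'a symfun))) * alternant n x (\<lambda>_. 0) =
      (exp_x (1/2) - inverse (exp_x (1/2))) * (\<Sum>j\<in>?J. ?F j)"
      using specialize_V_coeff_minus_1_represents[OF represents_extend_scalars[OF represents_schur[OF p]]
          anti n1 \<nu> exp_x_nonzero x]
      by (simp only: exp_x_half_power)
  qed
  also have "\<dots> = (\<Sum>(c, \<mu>)\<in>{(c, \<mu>). add_cell \<mu> c \<nu>}. scale (fls_nth (exp_x (of_int (content c))) k) (schur \<mu>))"
    by (rule sum.reindex_bij_witness[of _ "\<lambda>(c, \<mu>). fst c" "\<lambda>j. ((j, \<nu> j - 1), \<nu>(j := \<nu> j - 1))"])
       (auto simp: remove_cell_iff[OF p] content_def of_nat_diff diff_diff_eq)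
  finally show ?thesis .
qed

lemma linear_eq_on_schur:
  fixes T T' :: "'a::field_char_0 symfun \<Rightarrow> 'a symfun"
  assumes "Vector_Spaces.linear scale scale T" "Vector_Spaces.linear scale scale T'"
    and "\<And>\<nu>. is_partition \<nu> \<Longrightarrow> T (schur \<nu>) = T' (schur \<nu>)"
  shows "T = T'"
proof
  fix f
  interpret T: Vector_Spaces.linear scale scale T by fact
  interpret T': Vector_Spaces.linear scale scale T' by fact
  from schur_span_all[of f] show "T f = T' f"
    by induction (simp_all add: assms(3) T.add T'.add T.scale T'.scale T.zero T'.zero)
qed

lemma linear_vertex_coeff: "Vector_Spaces.linear scale scale (\<lambda>f. scale a (vertex_coeff s k f))"
  by (simp add: Vector_Spaces.linear_iff vector_space_scale vertex_coeff_add vertex_coeff_scale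
      scale_add scale_scale mult.commute)

lemma scale_fact_exp_coeff:
  "scale (fact k) (\<Sum>(c, \<mu>)\<in>A. scale (fls_nth (exp_x (of_int (content c))) (int k)) (schur \<mu>)) =
   (\<Sum>(c, \<mu>)\<in>A. scale (of_int (content c) ^ k) (schur \<mu> :: 'a::field_char_0 symfun))"
  by (auto simp: scale_sum scale_scale fls_nth_exp_x intro!: sum.cong)

text \<open>
  The coefficients of the vertex operator provide a linear operator with the required values on
  Schur functions; it is the only one, as Schur functions span.
\<close>

lemma U_op_eq: "U_op k = (\<lambda>f. scale (fact k) (vertex_coeff 1 (int k) f))"
  unfolding U_op_def
  by (rule the_equality)
     (auto simp: linear_vertex_coeff vertex_coeff_1_schur scale_fact_exp_coeff intro!: linear_eq_on_schur)

lemma D_op_eq: "D_op k = (\<lambda>f. scale (fact k) (vertex_coeff (-1) (int k) f))"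
  unfolding D_op_def
  by (rule the_equality)
     (auto simp: linear_vertex_coeff vertex_coeff_minus_1_schur scale_fact_exp_coeff intro!: linear_eq_on_schur)

lemma vertex_coeff_negative:
  assumes "k < 0" "s = 1 \<or> s = - 1"
  shows "vertex_coeff s k f = 0"
  using schur_span_all[of f]
proof induction
  case (schur \<nu>)
  then show ?case using assms
    by (auto simp: vertex_coeff_1_schur vertex_coeff_minus_1_schur fls_nth_exp_x)
qed (simp_all add: vertex_coeff_0 vertex_coeff_add vertex_coeff_scale)

theorem theorem5p4:
  fixes f :: "'a::field_char_0 symfun"
  shows "fps_to_fls (U_series f) =
           laurent_expand (scale (1 / (exp_x (1/2) - exp_x (-1/2)))
             (V_coeff (exp_x (1/2)) 1 (extend_scalars f))) \<and>
         fps_to_fls (D_series f) =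
           laurent_expand (scale (1 / (exp_x (1/2) - exp_x (-1/2)))
             (V_coeff (exp_x (1/2)) (-1) (extend_scalars f)))"
proof
  show "fps_to_fls (U_series f) =
           laurent_expand (scale (1 / (exp_x (1/2) - exp_x (-1/2)))
             (V_coeff (exp_x (1/2)) 1 (extend_scalars f)))"
    by (rule fls_eqI, unfold vertex_coeff_def[symmetric])
       (simp add: U_series_def U_op_eq scale_scale vertex_coeff_negative)
  show "fps_to_fls (D_series f) =
           laurent_expand (scale (1 / (exp_x (1/2) - exp_x (-1/2)))
             (V_coeff (exp_x (1/2)) (-1) (extend_scalars f)))"
    by (rule fls_eqI, unfold vertex_coeff_def[symmetric])
       (simp add: D_series_def D_op_eq scale_scale vertex_coeff_negative)
qed

end
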